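(* Let $p,r,\ell_0,m_0\in\mathbb{C}$ be such that $q^{2m_0+k}\neq -1$, $q^{2\ell_0+2k}\neq 1$, and $q^{4\ell_0+2k}\neq 1$ for all $k\in\mathbb{Z}$. Then the representation $V_{\ell_0,m_0}^{p,r}$ of $U_q^{\mathrm{tw}}(\mathfrak{so}_4)$ has (finite) length at most $6$. Moreover, if for all $k\in\mathbb{Z}$ we have $q^{2p+2\ell_0+2k}\neq 1$, $q^{2p-2\ell_0+2k}\neq 1$, $q^{2\ell_0+2r+2k}\neq 1$, $q^{2\ell_0-2r+2k}\neq 1$, $q^{2\ell_0+2m_0+2k}\neq 1$, and $q^{2\ell_0-2m_0+2k}\neq 1$, then $V_{\ell_0,m_0}^{p,r}$ is irreducible.
   Context: Fix $h\in\mathbb{C}\setminus 2\pi i\mathbb{Q}$, where $i=\sqrt{-1}$, and put $q=\exp(h)$, so $q$ is not a root of unity. For $b\in\mathbb{C}$ put $q^b=\exp(hb)$ and $[b]=\frac{q^b-q^{-b}}{q-q^{-1}}$. The algebra $U_q^{\mathrm{tw}}(\mathfrak{so}_4)$ is the complex unital associative algebra generated by $I_{21},I_{32},I_{43}$ subject to $I_{21}I_{43}=I_{43}I_{21}$ and, for $j=2,3$, $$I_{j+1,j}^2I_{j,j-1}-[2]I_{j+1,j}I_{j,j-1}I_{j+1,j}+I_{j,j-1}I_{j+1,j}^2=-I_{j,j-1},$$ $$I_{j,j-1}^2I_{j+1,j}-[2]I_{j,j-1}I_{j+1,j}I_{j,j-1}+I_{j+1,j}I_{j,j-1}^2=-I_{j+1,j}.$$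 For $p,r,\ell_0,m_0\in\mathbb{C}$ with $q^{2m}\neq -1$ for all $m\in m_0+\mathbb{Z}$ and $q^{2\ell}\neq 1$, $q^{4\ell+2}\neq 1$ for all $\ell\in\ell_0+\mathbb{Z}$, $V_{\ell_0,m_0}^{p,r}$ is the representation of $U_q^{\mathrm{tw}}(\mathfrak{so}_4)$ with basis $\{|\ell,m\rangle:\ell\in\ell_0+\mathbb{Z},\ m\in m_0+\mathbb{Z}\}$ and action $$I_{21}.|\ell,m\rangle=i[m]\,|\ell,m\rangle,$$ $$I_{32}.|\ell,m\rangle=a_{\ell,m}\,|\ell,m+1\rangle-|\ell,m-1\rangle,$$ $$I_{43}.|\ell,m\rangle=b_{\ell,m}\,|\ell+1,m\rangle-[\ell-m]\,|\ell-1,m\rangle+i\,c_{\ell,m}\,|\ell,m\rangle,$$ where $$a_{\ell,m}=\frac{[\ell+m+1][\ell-m]}{(q^m+q^{-m})(q^{m+1}+q^{-m-1})},$$ $$b_{\ell,m}=\frac{[p+\ell+2][p-\ell][\ell+r+1][\ell-r+1][\ell+m+1]}{[\ell+1]^2[2\ell+1][2\ell+3]},\qquad c_{\ell,m}=\frac{[p+1][r][m]}{[\ell+1][\ell]}.$$ Length means the length of a composition series as a module. *)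

theory Defs
  imports Complex_Main "HOL-Library.Poly_Mapping" "HOL-Algebra.QuotRing" "HOL-Algebra.Module"
    "HOL-Algebra.Algebraic_Closure_Type"
begin

section \<open>Modules over a not necessarily commutative ring\<close>

text \<open>
  The locale \<open>module\<close> of HOL-Algebra demands a commutative ring of scalars; the following is the
  same list of laws over an arbitrary ring. Submodules are those of HOL-Algebra (the locale
  \<open>submodule\<close> has no commutativity assumption). The components \<open>mult\<close> and \<open>one\<close> of a \<open>module\<close>
  record play no role.
\<close>

locale left_module = R?: ring R + M?: abelian_group M
  for R :: "('a, 'r) ring_scheme" (structure)
  and M :: "('a, 'b, 'm) module_scheme" (structure) +
  assumes lm_smult_closed:
      "\<lbrakk>a \<in> carrier R; x \<in> carrier M\<rbrakk> \<Longrightarrow> a \<odot>\<^bsub>M\<^esub> x \<in> carrier M"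
    and lm_smult_l_distr:
      "\<lbrakk>a \<in> carrier R; b \<in> carrier R; x \<in> carrier M\<rbrakk> \<Longrightarrow>
        (a \<oplus> b) \<odot>\<^bsub>M\<^esub> x = a \<odot>\<^bsub>M\<^esub> x \<oplus>\<^bsub>M\<^esub> b \<odot>\<^bsub>M\<^esub> x"
    and lm_smult_r_distr:
      "\<lbrakk>a \<in> carrier R; x \<in> carrier M; y \<in> carrier M\<rbrakk> \<Longrightarrow>
        a \<odot>\<^bsub>M\<^esub> (x \<oplus>\<^bsub>M\<^esub> y) = a \<odot>\<^bsub>M\<^esub> x \<oplus>\<^bsub>M\<^esub> a \<odot>\<^bsub>M\<^esub> y"
    and lm_smult_assoc:
      "\<lbrakk>a \<in> carrier R; b \<in> carrier R; x \<in> carrier M\<rbrakk> \<Longrightarrow>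
        (a \<otimes> b) \<odot>\<^bsub>M\<^esub> x = a \<odot>\<^bsub>M\<^esub> (b \<odot>\<^bsub>M\<^esub> x)"
    and lm_smult_one: "x \<in> carrier M \<Longrightarrow> \<one> \<odot>\<^bsub>M\<^esub> x = x"

definition irreducible_module :: "('a, 'r) ring_scheme \<Rightarrow> ('a, 'b) module \<Rightarrow> bool" where
  "irreducible_module R M \<longleftrightarrow>
     left_module R M \<and> carrier M \<noteq> {\<zero>\<^bsub>M\<^esub>} \<and>
     (\<forall>N. submodule N R M \<longrightarrow> N = {\<zero>\<^bsub>M\<^esub>} \<or> N = carrier M)"

definition factor_module :: "('a, 'b) module \<Rightarrow> 'b set \<Rightarrow> ('a, 'b set) module" where
  "factor_module M N =
     \<lparr>carrier = a_rcosets\<^bsub>M\<^esub> N, monoid.mult = undefined, one = undefined,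
      zero = N, add = set_add M,
      module.smult = (\<lambda>a C. \<Union>x\<in>C. N +>\<^bsub>M\<^esub> (a \<odot>\<^bsub>M\<^esub> x))\<rparr>"

definition composition_series ::
  "('a, 'r) ring_scheme \<Rightarrow> ('a, 'b) module \<Rightarrow> nat \<Rightarrow> (nat \<Rightarrow> 'b set) \<Rightarrow> bool" where
  "composition_series R M n F \<longleftrightarrow>
     left_module R M \<and> F 0 = {\<zero>\<^bsub>M\<^esub>} \<and> F n = carrier M \<and>
     (\<forall>i\<le>n. submodule (F i) R M) \<and>
     (\<forall>i<n. F i \<subseteq> F (Suc i) \<and>
        irreducible_module R (factor_module (M\<lparr>carrier := F (Suc i)\<rparr>) (F i)))"

text \<open>By Jordan--Hoelder there is at most one such \<open>n\<close>.\<close>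

definition has_length :: "('a, 'r) ring_scheme \<Rightarrow> ('a, 'b) module \<Rightarrow> nat \<Rightarrow> bool" where
  "has_length R M n \<longleftrightarrow> (\<exists>F. composition_series R M n F)"


section \<open>q-numbers\<close>

definition qpow :: "complex \<Rightarrow> complex \<Rightarrow> complex" where
  "qpow h b = exp (h * b)"

definition qnum :: "complex \<Rightarrow> complex \<Rightarrow> complex" where
  "qnum h b = (qpow h b - qpow h (- b)) / (qpow h 1 - qpow h (- 1))"


section \<open>The algebra\<close>

datatype gen = I21 | I32 | I43

datatype word = Word "gen list"

text \<open>Words under concatenation, written additively because the convolution product on
  \<open>\<Rightarrow>\<^sub>0\<close> expects an additive monoid of exponents.\<close>

instantiation word :: monoid_add
begin

definition zero_word :: word where
  "0 = Word []"

fun plus_word :: "word \<Rightarrow> word \<Rightarrow> word" where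
  "Word u + Word v = Word (u @ v)"

instance
proof
  fix a b c :: word
  show "a + b + c = a + (b + c)"
    by (cases a; cases b; cases c) simp
  show "0 + a = a" "a + 0 = a"
    by (cases a; simp add: zero_word_def)+
qed

end

text \<open>The free complex algebra on the three generators; the scalar \<open>c\<close> is \<open>single 0 c\<close>.\<close>

type_synonym free_alg = "word \<Rightarrow>\<^sub>0 complex"

definition scal :: "complex \<Rightarrow> free_alg" where
  "scal c = Poly_Mapping.single 0 c"

definition gen :: "gen \<Rightarrow> free_alg" where
  "gen g = Poly_Mapping.single (Word [g]) 1"

text \<open>The left-hand side minus the right-hand side of
  \<open>x\<^sup>2 y - [2] x y x + y x\<^sup>2 = - y\<close>.\<close>

definition serre :: "complex \<Rightarrow> free_alg \<Rightarrow> free_alg \<Rightarrow> free_alg" where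
  "serre h x y = x\<^sup>2 * y - scal (qnum h 2) * x * y * x + y * x\<^sup>2 + y"

definition so4_relators :: "complex \<Rightarrow> free_alg set" where
  "so4_relators h =
     {gen I21 * gen I43 - gen I43 * gen I21,
      serre h (gen I32) (gen I21), serre h (gen I21) (gen I32),
      serre h (gen I43) (gen I32), serre h (gen I32) (gen I43)}"

text \<open>
  The quotient of the free algebra by the two-sided ideal generated by the relators. Its complex
  algebra structure is given by the classes of the scalars \<open>scal c\<close>; in particular every
  submodule over this ring is a complex subspace.
\<close>

definition Uq_tw_so4 :: "complex \<Rightarrow> free_alg set ring" where
  "Uq_tw_so4 h =
     ring_of_type_algebra Quot (genideal ring_of_type_algebra (so4_relators h))"


section \<open>The representation\<close>

text \<open>A vector is a finitely supported function on labels \<open>(\<ell>, m)\<close>, and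
  \<open>single (\<ell>, m) 1\<close> is the basis vector with that label.\<close>

type_synonym vec = "(complex \<times> complex) \<Rightarrow>\<^sub>0 complex"

definition vscale :: "complex \<Rightarrow> vec \<Rightarrow> vec" where
  "vscale c v = Poly_Mapping.map ((*) c) v"

definition coeff_a :: "complex \<Rightarrow> complex \<Rightarrow> complex \<Rightarrow> complex" where
  "coeff_a h l m =
     qnum h (l + m + 1) * qnum h (l - m) /
     ((qpow h m + qpow h (- m)) * (qpow h (m + 1) + qpow h (- m - 1)))"

definition coeff_b ::
  "complex \<Rightarrow> complex \<Rightarrow> complex \<Rightarrow> complex \<Rightarrow> complex \<Rightarrow> complex" where
  "coeff_b h p r l m =
     qnum h (p + l + 2) * qnum h (p - l) * qnum h (l + r + 1) * qnum h (l - r + 1) *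
       qnum h (l + m + 1) /
     ((qnum h (l + 1))\<^sup>2 * qnum h (2 * l + 1) * qnum h (2 * l + 3))"

definition coeff_c ::
  "complex \<Rightarrow> complex \<Rightarrow> complex \<Rightarrow> complex \<Rightarrow> complex \<Rightarrow> complex" where
  "coeff_c h p r l m =
     qnum h (p + 1) * qnum h r * qnum h m / (qnum h (l + 1) * qnum h l)"

fun gen_on_basis ::
  "complex \<Rightarrow> complex \<Rightarrow> complex \<Rightarrow> gen \<Rightarrow> complex \<times> complex \<Rightarrow> vec" where
  "gen_on_basis h p r I21 (l, m) = Poly_Mapping.single (l, m) (\<i> * qnum h m)"
| "gen_on_basis h p r I32 (l, m) =
     Poly_Mapping.single (l, m + 1) (coeff_a h l m) - Poly_Mapping.single (l, m - 1) 1"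
| "gen_on_basis h p r I43 (l, m) =
     Poly_Mapping.single (l + 1, m) (coeff_b h p r l m)
     - Poly_Mapping.single (l - 1, m) (qnum h (l - m))
     + Poly_Mapping.single (l, m) (\<i> * coeff_c h p r l m)"

definition gen_act :: "complex \<Rightarrow> complex \<Rightarrow> complex \<Rightarrow> gen \<Rightarrow> vec \<Rightarrow> vec" where
  "gen_act h p r g v =
     (\<Sum>k\<in>Poly_Mapping.keys v. vscale (Poly_Mapping.lookup v k) (gen_on_basis h p r g k))"

fun word_act :: "complex \<Rightarrow> complex \<Rightarrow> complex \<Rightarrow> word \<Rightarrow> vec \<Rightarrow> vec" where
  "word_act h p r (Word gs) v = foldr (gen_act h p r) gs v"

definition free_act :: "complex \<Rightarrow> complex \<Rightarrow> complex \<Rightarrow> free_alg \<Rightarrow> vec \<Rightarrow> vec" where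
  "free_act h p r f v =
     (\<Sum>w\<in>Poly_Mapping.keys f. vscale (Poly_Mapping.lookup f w) (word_act h p r w v))"

text \<open>
  An element of the quotient algebra is a coset \<open>C\<close> of elements of the free algebra, and it acts
  on \<open>v\<close> by the common value of its representatives. That this is well defined, i.e. that the
  relators act by zero, is part of the assertion that \<open>Vrep\<close> is a \<open>left_module\<close>.
\<close>

definition Vrep ::
  "complex \<Rightarrow> complex \<Rightarrow> complex \<Rightarrow> complex \<Rightarrow> complex \<Rightarrow> (free_alg set, vec) module" where
  "Vrep h p r l0 m0 =
     \<lparr>carrier = {v. Poly_Mapping.keys v \<subseteq>
        {(l, m). l - l0 \<in> \<int> \<and> m - m0 \<in> \<int>}},
      monoid.mult = undefined, one = undefined, zero = 0, add = (+),
      module.smult = (\<lambda>C v. the_elem ((\<lambda>f. free_act h p r f v) ` C))\<rparr>"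

end

theory Submission
  imports Defs
begin

text \<open>
  The basis of the representation is a lattice \<open>(l0 + \<int>) \<times> (m0 + \<int>)\<close>. The generator \<open>I21\<close> is diagonal,
  \<open>I32\<close> moves a basis vector along its row (it changes \<open>m\<close>), and \<open>I43\<close> moves it to the neighbouring
  rows (it changes \<open>l\<close>).

  That the formulas define a representation is a statement about coefficients: each Serre relation
  splits into one identity for every displacement in the lattice. Almost all of them are the
  recursion \<open>[2][x] = [x + 1] + [x - 1]\<close> multiplied by common factors, or the product formula
  \<open>[x + 1][y + 1] - [x][y] = [x + y + 1]\<close>. Only the displacements that keep \<open>l\<close> in the relation
  between \<open>I43\<close> and \<open>I32\<close> tie the dependence of \<open>b\<close> on \<open>p\<close>, \<open>r\<close> and \<open>l\<close> to that of \<open>c\<close>; there, up to a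
  common factor, the relation says that \<open>F(x) = ([p + 1]\<^sup>2 - x)(x - [r]\<^sup>2) / x\<close> has a prescribed
  difference between \<open>x = [l + 1]\<^sup>2\<close> and \<open>x = [l]\<^sup>2\<close> (lemma \<open>ladder\<close>).

  Submodules are coordinate subspaces. The eigenvalues \<open>\<i>[m]\<close> of \<open>I21\<close> are distinct, so a submodule
  contains the columns of each of its vectors. Going from column \<open>m\<close> to column \<open>m + 1\<close> and back by
  \<open>I32\<close> multiplies \<open>|l,m\<rangle>\<close> by \<open>- a\<^sub>l\<^sub>,\<^sub>m\<close>, and these numbers are distinct for distinct \<open>l\<close>; so a
  submodule contains every basis vector that occurs in one of its vectors
  (\<open>submodule_basis_vector\<close>). Hence submodules correspond to the sets of lattice points that are
  closed under all moves with nonzero coefficient (\<open>submodule_imp_coord_span\<close>,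
  \<open>submodule_coord_span\<close>).

  A coefficient vanishes only across a wall. As \<open>q\<close> is not a root of unity, each q-number with
  argument running through a coset of \<open>\<int>\<close> vanishes at most once, and the condition on
  \<open>q\<^sup>4\<^sup>l\<close> forbids two q-numbers whose arguments add up to \<open>2 l + k\<close> from vanishing both. So \<open>b\<close>
  blocks at most two horizontal lines, one coming from \<open>p\<close> and one from \<open>r\<close>, and
  \<open>[l - m]\<close>, \<open>[l + m + 1]\<close> together produce at most one diagonal or antidiagonal wall. The walls cut
  the lattice into at most three times two regions. Inside a region all moves are reversible, and any
  two points of it can be joined (\<open>region_connected\<close>), so a closed set contains all of a region or
  nothing of it. Adding the regions one at a time in a suitable order gives a chain of submodules with
  simple or zero quotients, hence length at most 6. When there are no walls, the whole lattice is a
  single region and the module is irreducible.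
\<close>

section \<open>Irreducible subquotients of left modules\<close>

lemma submoduleD:
  fixes M (structure)
  assumes "submodule N R M"
  shows "N \<subseteq> carrier M" "\<zero> \<in> N" "x \<in> N \<Longrightarrow> y \<in> N \<Longrightarrow> x \<oplus> y \<in> N" "x \<in> N \<Longrightarrow> \<ominus> x \<in> N"
    "r \<in> carrier R \<Longrightarrow> x \<in> N \<Longrightarrow> r \<odot>\<^bsub>M\<^esub> x \<in> N"
proof -
  interpret submodule N R M by (rule assms)
  interpret additive_subgroup N M by (rule additive_subgroupI[OF subgroup_axioms])
  show "N \<subseteq> carrier M" "\<zero> \<in> N" "x \<in> N \<Longrightarrow> y \<in> N \<Longrightarrow> x \<oplus> y \<in> N" "x \<in> N \<Longrightarrow> \<ominus> x \<in> N"
    "r \<in> carrier R \<Longrightarrow> x \<in> N \<Longrightarrow> r \<odot>\<^bsub>M\<^esub> x \<in> N"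
    by (simp_all add: a_subset)
qed

text \<open>
  Closure under negation comes for free, because \<open>- x\<close> is the multiple of \<open>x\<close> by \<open>- 1\<close>.
\<close>

lemma submodule_left_moduleI:
  fixes M (structure)
  assumes "left_module R M" "N \<subseteq> carrier M" "\<zero> \<in> N"
    and "\<And>x y. x \<in> N \<Longrightarrow> y \<in> N \<Longrightarrow> x \<oplus> y \<in> N"
    and "\<And>r x. r \<in> carrier R \<Longrightarrow> x \<in> N \<Longrightarrow> r \<odot>\<^bsub>M\<^esub> x \<in> N"
  shows "submodule N R M"
proof -
  interpret left_module R M by fact
  have null: "\<zero>\<^bsub>R\<^esub> \<odot>\<^bsub>M\<^esub> x = \<zero>" if "x \<in> carrier M" for x
  proof -
    have "\<zero>\<^bsub>R\<^esub> \<odot>\<^bsub>M\<^esub> x \<oplus> \<zero>\<^bsub>R\<^esub> \<odot>\<^bsub>M\<^esub> x = \<zero>\<^bsub>R\<^esub> \<odot>\<^bsub>M\<^esub> x"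
      using lm_smult_l_distr[of "\<zero>\<^bsub>R\<^esub>" "\<zero>\<^bsub>R\<^esub>" x] that by simp
    then show ?thesis
      using lm_smult_closed[of "\<zero>\<^bsub>R\<^esub>" x] that by (metis R.zero_closed M.add.r_cancel_one)
  qed
  have neg: "\<ominus> x \<in> N" if x: "x \<in> N" for x
  proof -
    have xM: "x \<in> carrier M" using x assms(2) by blast
    have "(\<ominus>\<^bsub>R\<^esub> \<one>\<^bsub>R\<^esub>) \<odot>\<^bsub>M\<^esub> x \<oplus> x = \<zero>"
      using lm_smult_l_distr[of "\<ominus>\<^bsub>R\<^esub> \<one>\<^bsub>R\<^esub>" "\<one>\<^bsub>R\<^esub>" x] xM null by (simp add: lm_smult_one R.l_neg)
    then have "\<ominus> x = (\<ominus>\<^bsub>R\<^esub> \<one>\<^bsub>R\<^esub>) \<odot>\<^bsub>M\<^esub> x"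
      using xM by (intro M.minus_equality) (auto intro: lm_smult_closed)
    then show ?thesis using assms(5)[of "\<ominus>\<^bsub>R\<^esub> \<one>\<^bsub>R\<^esub>" x] x by simp
  qed
  show ?thesis
  proof
    show "N \<subseteq> carrier (add_monoid M)" using assms(2) by simp
    show "inv\<^bsub>add_monoid M\<^esub> x \<in> N" if "x \<in> N" for x
      using neg[OF that] by (simp add: a_inv_def)
  qed (use assms in auto)
qed

lemma left_module_submodule:
  fixes M (structure)
  assumes "left_module R M" "submodule N R M"
  shows "left_module R (M\<lparr>carrier := N\<rparr>)"
proof -
  interpret left_module R M by fact
  note N = submoduleD[OF assms(2)]
  have sub: "x \<in> N \<Longrightarrow> x \<in> carrier M" for x using N(1) by blast
  have "abelian_group (M\<lparr>carrier := N\<rparr>)"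
  proof (rule abelian_groupI)
    show "\<exists>y\<in>carrier (M\<lparr>carrier := N\<rparr>). y \<oplus>\<^bsub>M\<lparr>carrier := N\<rparr>\<^esub> x = \<zero>\<^bsub>M\<lparr>carrier := N\<rparr>\<^esub>"
      if "x \<in> carrier (M\<lparr>carrier := N\<rparr>)" for x
      using that N(4)[of x] sub by (auto intro!: bexI[of _ "\<ominus> x"] simp: M.l_neg)
  qed (use N sub in \<open>auto simp: M.a_ac\<close>)
  then show ?thesis
    by (intro left_module.intro left_module_axioms.intro R.ring_axioms)
      (use N sub in \<open>auto simp: lm_smult_l_distr lm_smult_r_distr lm_smult_assoc lm_smult_one\<close>)
qed

lemma submodule_in_submodule:
  fixes M (structure)
  assumes "left_module R M" "submodule N R M" "submodule K R M" "K \<subseteq> N"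
  shows "submodule K R (M\<lparr>carrier := N\<rparr>)"
  using submoduleD[OF assms(3)] assms(4)
  by (intro submodule_left_moduleI left_module_submodule[OF assms(1,2)]) auto

lemma abelian_subgroup_submodule:
  assumes "left_module R M" "submodule N R M"
  shows "abelian_subgroup N M"
proof -
  interpret left_module R M by fact
  interpret submodule N R M by fact
  show ?thesis
    by (intro abelian_subgroupI3 additive_subgroupI subgroup_axioms M.abelian_group_axioms)
qed

lemma factor_module_smult:
  fixes M (structure)
  assumes "left_module R M" "submodule N R M" "r \<in> carrier R" "x \<in> carrier M"
  shows "r \<odot>\<^bsub>factor_module M N\<^esub> (N +> x) = N +> (r \<odot>\<^bsub>M\<^esub> x)"
proof -
  interpret left_module R M by fact
  interpret N: abelian_subgroup N M by (rule abelian_subgroup_submodule) fact+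
  note N = submoduleD[OF assms(2)]
  have eq: "N +> (r \<odot>\<^bsub>M\<^esub> y) = N +> (r \<odot>\<^bsub>M\<^esub> x)" if y: "y \<in> N +> x" for y
  proof -
    obtain n where n: "n \<in> N" "y = n \<oplus> x"
      using y unfolding a_r_coset_def' by auto
    then have ry: "r \<odot>\<^bsub>M\<^esub> y = (r \<odot>\<^bsub>M\<^esub> n) \<oplus> (r \<odot>\<^bsub>M\<^esub> x)"
      using N(1) assms by (auto intro: lm_smult_r_distr)
    moreover have "r \<odot>\<^bsub>M\<^esub> n \<in> N" using N(5) n assms by blast
    ultimately have "r \<odot>\<^bsub>M\<^esub> y \<in> N +> (r \<odot>\<^bsub>M\<^esub> x)"
      unfolding a_r_coset_def' ry by blast
    then show ?thesis
      using M.a_repr_independence[OF _ lm_smult_closed[OF assms(3,4)] N.a_subgroup] by simp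
  qed
  have "x \<in> N +> x" using N.a_rcos_self assms(4) by simp
  then have "N +> x \<noteq> {}" by (metis empty_iff)
  then have "(\<Union>y\<in>N +> x. N +> (r \<odot>\<^bsub>M\<^esub> y)) = N +> (r \<odot>\<^bsub>M\<^esub> x)"
    by (rule SUP_eq_const) (rule eq)
  then show ?thesis by (simp add: factor_module_def)
qed

lemma left_module_factor:
  fixes M (structure)
  assumes "left_module R M" "submodule N R M"
  shows "left_module R (factor_module M N)"
proof -
  interpret left_module R M by fact
  interpret N: abelian_subgroup N M by (rule abelian_subgroup_submodule) fact+
  note N = submoduleD[OF assms(2)]
  have carr: "carrier (factor_module M N) = (\<lambda>x. N +> x) ` carrier M"
    by (auto simp: factor_module_def A_RCOSETS_def')
  have add: "(N +> x) \<oplus>\<^bsub>factor_module M N\<^esub> (N +> y) = N +> (x \<oplus> y)"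
    if "x \<in> carrier M" "y \<in> carrier M" for x y
    using N.a_rcos_sum[OF that] by (simp add: factor_module_def)
  have zero: "\<zero>\<^bsub>factor_module M N\<^esub> = N +> \<zero>"
    using N(1) by (simp add: factor_module_def)
  have "abelian_group (factor_module M N)"
  proof (rule abelian_groupI)
    show "\<exists>D\<in>carrier (factor_module M N). D \<oplus>\<^bsub>factor_module M N\<^esub> C = \<zero>\<^bsub>factor_module M N\<^esub>"
      if "C \<in> carrier (factor_module M N)" for C
    proof -
      from that[unfolded carr] obtain x where x: "C = N +> x" "x \<in> carrier M"
        by (rule imageE)
      have "(N +> (\<ominus> x)) \<oplus>\<^bsub>factor_module M N\<^esub> C = \<zero>\<^bsub>factor_module M N\<^esub>"
        unfolding zero x(1) add[OF M.a_inv_closed[OF x(2)] x(2)] M.l_neg[OF x(2)] ..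
      moreover have "N +> (\<ominus> x) \<in> carrier (factor_module M N)"
        unfolding carr by (rule imageI) (rule M.a_inv_closed[OF x(2)])
      ultimately show ?thesis ..
    qed
  qed (auto simp: carr add zero M.a_ac)
  then show ?thesis
    by (intro left_module.intro left_module_axioms.intro R.ring_axioms)
      (auto simp: carr add factor_module_smult[OF assms] lm_smult_closed lm_smult_l_distr lm_smult_r_distr
        lm_smult_assoc lm_smult_one)
qed

text \<open>
  The correspondence theorem: a submodule \<open>P\<close> of the quotient is the image of its preimage \<open>K\<close> in
  \<open>N'\<close>, and \<open>K\<close> lies between \<open>N\<close> and \<open>N'\<close>.
\<close>

lemma irreducible_factorI:
  fixes M (structure)
  assumes "left_module R M" "submodule N R M" "submodule N' R M" "N \<subset> N'"
    and max: "\<And>K. submodule K R M \<Longrightarrow> N \<subseteq> K \<Longrightarrow> K \<subseteq> N' \<Longrightarrow> K = N \<or> K = N'"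
  shows "irreducible_module R (factor_module (M\<lparr>carrier := N'\<rparr>) N)"
proof -
  define M' where "M' = M\<lparr>carrier := N'\<rparr>"
  define Q where "Q = factor_module M' N"
  have M': "left_module R M'"
    unfolding M'_def by (rule left_module_submodule) fact+
  have NM': "submodule N R M'"
    unfolding M'_def using assms by (intro submodule_in_submodule) auto
  interpret left_module R M by fact
  interpret M': left_module R M' by fact
  interpret N: abelian_subgroup N M' by (rule abelian_subgroup_submodule) fact+
  have simps: "carrier M' = N'" "add M' = add M" "zero M' = \<zero>" "module.smult M' = module.smult M"
    by (simp_all add: M'_def)
  have Q: "left_module R Q"
    unfolding Q_def by (rule left_module_factor) fact+
  interpret Q: left_module R Q by fact
  note N = submoduleD[OF assms(2)] and N' = submoduleD[OF assms(3)]
  have zeroQ: "\<zero>\<^bsub>Q\<^esub> = N" by (simp add: Q_def factor_module_def)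
  have carrQ: "carrier Q = (\<lambda>x. N +>\<^bsub>M'\<^esub> x) ` N'"
    by (auto simp: Q_def factor_module_def A_RCOSETS_def' simps)
  have addQ: "(N +>\<^bsub>M'\<^esub> x) \<oplus>\<^bsub>Q\<^esub> (N +>\<^bsub>M'\<^esub> y) = N +>\<^bsub>M'\<^esub> (x \<oplus> y)" if "x \<in> N'" "y \<in> N'" for x y
    using N.a_rcos_sum[of x y] that by (simp add: Q_def factor_module_def simps)
  have smultQ: "r \<odot>\<^bsub>Q\<^esub> (N +>\<^bsub>M'\<^esub> x) = N +>\<^bsub>M'\<^esub> (r \<odot>\<^bsub>M\<^esub> x)" if "r \<in> carrier R" "x \<in> N'" for r x
    using factor_module_smult[OF M' NM' that(1)] that by (simp add: Q_def simps)
  have coset_N: "N +>\<^bsub>M'\<^esub> x = N \<longleftrightarrow> x \<in> N" if "x \<in> N'" for x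
  proof
    show "N +>\<^bsub>M'\<^esub> x = N \<Longrightarrow> x \<in> N"
      using N.a_rcos_self[of x] that simps by auto
    show "x \<in> N \<Longrightarrow> N +>\<^bsub>M'\<^esub> x = N"
      using M'.M.a_coset_join2[OF _ N.a_subgroup] that simps by auto
  qed
  obtain x where x: "x \<in> N'" "x \<notin> N" using assms(4) by blast
  then have "N +>\<^bsub>M'\<^esub> x \<in> carrier Q" "N +>\<^bsub>M'\<^esub> x \<noteq> N"
    using coset_N unfolding carrQ by simp_all
  then have "carrier Q \<noteq> {\<zero>\<^bsub>Q\<^esub>}"
    unfolding zeroQ by (metis singletonD)
  moreover have "P = {\<zero>\<^bsub>Q\<^esub>} \<or> P = carrier Q" if P: "submodule P R Q" for P
  proof -
    define K where "K = {x \<in> N'. N +>\<^bsub>M'\<^esub> x \<in> P}"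
    note PD = submoduleD[OF P]
    have "submodule K R M"
    proof (rule submodule_left_moduleI[OF assms(1)])
      show "K \<subseteq> carrier M" using N'(1) by (auto simp: K_def)
      show "\<zero> \<in> K" using N'(2) PD(2) coset_N[of \<zero>] N(2) by (auto simp: K_def zeroQ)
      show "x \<oplus> y \<in> K" if "x \<in> K" "y \<in> K" for x y
      proof -
        from that have xy: "x \<in> N'" "y \<in> N'" "N +>\<^bsub>M'\<^esub> x \<in> P" "N +>\<^bsub>M'\<^esub> y \<in> P"
          by (simp_all add: K_def)
        from PD(3)[OF xy(3,4)] have "N +>\<^bsub>M'\<^esub> (x \<oplus> y) \<in> P"
          unfolding addQ[OF xy(1,2)] .
        then show ?thesis using N'(3) xy by (simp add: K_def)
      qed
      show "r \<odot>\<^bsub>M\<^esub> x \<in> K" if "r \<in> carrier R" "x \<in> K" for r x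
      proof -
        from that have x: "x \<in> N'" "N +>\<^bsub>M'\<^esub> x \<in> P"
          by (simp_all add: K_def)
        from PD(5)[OF that(1) x(2)] have "N +>\<^bsub>M'\<^esub> (r \<odot>\<^bsub>M\<^esub> x) \<in> P"
          unfolding smultQ[OF that(1) x(1)] .
        then show ?thesis using N'(5) that(1) x by (simp add: K_def)
      qed
    qed
    moreover have "N \<subseteq> K"
    proof
      fix y assume "y \<in> N"
      with assms(4) coset_N have "y \<in> N'" "N +>\<^bsub>M'\<^esub> y = N" by auto
      with PD(2) show "y \<in> K" by (simp add: K_def zeroQ)
    qed
    ultimately have "K = N \<or> K = N'"
      using max[of K] by (auto simp: K_def)
    moreover have PK: "P = (\<lambda>x. N +>\<^bsub>M'\<^esub> x) ` K"
      using PD(1) unfolding carrQ K_def by auto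
    moreover have "(\<lambda>x. N +>\<^bsub>M'\<^esub> x) ` N = {N}"
      using coset_N assms(4) N(2) by (auto simp: image_def)
    ultimately show ?thesis
      unfolding zeroQ carrQ by metis
  qed
  ultimately show ?thesis
    using Q unfolding irreducible_module_def Q_def M'_def by blast
qed

text \<open>
  Repetitions in the chain are harmless: dropping them leaves a chain of strict inclusions without
  submodules in between, which is a composition series. So it is enough to bound the number of steps
  without knowing which of them are trivial.
\<close>

lemma has_length_if_chain:
  fixes M (structure)
  assumes "left_module R M"
    and bot: "G 0 = {\<zero>}" and top: "G n = carrier M"
    and sub: "\<And>i. i \<le> n \<Longrightarrow> submodule (G i) R M"
    and mono: "\<And>i. i < n \<Longrightarrow> G i \<subseteq> G (Suc i)"
    and cover: "\<And>i K. i < n \<Longrightarrow> submodule K R M \<Longrightarrow> G i \<subseteq> K \<Longrightarrow> K \<subseteq> G (Suc i) \<Longrightarrow> K = G i \<or> K = G (Suc i)"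
  shows "\<exists>k\<le>n. has_length R M k"
proof -
  have "\<exists>k\<le>j. \<exists>F. F 0 = {\<zero>} \<and> F k = G j \<and> (\<forall>i\<le>k. submodule (F i) R M) \<and>
      (\<forall>i<k. F i \<subseteq> F (Suc i) \<and> irreducible_module R (factor_module (M\<lparr>carrier := F (Suc i)\<rparr>) (F i)))"
    if "j \<le> n" for j
    using that
  proof (induction j)
    case 0
    then show ?case using bot sub[of 0] by (intro exI[of _ 0]) auto
  next
    case (Suc j)
    then obtain k F where F: "k \<le> j" "F 0 = {\<zero>}" "F k = G j" "\<And>i. i \<le> k \<Longrightarrow> submodule (F i) R M"
      "\<And>i. i < k \<Longrightarrow> F i \<subseteq> F (Suc i)"
      "\<And>i. i < k \<Longrightarrow> irreducible_module R (factor_module (M\<lparr>carrier := F (Suc i)\<rparr>) (F i))"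
      by auto
    show ?case
    proof (cases "G j = G (Suc j)")
      case True
      then show ?thesis
        using F by (intro exI[of _ k] exI[of _ F] conjI allI impI) simp_all
    next
      case False
      define F' where "F' = F(Suc k := G (Suc j))"
      have old: "F' i = F i" if "i \<le> k" for i using that by (simp add: F'_def)
      have "irreducible_module R (factor_module (M\<lparr>carrier := G (Suc j)\<rparr>) (G j))"
        using Suc.prems False mono[of j] cover[of j]
        by (intro irreducible_factorI[OF assms(1) sub sub]) auto
      then have "irreducible_module R (factor_module (M\<lparr>carrier := F' (Suc i)\<rparr>) (F' i))" "F' i \<subseteq> F' (Suc i)"
        if "i < Suc k" for i
        using that F(5,6)[of i] F(3) mono[of j] Suc.prems by (auto simp: F'_def less_Suc_eq)
      moreover have "submodule (F' i) R M" if "i \<le> Suc k" for i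
        using that F(4)[of i] sub[of "Suc j"] Suc.prems by (auto simp: F'_def le_Suc_eq)
      ultimately show ?thesis
        using F(1,2) by (intro exI[of _ "Suc k"] conjI exI[of _ F']) (auto simp: F'_def)
    qed
  qed
  from this[of n] show ?thesis
    using assms(1) top unfolding has_length_def composition_series_def by auto
qed

section \<open>Identities for q-numbers\<close>

lemma qpow_add: "qpow h (a + b) = qpow h a * qpow h b"
  by (simp add: qpow_def ring_distribs exp_add)

lemma qpow_nonzero: "qpow h b \<noteq> 0"
  by (simp add: qpow_def)

lemma qpow_mult_minus: "qpow h b * qpow h (- b) = 1"
  by (simp add: qpow_def flip: exp_add)

lemma qpow_double: "qpow h (2 * b) = (qpow h b)\<^sup>2"
  by (simp only: mult_2 qpow_add power2_eq_square)

locale q_generic =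
  fixes h :: complex
  assumes not_root_of_unity: "\<And>n::int. n \<noteq> 0 \<Longrightarrow> qpow h (of_int n) \<noteq> 1"
begin

abbreviation br :: "complex \<Rightarrow> complex"  ("[_]\<^sub>q")
  where "[b]\<^sub>q \<equiv> qnum h b"

text \<open>
  The quantity \<open>q\<^sup>m + q\<^sup>-\<^sup>m\<close> in the denominators of \<open>a\<close>.
\<close>

abbreviation dd :: "complex \<Rightarrow> complex"
  where "dd m \<equiv> qpow h m + qpow h (- m)"

abbreviation qq :: complex where "qq \<equiv> qpow h 1 - qpow h (- 1)"

lemma qq_nonzero: "qq \<noteq> 0"
proof
  assume "qq = 0"
  then have "(qpow h 1)\<^sup>2 = 1"
    using qpow_mult_minus[of h 1] by (simp add: power2_eq_square)
  then show False
    using not_root_of_unity[of 2] qpow_double[of h 1] by simp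
qed

lemma br_times_qq: "[b]\<^sub>q * qq = qpow h b - qpow h (- b)"
  using qq_nonzero by (simp add: qnum_def)

lemma br_minus: "[- b]\<^sub>q = - [b]\<^sub>q"
  by (simp add: qnum_def diff_divide_distrib)

lemma br_minus_diff: "[a - b]\<^sub>q = - [b - a]\<^sub>q"
  by (metis br_minus minus_diff_eq)

lemma br_1: "[1]\<^sub>q = 1"
  using qq_nonzero by (simp add: qnum_def)

text \<open>
  The basic identity, from which the recursions below follow. Multiplied by \<open>(q - 1/q)\<^sup>2\<close> it is an
  identity of Laurent polynomials in \<open>q\<^sup>a\<close>, \<open>q\<^sup>b\<close> and \<open>q\<close>.
\<close>

lemma br_shift_prod: "[a + 1]\<^sub>q * [b + 1]\<^sub>q - [a]\<^sub>q * [b]\<^sub>q = [a + b + 1]\<^sub>q"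
proof -
  define A A' B B' Q Q' where "A = qpow h a" "A' = qpow h (- a)" "B = qpow h b" "B' = qpow h (- b)"
    "Q = qpow h 1" "Q' = qpow h (- 1)"
  note defs = this
  have u: "A * A' = 1" "B * B' = 1" "Q * Q' = 1"
    by (simp_all add: defs qpow_mult_minus)
  have e: "[a + 1]\<^sub>q * qq = A * Q - A' * Q'" "[b + 1]\<^sub>q * qq = B * Q - B' * Q'"
    "[a]\<^sub>q * qq = A - A'" "[b]\<^sub>q * qq = B - B'" "[a + b + 1]\<^sub>q * qq = A * B * Q - A' * B' * Q'"
    unfolding br_times_qq defs
    by (simp_all add: qpow_add[symmetric] algebra_simps)
  have "([a + 1]\<^sub>q * [b + 1]\<^sub>q - [a]\<^sub>q * [b]\<^sub>q) * qq * qq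
      = ([a + 1]\<^sub>q * qq) * ([b + 1]\<^sub>q * qq) - ([a]\<^sub>q * qq) * ([b]\<^sub>q * qq)"
    by (simp add: algebra_simps)
  also have "\<dots> = (A * B * Q - A' * B' * Q') * (Q - Q')"
    unfolding e using u by Groebner_Basis.algebra
  also have "\<dots> = [a + b + 1]\<^sub>q * qq * qq"
    unfolding e(5) by (simp add: defs)
  finally show ?thesis using qq_nonzero by simp
qed

lemma br_2: "[2]\<^sub>q * [b]\<^sub>q = [b + 1]\<^sub>q + [b - 1]\<^sub>q"
proof -
  have "[1 + 1]\<^sub>q * [b - 1 + 1]\<^sub>q - [1]\<^sub>q * [b - 1]\<^sub>q = [1 + (b - 1) + 1]\<^sub>q"
    by (rule br_shift_prod)
  then show ?thesis unfolding br_1 by (simp add: diff_eq_eq)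
qed

text \<open>
  The quadratic invariant of the recursion \<open>[2][b] = [b + 1] + [b - 1]\<close>.
\<close>

lemma br_consecutive: "[b]\<^sub>q\<^sup>2 + [b + 1]\<^sub>q\<^sup>2 - [2]\<^sub>q * [b]\<^sub>q * [b + 1]\<^sub>q = 1"
proof -
  \<comment> \<open>The product formula with arguments of opposite sign, \<open>- b - 2\<close> and \<open>b\<close>.\<close>
  have "[- (b + 1)]\<^sub>q * [b + 1]\<^sub>q - [- (b + 2)]\<^sub>q * [b]\<^sub>q = [- 1]\<^sub>q"
    using br_shift_prod[of "- b - 2" b] by (simp add: algebra_simps)
  then have "[b + 1]\<^sub>q * [b + 1]\<^sub>q - [b + 2]\<^sub>q * [b]\<^sub>q = 1"
    unfolding br_minus br_1 by (simp add: algebra_simps)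
  moreover have "[2]\<^sub>q * [b + 1]\<^sub>q = [b + 2]\<^sub>q + [b]\<^sub>q"
    using br_2[of "b + 1"] by (simp add: algebra_simps)
  ultimately show ?thesis by Groebner_Basis.algebra
qed

lemma br_square_diff: "[b + 1]\<^sub>q\<^sup>2 - [b]\<^sub>q\<^sup>2 = [2 * b + 1]\<^sub>q"
  unfolding power2_eq_square mult_2 by (rule br_shift_prod)

lemma br_square_diff2: "[a + b]\<^sub>q * [a - b]\<^sub>q = [a]\<^sub>q\<^sup>2 - [b]\<^sub>q\<^sup>2"
proof -
  define A A' B B' where "A = qpow h a" "A' = qpow h (- a)" "B = qpow h b" "B' = qpow h (- b)"
  note defs = this
  have u: "A * A' = 1" "B * B' = 1"
    by (simp_all add: defs qpow_mult_minus)
  have e: "[a + b]\<^sub>q * qq = A * B - A' * B'" "[a - b]\<^sub>q * qq = A * B' - A' * B"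
    "[a]\<^sub>q * qq = A - A'" "[b]\<^sub>q * qq = B - B'"
    unfolding br_times_qq defs
    by (simp_all add: qpow_add[symmetric] algebra_simps)
  have "[a + b]\<^sub>q * [a - b]\<^sub>q * qq * qq = ([a + b]\<^sub>q * qq) * ([a - b]\<^sub>q * qq)"
    by (simp add: algebra_simps)
  also have "\<dots> = ([a]\<^sub>q * qq) * ([a]\<^sub>q * qq) - ([b]\<^sub>q * qq) * ([b]\<^sub>q * qq)"
    unfolding e using u by Groebner_Basis.algebra
  also have "\<dots> = ([a]\<^sub>q\<^sup>2 - [b]\<^sub>q\<^sup>2) * qq * qq"
    by (simp add: power2_eq_square algebra_simps)
  finally show ?thesis using qq_nonzero by simp
qed

lemma br_step2: "[m + 1]\<^sub>q - [m - 1]\<^sub>q = dd m"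
proof -
  define A A' Q Q' where "A = qpow h m" "A' = qpow h (- m)" "Q = qpow h 1" "Q' = qpow h (- 1)"
  note defs = this
  have e: "[m + 1]\<^sub>q * qq = A * Q - A' * Q'" "[m - 1]\<^sub>q * qq = A * Q' - A' * Q"
    unfolding br_times_qq defs by (simp_all add: qpow_add[symmetric])
  have "([m + 1]\<^sub>q - [m - 1]\<^sub>q) * qq = (A + A') * (Q - Q')"
    unfolding left_diff_distrib e by (simp add: algebra_simps)
  then have "([m + 1]\<^sub>q - [m - 1]\<^sub>q) * qq = dd m * qq"
    by (simp add: defs)
  then show ?thesis using qq_nonzero by simp
qed

lemma br_double: "[2 * m]\<^sub>q = [m]\<^sub>q * dd m"
proof -
  have "[2 * m]\<^sub>q * qq = qpow h m * qpow h m - qpow h (- m) * qpow h (- m)"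
    unfolding br_times_qq mult_2 minus_add_distrib qpow_add by simp
  also have "\<dots> = ([m]\<^sub>q * qq) * dd m"
    unfolding br_times_qq by (simp add: algebra_simps)
  finally have "[2 * m]\<^sub>q * qq = [m]\<^sub>q * dd m * qq"
    by (simp add: mult_ac)
  then show ?thesis using qq_nonzero by simp
qed

lemma br_eq_0_iff: "[b]\<^sub>q = 0 \<longleftrightarrow> qpow h (2 * b) = 1"
proof -
  have "[b]\<^sub>q = 0 \<longleftrightarrow> qpow h b = qpow h (- b)"
    using qq_nonzero by (simp add: qnum_def)
  also have "\<dots> \<longleftrightarrow> qpow h (2 * b) = 1"
    unfolding qpow_double power2_eq_square using qpow_mult_minus[of h b] qpow_nonzero[of h b]
    by (metis mult_cancel_left)
  finally show ?thesis .
qed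

lemma dd_eq_0_iff: "dd m = 0 \<longleftrightarrow> qpow h (2 * m) = - 1"
proof -
  have "dd m = 0 \<longleftrightarrow> qpow h m = - qpow h (- m)"
    by (simp add: eq_neg_iff_add_eq_0)
  also have "\<dots> \<longleftrightarrow> qpow h (2 * m) = - 1"
    unfolding qpow_double power2_eq_square using qpow_mult_minus[of h m] qpow_nonzero[of h m]
    by (metis mult_cancel_left mult_minus_right)
  finally show ?thesis .
qed

text \<open>
  The next three lemmas have their arguments tied by equations, so that they apply to q-numbers whose
  arguments are in any normal form.
\<close>

lemma br_shift_prod_at: "x + 1 = x' \<Longrightarrow> y + 1 = y' \<Longrightarrow> x + y + 1 = z \<Longrightarrow> [x']\<^sub>q * [y']\<^sub>q - [x]\<^sub>q * [y]\<^sub>q = [z]\<^sub>q"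
  using br_shift_prod by blast
lemma br_shift_cross_at:
  assumes "x + 1 = x'" "y + 1 = y'" "x - y = z"
  shows "[x]\<^sub>q * [y']\<^sub>q - [x']\<^sub>q * [y]\<^sub>q = [z]\<^sub>q"
proof -
  have "[x']\<^sub>q * [- y]\<^sub>q - [x]\<^sub>q * [- y']\<^sub>q = [z]\<^sub>q"
    using assms by (intro br_shift_prod_at) auto
  then show ?thesis by (simp add: br_minus)
qed
lemma br_next: "x + 1 = y \<Longrightarrow> y + 1 = z \<Longrightarrow> [z]\<^sub>q = [2]\<^sub>q * [y]\<^sub>q - [x]\<^sub>q"
  using br_2[of y] by auto

end

section \<open>The generators in coordinates\<close>

abbreviation lookup where "lookup \<equiv> Poly_Mapping.lookup"
abbreviation keys where "keys \<equiv> Poly_Mapping.keys"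

lemma lookup_vscale: "lookup (vscale c v) k = c * lookup v k"
  unfolding vscale_def by (simp add: map.rep_eq when_def)

lemma vscale_add_right: "vscale c (v + w) = vscale c v + vscale c w"
  by (rule poly_mapping_eqI) (simp add: lookup_vscale lookup_add ring_distribs)

lemma vscale_add_left: "vscale (c + d) v = vscale c v + vscale d v"
  by (rule poly_mapping_eqI) (simp add: lookup_vscale lookup_add ring_distribs)

lemma vscale_vscale: "vscale c (vscale d v) = vscale (c * d) v"
  by (rule poly_mapping_eqI) (simp add: lookup_vscale)

lemma vscale_0 [simp]: "vscale 0 v = 0"
  by (rule poly_mapping_eqI) (simp add: lookup_vscale)

lemma vscale_1 [simp]: "vscale 1 v = v"
  by (rule poly_mapping_eqI) (simp add: lookup_vscale)

lemma vscale_zero [simp]: "vscale c 0 = 0"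
  by (rule poly_mapping_eqI) (simp add: lookup_vscale)

text \<open>
  The generators and the free algebra both act by sums over the support of a vector or of an algebra
  element; enlarging the range of summation makes such sums linear.
\<close>

lemma sum_keys_superset:
  assumes "finite B" "keys v \<subseteq> B"
  shows "(\<Sum>k\<in>keys v. vscale (lookup v k) (F k)) = (\<Sum>k\<in>B. vscale (lookup v k) (F k))"
  using assms by (intro sum.mono_neutral_left) (auto simp: in_keys_iff)

lemma sum_keys_add:
  "(\<Sum>k\<in>keys (v + w). vscale (lookup (v + w) k) (F k)) =
   (\<Sum>k\<in>keys v. vscale (lookup v k) (F k)) + (\<Sum>k\<in>keys w. vscale (lookup w k) (F k))"
proof -
  let ?B = "keys v \<union> keys w"
  have "keys (v + w) \<subseteq> ?B" by (rule keys_add)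
  then show ?thesis
    unfolding sum_keys_superset[OF _ \<open>keys (v + w) \<subseteq> ?B\<close>, simplified]
    by (simp add: sum_keys_superset[of ?B v] sum_keys_superset[of ?B w] lookup_add vscale_add_left sum.distrib)
qed

lemma vscale_sum: "vscale c (\<Sum>k\<in>A. F k) = (\<Sum>k\<in>A. vscale c (F k))"
  by (induction A rule: infinite_finite_induct) (simp_all add: vscale_add_right)

lemma sum_keys_vscale:
  "(\<Sum>k\<in>keys (vscale c v). vscale (lookup (vscale c v) k) (F k)) =
   vscale c (\<Sum>k\<in>keys v. vscale (lookup v k) (F k))"
proof -
  have sub: "keys (vscale c v) \<subseteq> keys v"
    by (auto simp: in_keys_iff lookup_vscale)
  show ?thesis
    unfolding sum_keys_superset[OF finite_keys sub]
    by (simp add: vscale_sum vscale_vscale lookup_vscale)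
qed

lemma sum_keys_lookup_single:
  fixes v :: "'k \<Rightarrow>\<^sub>0 complex" and \<phi> :: "'k \<Rightarrow> complex"
  assumes "\<And>k. f k = x \<longleftrightarrow> k = y"
  shows "(\<Sum>k\<in>keys v. lookup v k * lookup (Poly_Mapping.single (f k) (\<phi> k)) x) = \<phi> y * lookup v y"
proof -
  have "(\<Sum>k\<in>keys v. lookup v k * lookup (Poly_Mapping.single (f k) (\<phi> k)) x)
      = (\<Sum>k\<in>keys v. if k = y then lookup v k * \<phi> k else 0)"
    by (rule sum.cong) (auto simp: assms lookup_single when_def)
  also have "\<dots> = \<phi> y * lookup v y"
    by (simp add: in_keys_iff)
  finally show ?thesis .
qed

lemma lookup_gen_act:
  "lookup (gen_act h p r g v) x = (\<Sum>k\<in>keys v. lookup v k * lookup (gen_on_basis h p r g k) x)"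
  by (simp add: gen_act_def lookup_sum lookup_vscale)

lemma lookup_gen_act_I21:
  "lookup (gen_act h p r I21 v) (l, m) = \<i> * qnum h m * lookup v (l, m)"
proof -
  have b: "gen_on_basis h p r I21 k = Poly_Mapping.single k (\<i> * qnum h (snd k))" for k
    by (cases k) simp
  show ?thesis
    unfolding lookup_gen_act b by (subst sum_keys_lookup_single[where y = "(l, m)"]) auto
qed

text \<open>
  On coordinates the action is transposed: the coordinate at \<open>(l, m)\<close> collects the contributions of
  the neighbours from which a move leads to \<open>(l, m)\<close>.
\<close>

lemma lookup_gen_act_I32:
  "lookup (gen_act h p r I32 v) (l, m) =
     coeff_a h l (m - 1) * lookup v (l, m - 1) - lookup v (l, m + 1)"
proof -
  let ?A = "\<lambda>k. Poly_Mapping.single (fst k, snd k + 1) (coeff_a h (fst k) (snd k))"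
    and ?B = "\<lambda>k. Poly_Mapping.single (fst k, snd k - 1) 1"
  have b: "gen_on_basis h p r I32 k = ?A k - ?B k" for k
    by (cases k) simp
  have "(\<Sum>k\<in>keys v. lookup v k * lookup (?A k) (l, m)) = coeff_a h l (m - 1) * lookup v (l, m - 1)"
    by (subst sum_keys_lookup_single[where y = "(l, m - 1)"]) auto
  moreover have "(\<Sum>k\<in>keys v. lookup v k * lookup (?B k) (l, m)) = lookup v (l, m + 1)"
    by (subst sum_keys_lookup_single[where y = "(l, m + 1)"]) auto
  ultimately show ?thesis
    unfolding lookup_gen_act b lookup_minus right_diff_distrib sum_subtractf by simp
qed

lemma lookup_gen_act_I43:
  "lookup (gen_act h p r I43 v) (l, m) =
     coeff_b h p r (l - 1) m * lookup v (l - 1, m) - qnum h (l + 1 - m) * lookup v (l + 1, m)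
     + \<i> * coeff_c h p r l m * lookup v (l, m)"
proof -
  let ?A = "\<lambda>k. Poly_Mapping.single (fst k + 1, snd k) (coeff_b h p r (fst k) (snd k))"
    and ?B = "\<lambda>k. Poly_Mapping.single (fst k - 1, snd k) (qnum h (fst k - snd k))"
    and ?C = "\<lambda>k. Poly_Mapping.single k (\<i> * coeff_c h p r (fst k) (snd k))"
  have b: "gen_on_basis h p r I43 k = ?A k - ?B k + ?C k" for k
    by (cases k) simp
  have "(\<Sum>k\<in>keys v. lookup v k * lookup (?A k) (l, m)) = coeff_b h p r (l - 1) m * lookup v (l - 1, m)"
    by (subst sum_keys_lookup_single[where y = "(l - 1, m)"]) auto
  moreover have "(\<Sum>k\<in>keys v. lookup v k * lookup (?B k) (l, m)) = qnum h (l + 1 - m) * lookup v (l + 1, m)"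
    by (subst sum_keys_lookup_single[where y = "(l + 1, m)"]) auto
  moreover have "(\<Sum>k\<in>keys v. lookup v k * lookup (?C k) (l, m)) = \<i> * coeff_c h p r l m * lookup v (l, m)"
    by (subst sum_keys_lookup_single[where y = "(l, m)"]) auto
  ultimately show ?thesis
    unfolding lookup_gen_act b lookup_minus lookup_add right_diff_distrib distrib_left
      sum_subtractf sum.distrib by simp
qed

lemma gen_act_add: "gen_act h p r g (v + w) = gen_act h p r g v + gen_act h p r g w"
  unfolding gen_act_def by (rule sum_keys_add)

lemma gen_act_vscale: "gen_act h p r g (vscale c v) = vscale c (gen_act h p r g v)"
  unfolding gen_act_def by (rule sum_keys_vscale)

section \<open>The action of the free algebra\<close>

text \<open>
  Every finitely supported function is a finite sum of functions supported at one point.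
\<close>

lemma poly_mapping_add_induct [case_names single add]:
  fixes f :: "'a \<Rightarrow>\<^sub>0 'b::comm_monoid_add"
  assumes single: "\<And>k c. P (Poly_Mapping.single k c)"
    and add: "\<And>f g. P f \<Longrightarrow> P g \<Longrightarrow> P (f + g)"
  shows "P f"
proof -
  have "P (\<Sum>k\<in>A. Poly_Mapping.single k (lookup f k))" for A
    using single[of undefined 0] by (induction A rule: infinite_finite_induct) (auto intro: single add)
  moreover have "f = (\<Sum>k\<in>keys f. Poly_Mapping.single k (lookup f k))"
    by (rule poly_mapping_eqI) (simp add: lookup_sum lookup_single when_def in_keys_iff)
  ultimately show ?thesis by metis
qed

lemma free_act_add: "free_act h p r (f + g) v = free_act h p r f v + free_act h p r g v"
  unfolding free_act_def by (rule sum_keys_add)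

lemma free_act_single: "free_act h p r (Poly_Mapping.single w c) v = vscale c (word_act h p r w v)"
  unfolding free_act_def by (cases "c = 0") simp_all

lemma word_act_plus: "word_act h p r (u + w) v = word_act h p r u (word_act h p r w v)"
  by (cases u; cases w) simp

lemma word_act_add: "word_act h p r w (u + v) = word_act h p r w u + word_act h p r w v"
proof (cases w)
  case (Word gs)
  then show ?thesis by (induction gs arbitrary: w) (simp_all add: gen_act_add)
qed

lemma word_act_vscale: "word_act h p r w (vscale c v) = vscale c (word_act h p r w v)"
proof (cases w)
  case (Word gs)
  then show ?thesis by (induction gs arbitrary: w) (simp_all add: gen_act_vscale)
qed

lemma free_act_vadd: "free_act h p r f (u + v) = free_act h p r f u + free_act h p r f v"
  by (simp add: free_act_def word_act_add vscale_add_right sum.distrib)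

lemma free_act_vscale: "free_act h p r f (vscale c v) = vscale c (free_act h p r f v)"
  by (simp add: free_act_def word_act_vscale vscale_sum vscale_vscale mult.commute)

lemma free_act_mult: "free_act h p r (f * g) v = free_act h p r f (free_act h p r g v)"
proof (induction f rule: poly_mapping_add_induct)
  case (single u c)
  show ?case
  proof (induction g rule: poly_mapping_add_induct)
    case (single w d)
    show ?case
      by (simp add: mult_single free_act_single word_act_plus word_act_vscale vscale_vscale)
  next
    case (add f g)
    then show ?case by (simp add: ring_distribs free_act_add free_act_vadd)
  qed
next
  case (add f g)
  then show ?case by (simp add: ring_distribs free_act_add)
qed

lemma free_act_scal: "free_act h p r (scal c) v = vscale c v"
  by (simp add: scal_def free_act_single zero_word_def)

lemma free_act_gen: "free_act h p r (gen g) v = gen_act h p r g v"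
  by (simp add: gen_def free_act_single)

lemma scal_neg_1: "scal (- 1) * f = - f" for f :: free_alg
  unfolding scal_def by (metis mult_minus1 single_one single_uminus)

lemma free_act_minus: "free_act h p r (- f) v = - free_act h p r f v"
proof -
  have "vscale (- 1) w = - w" for w :: vec
    by (rule poly_mapping_eqI) (simp add: lookup_vscale)
  then show ?thesis
    using free_act_mult[of h p r "scal (- 1)" f v] by (simp add: scal_neg_1 free_act_scal)
qed

lemma free_act_diff: "free_act h p r (f - g) v = free_act h p r f v - free_act h p r g v"
  using free_act_add[of h p r f "- g" v] by (simp add: free_act_minus)

lemma free_act_one: "free_act h p r 1 v = v"
  using free_act_scal[of h p r 1 v] by (simp add: scal_def)

lemma free_act_vzero: "free_act h p r f 0 = 0"
  using free_act_vscale[of h p r f 0 0] by simp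

lemma free_act_serre:
  "free_act h p r (serre h (gen x) (gen y)) v =
     gen_act h p r x (gen_act h p r x (gen_act h p r y v))
     - vscale (qnum h 2) (gen_act h p r x (gen_act h p r y (gen_act h p r x v)))
     + gen_act h p r y (gen_act h p r x (gen_act h p r x v)) + gen_act h p r y v"
  by (simp add: serre_def power2_eq_square mult.assoc free_act_add free_act_diff free_act_mult free_act_scal free_act_gen)

section \<open>Serre relations as nearest-neighbour operators\<close>

text \<open>
  The actions of \<open>I32\<close> and \<open>I43\<close> on coordinate functions, with arbitrary coefficient functions. With
  \<open>b = s = 0\<close> the operator \<open>op43\<close> is diagonal, so it also covers \<open>I21\<close>.
\<close>

definition op32 :: "(complex \<Rightarrow> complex \<Rightarrow> complex) \<Rightarrow> (complex \<Rightarrow> complex \<Rightarrow> complex) \<Rightarrow> complex \<Rightarrow> complex \<Rightarrow> complex"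
  where "op32 a v l m = a l (m - 1) * v l (m - 1) - v l (m + 1)"

definition op43 :: "(complex \<Rightarrow> complex \<Rightarrow> complex) \<Rightarrow> (complex \<Rightarrow> complex \<Rightarrow> complex) \<Rightarrow> (complex \<Rightarrow> complex \<Rightarrow> complex)
   \<Rightarrow> (complex \<Rightarrow> complex \<Rightarrow> complex) \<Rightarrow> complex \<Rightarrow> complex \<Rightarrow> complex"
  where "op43 b s c v l m = b (l - 1) m * v (l - 1) m - s (l + 1) m * v (l + 1) m + c l m * v l m"

text \<open>
  The left-hand side of a Serre relation as an explicit combination of the coordinates of \<open>v\<close>. The
  coefficient function of a displacement is evaluated at the point where the displacement starts. Each
  of the ten displacements (\<open>l\<close> changes by at most 2, \<open>m\<close> by 1) has its own coefficient, and
  the relation holds once these are the prescribed ones.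
\<close>

lemma serre_expand_43_32:
  fixes a b s c v :: "complex \<Rightarrow> complex \<Rightarrow> complex" and t l m :: complex
  defines "A32 \<equiv> op32 a" and "A43 \<equiv> op43 b s c"
  defines "K21 \<equiv> \<lambda>l m. a l m * b l (m+1) * b (l+1) (m+1) - t * (b l m * a (l+1) m * b (l+1) (m+1)) + b l m * b (l+1) m * a (l+2) m"
    and "K20 \<equiv> \<lambda>l m. b l (m-1) * b (l+1) (m-1) - t * (b l m * b (l+1) (m-1)) + b l m * b (l+1) m"
    and "K11 \<equiv> \<lambda>l m. a l m * b l (m+1) * (c l (m+1) + c (l+1) (m+1))
        - t * (b l m * a (l+1) m * c (l+1) (m+1) + c l m * a l m * b l (m+1))
        + b l m * (c l m + c (l+1) m) * a (l+1) m"
    and "K10 \<equiv> \<lambda>l m. b l (m-1) * (c l (m-1) + c (l+1) (m-1))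
        - t * (b l m * c (l+1) (m-1) + c l m * b l (m-1))
        + b l m * (c l m + c (l+1) m)"
    and "K01 \<equiv> \<lambda>l m. a l m * (- b l (m+1) * s (l+1) (m+1) - s l (m+1) * b (l-1) (m+1) + c l (m+1) ^ 2)
        - t * (- b l m * a (l+1) m * s (l+1) (m+1) - s l m * a (l-1) m * b (l-1) (m+1) + c l m * a l m * c l (m+1))
        + (- b l m * s (l+1) m - s l m * b (l-1) m + c l m ^ 2) * a l m"
    and "K00 \<equiv> \<lambda>l m. (- b l (m-1) * s (l+1) (m-1) - s l (m-1) * b (l-1) (m-1) + c l (m-1) ^ 2)
        - t * (- b l m * s (l+1) (m-1) - s l m * b (l-1) (m-1) + c l m * c l (m-1))
        + (- b l m * s (l+1) m - s l m * b (l-1) m + c l m ^ 2)"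
    and "Km1 \<equiv> \<lambda>l m. a l m * s l (m+1) * (c l (m+1) + c (l-1) (m+1))
        - t * (s l m * a (l-1) m * c (l-1) (m+1) + c l m * a l m * s l (m+1))
        + s l m * (c l m + c (l-1) m) * a (l-1) m"
    and "Km0 \<equiv> \<lambda>l m. s l (m-1) * (c l (m-1) + c (l-1) (m-1))
        - t * (s l m * c (l-1) (m-1) + c l m * s l (m-1))
        + s l m * (c l m + c (l-1) m)"
    and "Kn1 \<equiv> \<lambda>l m. a l m * s l (m+1) * s (l-1) (m+1) - t * (s l m * a (l-1) m * s (l-1) (m+1)) + s l m * s (l-1) m * a (l-2) m"
    and "Kn0 \<equiv> \<lambda>l m. s l (m-1) * s (l-1) (m-1) - t * (s l m * s (l-1) (m-1)) + s l m * s (l-1) m"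
  shows "A43 (A43 (A32 v)) l m - t * A43 (A32 (A43 v)) l m + A32 (A43 (A43 v)) l m
     = K21 (l-2) (m-1) * v (l-2) (m-1) - K20 (l-2) (m+1) * v (l-2) (m+1)
     + K11 (l-1) (m-1) * v (l-1) (m-1) - K10 (l-1) (m+1) * v (l-1) (m+1)
     + K01 l (m-1) * v l (m-1) - K00 l (m+1) * v l (m+1)
     - Km1 (l+1) (m-1) * v (l+1) (m-1) + Km0 (l+1) (m+1) * v (l+1) (m+1)
     + Kn1 (l+2) (m-1) * v (l+2) (m-1) - Kn0 (l+2) (m+1) * v (l+2) (m+1)"
  unfolding assms op32_def op43_def
  by (simp add: algebra_simps power2_eq_square)

text \<open>
  The relation with the roles exchanged: \<open>l\<close> changes by at most 1 and \<open>m\<close> by 0 or 2.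
\<close>

lemma serre_expand_32_43:
  fixes a b s c v :: "complex \<Rightarrow> complex \<Rightarrow> complex" and t l m :: complex
  defines "A32 \<equiv> op32 a" and "A43 \<equiv> op43 b s c"
  defines "K12 \<equiv> \<lambda>l m. b l m * a (l+1) m * a (l+1) (m+1) - t * (a l m * b l (m+1) * a (l+1) (m+1)) + a l m * a l (m+1) * b l (m+2)"
    and "K10 \<equiv> \<lambda>l m. b l m * (a (l+1) m + a (l+1) (m-1)) - t * (a l m * b l (m+1) + b l (m-1) * a (l+1) (m-1))
      + (a l m + a l (m-1)) * b l m"
    and "K1m \<equiv> \<lambda>l m. b l m - t * b l (m-1) + b l (m-2)"
    and "K02 \<equiv> \<lambda>l m. c l m * a l m * a l (m+1) - t * (a l m * c l (m+1) * a l (m+1)) + a l m * a l (m+1) * c l (m+2)"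
    and "K00 \<equiv> \<lambda>l m. c l m * (a l m + a l (m-1)) - t * (a l m * c l (m+1) + c l (m-1) * a l (m-1))
      + (a l m + a l (m-1)) * c l m"
    and "K0m \<equiv> \<lambda>l m. c l m - t * c l (m-1) + c l (m-2)"
    and "Km2 \<equiv> \<lambda>l m. s l m * a (l-1) m * a (l-1) (m+1) - t * (a l m * s l (m+1) * a (l-1) (m+1)) + a l m * a l (m+1) * s l (m+2)"
    and "Km0 \<equiv> \<lambda>l m. s l m * (a (l-1) m + a (l-1) (m-1)) - t * (a l m * s l (m+1) + s l (m-1) * a (l-1) (m-1))
      + (a l m + a l (m-1)) * s l m"
    and "Kmm \<equiv> \<lambda>l m. s l m - t * s l (m-1) + s l (m-2)"
  shows "A32 (A32 (A43 v)) l m - t * A32 (A43 (A32 v)) l m + A43 (A32 (A32 v)) l m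
     = K12 (l-1) (m-2) * v (l-1) (m-2) - K10 (l-1) m * v (l-1) m + K1m (l-1) (m+2) * v (l-1) (m+2)
     + K02 l (m-2) * v l (m-2) - K00 l m * v l m + K0m l (m+2) * v l (m+2)
     - Km2 (l+1) (m-2) * v (l+1) (m-2) + Km0 (l+1) m * v (l+1) m - Kmm (l+1) (m+2) * v (l+1) (m+2)"
  unfolding assms op32_def op43_def
  by (simp add: algebra_simps power2_eq_square)

section \<open>The lattice of labels\<close>

text \<open>
  The three hypotheses say, in this order, that the denominators of \<open>a\<close> do not vanish, that
  \<open>[l] \<noteq> 0\<close>, and that \<open>[2 l + k] \<noteq> 0\<close> for integers \<open>k\<close>, on the whole lattice. The first one also separates the
  eigenvalues of \<open>I21\<close>, and the last one the values of \<open>a\<close> in a column.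
\<close>

locale so4_rep = q_generic h for h +
  fixes p r l0 m0 :: complex
  assumes m_generic: "\<And>k :: int. qpow h (2 * m0 + of_int k) \<noteq> - 1"
    and l_generic: "\<And>k :: int. qpow h (2 * l0 + 2 * of_int k) \<noteq> 1"
    and l_generic2: "\<And>k :: int. qpow h (4 * l0 + 2 * of_int k) \<noteq> 1"
begin

definition in_L :: "complex \<Rightarrow> bool" where "in_L l \<longleftrightarrow> l - l0 \<in> \<int>"
definition in_M :: "complex \<Rightarrow> bool" where "in_M m \<longleftrightarrow> m - m0 \<in> \<int>"

lemma in_L_shift [simp]: "in_L (l + 1) = in_L l" "in_L (l - 1) = in_L l"
proof -
  have "l + 1 - l0 = (l - l0) + 1" "l - 1 - l0 = (l - l0) - 1" by simp_all
  moreover have "x + 1 \<in> \<int> \<longleftrightarrow> x \<in> \<int>" "x - 1 \<in> \<int> \<longleftrightarrow> x \<in> \<int>" for x :: complex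
    by (metis Ints_1 Ints_add Ints_diff add_diff_cancel_right' diff_add_cancel)+
  ultimately show "in_L (l + 1) = in_L l" "in_L (l - 1) = in_L l"
    unfolding in_L_def by metis+
qed

lemma in_M_shift [simp]: "in_M (m + 1) = in_M m" "in_M (m - 1) = in_M m"
proof -
  have "m + 1 - m0 = (m - m0) + 1" "m - 1 - m0 = (m - m0) - 1" by simp_all
  moreover have "x + 1 \<in> \<int> \<longleftrightarrow> x \<in> \<int>" "x - 1 \<in> \<int> \<longleftrightarrow> x \<in> \<int>" for x :: complex
    by (metis Ints_1 Ints_add Ints_diff add_diff_cancel_right' diff_add_cancel)+
  ultimately show "in_M (m + 1) = in_M m" "in_M (m - 1) = in_M m"
    unfolding in_M_def by metis+
qed

lemma in_L_shift2 [simp]: "in_L (l + 2) = in_L l" "in_L (l - 2) = in_L l"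
proof -
  have "l + 2 = l + 1 + 1" "l - 2 = l - 1 - 1" by simp_all
  then show "in_L (l + 2) = in_L l" "in_L (l - 2) = in_L l" by (metis in_L_shift)+
qed

lemma in_M_shift2 [simp]: "in_M (m + 2) = in_M m" "in_M (m - 2) = in_M m"
proof -
  have "m + 2 = m + 1 + 1" "m - 2 = m - 1 - 1" by simp_all
  then show "in_M (m + 2) = in_M m" "in_M (m - 2) = in_M m" by (metis in_M_shift)+
qed

lemma in_L_E:
  assumes "in_L l" obtains k :: int where "l = l0 + of_int k"
  using assms unfolding in_L_def by (metis Ints_cases add.commute diff_add_cancel)

lemma in_M_E:
  assumes "in_M m" obtains k :: int where "m = m0 + of_int k"
  using assms unfolding in_M_def by (metis Ints_cases add.commute diff_add_cancel)

lemma br_l_nonzero: "in_L l \<Longrightarrow> [l]\<^sub>q \<noteq> 0"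
  using l_generic by (auto elim!: in_L_E simp: br_eq_0_iff ring_distribs)

lemma br_2l_nonzero:
  assumes "in_L l" shows "[2 * l + of_int k]\<^sub>q \<noteq> 0"
proof -
  from assms obtain j where j: "l = l0 + of_int j" by (rule in_L_E)
  have "2 * (2 * l + of_int k) = 4 * l0 + 2 * of_int (2 * j + k)"
    by (simp add: j algebra_simps)
  then show ?thesis using l_generic2[of "2 * j + k"] unfolding br_eq_0_iff by metis
qed

lemma dd_nonzero:
  assumes "in_M m" shows "dd m \<noteq> 0"
proof -
  from assms obtain j where j: "m = m0 + of_int j" by (rule in_M_E)
  have "2 * m = 2 * m0 + of_int (2 * j)"
    by (simp add: j algebra_simps)
  then show ?thesis using m_generic[of "2 * j"] by (simp add: dd_eq_0_iff)
qed

end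

section \<open>Coefficient identities\<close>

context so4_rep begin

definition invD :: "complex \<Rightarrow> complex" where "invD m = inverse (dd m)"
definition invl :: "complex \<Rightarrow> complex" where "invl l = inverse [l]\<^sub>q"

lemma invD: "in_M m \<Longrightarrow> invD m * dd m = 1"
  using dd_nonzero by (simp add: invD_def)
lemma invl: "in_L l \<Longrightarrow> invl l * [l]\<^sub>q = 1"
  using br_l_nonzero by (simp add: invl_def)

text \<open>
  The factor of \<open>b\<close> that depends only on \<open>l\<close>, and the constant factor of \<open>c\<close>, including the imaginary
  unit with which \<open>c\<close> occurs in the action.
\<close>

definition ff :: "complex \<Rightarrow> complex" where
  "ff l = [p + l + 2]\<^sub>q * [p - l]\<^sub>q * [l + r + 1]\<^sub>q * [l - r + 1]\<^sub>q
     / ([l + 1]\<^sub>q\<^sup>2 * [2 * l + 1]\<^sub>q * [2 * l + 3]\<^sub>q)"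

definition gg :: complex where "gg = \<i> * [p + 1]\<^sub>q * [r]\<^sub>q"

abbreviation a :: "complex \<Rightarrow> complex \<Rightarrow> complex" where "a \<equiv> coeff_a h"
abbreviation b :: "complex \<Rightarrow> complex \<Rightarrow> complex" where "b \<equiv> coeff_b h p r"
abbreviation s :: "complex \<Rightarrow> complex \<Rightarrow> complex" where "s l m \<equiv> [l - m]\<^sub>q"
abbreviation c :: "complex \<Rightarrow> complex \<Rightarrow> complex" where "c l m \<equiv> \<i> * coeff_c h p r l m"

lemma a_eq: "a l m = [l + m + 1]\<^sub>q * [l - m]\<^sub>q * (invD m * invD (m + 1))"
  by (simp add: coeff_a_def invD_def divide_inverse)
lemma b_eq: "b l m = ff l * [l + m + 1]\<^sub>q"
  by (simp add: coeff_b_def ff_def)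
lemma c_eq: "c l m = gg * [m]\<^sub>q * (invl l * invl (l + 1))"
  by (simp add: coeff_c_def gg_def invl_def divide_inverse)

text \<open>
  In the coefficient identities for the relation between \<open>I43\<close> and \<open>I32\<close>, the suffix names the
  displacement: the change of \<open>l\<close>, then the direction in which \<open>m\<close> moves. Here all common factors
  cancel and the recursion for \<open>[l - m]\<close> remains.
\<close>

lemma serre_43_32_up2_right:
  "a l m * b l (m+1) * b (l+1) (m+1) - [2]\<^sub>q * (b l m * a (l+1) m * b (l+1) (m+1)) + b l m * b (l+1) m * a (l+2) m = 0"
proof -
  define S0 S1 S2 T1 T2 T3 where "S0 = [l - m]\<^sub>q" "S1 = [l - m + 1]\<^sub>q" "S2 = [l - m + 2]\<^sub>q"
    "T1 = [l + m + 1]\<^sub>q" "T2 = [l + m + 2]\<^sub>q" "T3 = [l + m + 3]\<^sub>q"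
  note defs = this
  have S: "S2 = [2]\<^sub>q * S1 - S0"
    unfolding defs by (rule br_next) simp_all
  have e: "a l m = T1 * S0 * (invD m * invD (m + 1))" "a (l+1) m = T2 * S1 * (invD m * invD (m + 1))"
     "a (l+2) m = T3 * S2 * (invD m * invD (m + 1))"
    "b l (m+1) = ff l * T2" "b l m = ff l * T1" "b (l+1) (m+1) = ff (l+1) * T3" "b (l+1) m = ff (l+1) * T2"
    unfolding a_eq b_eq defs by (simp_all add: algebra_simps)
  show ?thesis unfolding e S by (simp add: algebra_simps)
qed

lemma serre_43_32_up2_left: "b l (m-1) * b (l+1) (m-1) - [2]\<^sub>q * (b l m * b (l+1) (m-1)) + b l m * b (l+1) m = 0"
proof -
  define T0 T1 T2 where "T0 = [l + m]\<^sub>q" "T1 = [l + m + 1]\<^sub>q" "T2 = [l + m + 2]\<^sub>q"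
  note defs = this
  have S: "T2 = [2]\<^sub>q * T1 - T0"
    unfolding defs by (rule br_next) simp_all
  have e: "b l (m-1) = ff l * T0" "b l m = ff l * T1" "b (l+1) (m-1) = ff (l+1) * T1" "b (l+1) m = ff (l+1) * T2"
    unfolding b_eq defs by (simp_all add: algebra_simps)
  show ?thesis unfolding e S by (simp add: algebra_simps)
qed

text \<open>
  The identities that change \<open>l\<close> by 1 mix \<open>b\<close> or \<open>s\<close> with \<open>c\<close>. After cancelling the common factors two
  terms are left, with denominators \<open>[l]\<close> and \<open>[l + 2]\<close>; the product formula turns their numerators
  into \<open>[l]\<close> and \<open>- [l + 2]\<close>, so that they add up to \<open>1 - 1\<close>. The other three identities of this
  kind are analogous.
\<close>

lemma serre_43_32_up1_right:
  assumes "in_L l"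
  shows "a l m * b l (m+1) * (c l (m+1) + c (l+1) (m+1))
        - [2]\<^sub>q * (b l m * a (l+1) m * c (l+1) (m+1) + c l m * a l m * b l (m+1))
        + b l m * (c l m + c (l+1) m) * a (l+1) m = 0"
proof -
  define S0 S1 T1 T2 M0 M1 M2 M' iE w0 w1 w2 where "S0 = [l - m]\<^sub>q" "S1 = [l - m + 1]\<^sub>q" 
    "T1 = [l + m + 1]\<^sub>q" "T2 = [l + m + 2]\<^sub>q" "M0 = [m]\<^sub>q" "M1 = [m + 1]\<^sub>q" "M2 = [m + 2]\<^sub>q" "M' = [m - 1]\<^sub>q"
    "iE = invD m * invD (m + 1)" "w0 = invl l" "w1 = invl (l + 1)" "w2 = invl (l + 2)"
  note defs = this
  have e: "a l m = T1 * S0 * iE" "a (l+1) m = T2 * S1 * iE"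
    "b l (m+1) = ff l * T2" "b l m = ff l * T1" 
    "c l (m+1) = gg * M1 * (w0 * w1)" "c l m = gg * M0 * (w0 * w1)"
    "c (l+1) (m+1) = gg * M1 * (w1 * w2)" "c (l+1) m = gg * M0 * (w1 * w2)"
    unfolding a_eq b_eq c_eq defs by (simp_all add: algebra_simps)
  have M: "M1 = [2]\<^sub>q * M0 - M'" "M2 = [2]\<^sub>q * M1 - M0"
    unfolding defs by (rule br_next; simp)+
  have 1: "w0 * (S0 * M1 - [2]\<^sub>q * M0 * S0 + S1 * M0) = 1"
  proof -
    have "S0 * M1 - [2]\<^sub>q * M0 * S0 + S1 * M0 = S1 * M0 - S0 * M'"
      unfolding M(1) by (simp add: algebra_simps)
    also have "\<dots> = [l]\<^sub>q" unfolding defs by (rule br_shift_prod_at) simp_all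
    finally show ?thesis using invl[OF assms] by (simp add: defs)
  qed
  have 2: "w2 * (S0 * M1 - [2]\<^sub>q * M1 * S1 + S1 * M0) = - 1"
  proof -
    have "S0 * M1 - [2]\<^sub>q * M1 * S1 + S1 * M0 = - (S1 * M2 - S0 * M1)"
      unfolding M(2) by (simp add: algebra_simps)
    also have "S1 * M2 - S0 * M1 = [l + 2]\<^sub>q" unfolding defs by (rule br_shift_prod_at) simp_all
    finally show ?thesis using invl[of "l + 2"] assms by (simp add: defs)
  qed
  have "a l m * b l (m+1) * (c l (m+1) + c (l+1) (m+1))
        - [2]\<^sub>q * (b l m * a (l+1) m * c (l+1) (m+1) + c l m * a l m * b l (m+1))
        + b l m * (c l m + c (l+1) m) * a (l+1) m
      = ff l * gg * iE * w1 * T1 * T2 * (w0 * (S0 * M1 - [2]\<^sub>q * M0 * S0 + S1 * M0) + w2 * (S0 * M1 - [2]\<^sub>q * M1 * S1 + S1 * M0))"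
    unfolding e by (simp add: algebra_simps)
  then show ?thesis unfolding 1 2 by simp
qed

lemma serre_43_32_up1_left:
  assumes "in_L l"
  shows "b l (m-1) * (c l (m-1) + c (l+1) (m-1))
        - [2]\<^sub>q * (b l m * c (l+1) (m-1) + c l m * b l (m-1))
        + b l m * (c l m + c (l+1) m) = 0"
proof -
  define T0 T1 M0 M1 M2 M' w0 w1 w2 where "T0 = [l + m]\<^sub>q" "T1 = [l + m + 1]\<^sub>q" "M0 = [m - 1]\<^sub>q"
    "M1 = [m]\<^sub>q" "M2 = [m + 1]\<^sub>q" "M' = [m - 2]\<^sub>q" "w0 = invl l" "w1 = invl (l + 1)" "w2 = invl (l + 2)"
  note defs = this
  have e: "b l (m-1) = ff l * T0" "b l m = ff l * T1"
    "c l (m-1) = gg * M0 * (w0 * w1)" "c l m = gg * M1 * (w0 * w1)"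
    "c (l+1) (m-1) = gg * M0 * (w1 * w2)" "c (l+1) m = gg * M1 * (w1 * w2)"
    unfolding b_eq c_eq defs by (simp_all add: algebra_simps)
  have M: "M1 = [2]\<^sub>q * M0 - M'" "M2 = [2]\<^sub>q * M1 - M0"
    unfolding defs by (rule br_next; simp)+
  have 1: "w0 * (T0 * M0 - [2]\<^sub>q * M1 * T0 + T1 * M1) = - 1"
  proof -
    have "T0 * M0 - [2]\<^sub>q * M1 * T0 + T1 * M1 = - (T0 * M2 - T1 * M1)"
      unfolding M(2) by (simp add: algebra_simps)
    also have "T0 * M2 - T1 * M1 = [l]\<^sub>q" unfolding defs by (rule br_shift_cross_at) simp_all
    finally show ?thesis using invl[OF assms] by (simp add: defs)
  qed
  have 2: "w2 * (T0 * M0 - [2]\<^sub>q * M0 * T1 + T1 * M1) = 1"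
  proof -
    have "T0 * M0 - [2]\<^sub>q * M0 * T1 + T1 * M1 = T0 * M0 - T1 * M'"
      unfolding M(1) by (simp add: algebra_simps)
    also have "\<dots> = [l + 2]\<^sub>q" unfolding defs by (rule br_shift_cross_at) simp_all
    finally show ?thesis using invl[of "l + 2"] assms by (simp add: defs)
  qed
  have "b l (m-1) * (c l (m-1) + c (l+1) (m-1))
        - [2]\<^sub>q * (b l m * c (l+1) (m-1) + c l m * b l (m-1))
        + b l m * (c l m + c (l+1) m)
     = ff l * gg * w1 * (w0 * (T0 * M0 - [2]\<^sub>q * M1 * T0 + T1 * M1) + w2 * (T0 * M0 - [2]\<^sub>q * M0 * T1 + T1 * M1))"
    unfolding e by (simp add: algebra_simps)
  then show ?thesis unfolding 1 2 by simp
qed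

lemma serre_43_32_down1_right:
  assumes "in_L l"
  shows "a l m * s l (m+1) * (c l (m+1) + c (l-1) (m+1))
        - [2]\<^sub>q * (s l m * a (l-1) m * c (l-1) (m+1) + c l m * a l m * s l (m+1))
        + s l m * (c l m + c (l-1) m) * a (l-1) m = 0"
proof -
  define S0 S' T0 T1 M0 M1 M2 M' iE w0 w1 w' where "S0 = [l - m]\<^sub>q" "S' = [l - m - 1]\<^sub>q" 
    "T0 = [l + m]\<^sub>q" "T1 = [l + m + 1]\<^sub>q" "M0 = [m]\<^sub>q" "M1 = [m + 1]\<^sub>q" "M2 = [m + 2]\<^sub>q" "M' = [m - 1]\<^sub>q"
    "iE = invD m * invD (m + 1)" "w0 = invl l" "w1 = invl (l + 1)" "w' = invl (l - 1)"
  note defs = this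
  have e: "a l m = T1 * S0 * iE" "a (l-1) m = T0 * S' * iE" "s l (m+1) = S'" "s l m = S0"
    "c l (m+1) = gg * M1 * (w0 * w1)" "c l m = gg * M0 * (w0 * w1)"
    "c (l-1) (m+1) = gg * M1 * (w' * w0)" "c (l-1) m = gg * M0 * (w' * w0)"
    unfolding a_eq c_eq defs by (simp_all add: algebra_simps)
  have M: "M1 = [2]\<^sub>q * M0 - M'" "M2 = [2]\<^sub>q * M1 - M0"
    unfolding defs by (rule br_next; simp)+
  have 1: "w1 * (T1 * M1 - [2]\<^sub>q * M0 * T1 + T0 * M0) = 1"
  proof -
    have "T1 * M1 - [2]\<^sub>q * M0 * T1 + T0 * M0 = T0 * M0 - T1 * M'"
      unfolding M(1) by (simp add: algebra_simps)
    also have "\<dots> = [l + 1]\<^sub>q" unfolding defs by (rule br_shift_cross_at) simp_all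
    finally show ?thesis using invl[of "l + 1"] assms by (simp add: defs)
  qed
  have 2: "w' * (T1 * M1 - [2]\<^sub>q * M1 * T0 + T0 * M0) = - 1"
  proof -
    have "T1 * M1 - [2]\<^sub>q * M1 * T0 + T0 * M0 = - (T0 * M2 - T1 * M1)"
      unfolding M(2) by (simp add: algebra_simps)
    also have "T0 * M2 - T1 * M1 = [l - 1]\<^sub>q" unfolding defs by (rule br_shift_cross_at) simp_all
    finally show ?thesis using invl[of "l - 1"] assms by (simp add: defs)
  qed
  have "a l m * s l (m+1) * (c l (m+1) + c (l-1) (m+1))
        - [2]\<^sub>q * (s l m * a (l-1) m * c (l-1) (m+1) + c l m * a l m * s l (m+1))
        + s l m * (c l m + c (l-1) m) * a (l-1) m
     = S0 * S' * iE * gg * w0 * (w1 * (T1 * M1 - [2]\<^sub>q * M0 * T1 + T0 * M0) + w' * (T1 * M1 - [2]\<^sub>q * M1 * T0 + T0 * M0))"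
    unfolding e by (simp add: algebra_simps)
  then show ?thesis unfolding 1 2 by simp
qed

lemma serre_43_32_down1_left:
  assumes "in_L l"
  shows "s l (m-1) * (c l (m-1) + c (l-1) (m-1))
        - [2]\<^sub>q * (s l m * c (l-1) (m-1) + c l m * s l (m-1))
        + s l m * (c l m + c (l-1) m) = 0"
proof -
  define S0 S1 M0 M1 M2 M' w0 w1 w' where "S0 = [l - m]\<^sub>q" "S1 = [l - m + 1]\<^sub>q" 
    "M0 = [m - 1]\<^sub>q" "M1 = [m]\<^sub>q" "M2 = [m + 1]\<^sub>q" "M' = [m - 2]\<^sub>q"
    "w0 = invl l" "w1 = invl (l + 1)" "w' = invl (l - 1)"
  note defs = this
  have e: "s l (m-1) = S1" "s l m = S0"
    "c l (m-1) = gg * M0 * (w0 * w1)" "c l m = gg * M1 * (w0 * w1)"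
    "c (l-1) (m-1) = gg * M0 * (w' * w0)" "c (l-1) m = gg * M1 * (w' * w0)"
    unfolding c_eq defs by (simp_all add: algebra_simps)
  have M: "M1 = [2]\<^sub>q * M0 - M'" "M2 = [2]\<^sub>q * M1 - M0"
    unfolding defs by (rule br_next; simp)+
  have 1: "w1 * (S1 * M0 - [2]\<^sub>q * M1 * S1 + S0 * M1) = - 1"
  proof -
    have "S1 * M0 - [2]\<^sub>q * M1 * S1 + S0 * M1 = - (S1 * M2 - S0 * M1)"
      unfolding M(2) by (simp add: algebra_simps)
    also have "S1 * M2 - S0 * M1 = [l + 1]\<^sub>q" unfolding defs by (rule br_shift_prod_at) simp_all
    finally show ?thesis using invl[of "l + 1"] assms by (simp add: defs)
  qed
  have 2: "w' * (S1 * M0 - [2]\<^sub>q * M0 * S0 + S0 * M1) = 1"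
  proof -
    have "S1 * M0 - [2]\<^sub>q * M0 * S0 + S0 * M1 = S1 * M0 - S0 * M'"
      unfolding M(1) by (simp add: algebra_simps)
    also have "\<dots> = [l - 1]\<^sub>q" unfolding defs by (rule br_shift_prod_at) simp_all
    finally show ?thesis using invl[of "l - 1"] assms by (simp add: defs)
  qed
  have "s l (m-1) * (c l (m-1) + c (l-1) (m-1))
        - [2]\<^sub>q * (s l m * c (l-1) (m-1) + c l m * s l (m-1))
        + s l m * (c l m + c (l-1) m)
     = gg * w0 * (w1 * (S1 * M0 - [2]\<^sub>q * M1 * S1 + S0 * M1) + w' * (S1 * M0 - [2]\<^sub>q * M0 * S0 + S0 * M1))"
    unfolding e by (simp add: algebra_simps)
  then show ?thesis unfolding 1 2 by simp
qed

lemma serre_43_32_down2_right: "a l m * s l (m+1) * s (l-1) (m+1) - [2]\<^sub>q * (s l m * a (l-1) m * s (l-1) (m+1)) + s l m * s (l-1) m * a (l-2) m = 0"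
proof -
  define S0 S1 S2 T0 T1 T2 where "S0 = [l - m]\<^sub>q" "S1 = [l - m - 1]\<^sub>q" "S2 = [l - m - 2]\<^sub>q"
    "T0 = [l + m - 1]\<^sub>q" "T1 = [l + m]\<^sub>q" "T2 = [l + m + 1]\<^sub>q"
  note defs = this
  have S: "T2 = [2]\<^sub>q * T1 - T0"
    unfolding defs by (rule br_next) simp_all
  have e: "a l m = T2 * S0 * (invD m * invD (m + 1))" "a (l-1) m = T1 * S1 * (invD m * invD (m + 1))"
     "a (l-2) m = T0 * S2 * (invD m * invD (m + 1))"
    "s l (m+1) = S1" "s l m = S0" "s (l-1) (m+1) = S2" "s (l-1) m = S1"
    unfolding a_eq defs by (simp_all add: algebra_simps)
  show ?thesis unfolding e S by (simp add: algebra_simps)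
qed

lemma serre_43_32_down2_left: "s l (m-1) * s (l-1) (m-1) - [2]\<^sub>q * (s l m * s (l-1) (m-1)) + s l m * s (l-1) m = 0"
proof -
  define S0 S1 S' where "S0 = [l - m]\<^sub>q" "S1 = [l - m + 1]\<^sub>q" "S' = [l - m - 1]\<^sub>q"
  note defs = this
  have S: "S1 = [2]\<^sub>q * S0 - S'"
    unfolding defs by (rule br_next) simp_all
  have e: "s l (m-1) = S1" "s l m = S0" "s (l-1) (m-1) = S0" "s (l-1) m = S'"
    unfolding defs by (simp_all add: algebra_simps)
  show ?thesis unfolding e S by (simp add: algebra_simps)
qed

text \<open>
  With \<open>F(x) = (P - x)(x - R) / x\<close>, where \<open>P = [p + 1]\<^sup>2\<close> and \<open>R = [r]\<^sup>2\<close>, the two terms in \<open>ff\<close> are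
  \<open>F([l + 1]\<^sup>2) / D\<close> and \<open>F([l]\<^sup>2) / D\<close> for \<open>D = [2 l + 1] = [l + 1]\<^sup>2 - [l]\<^sup>2\<close>. As
  \<open>F(x) = P + R - x - P R / x\<close>, the difference quotient of \<open>F\<close> is \<open>- 1\<close> plus the term \<open>P R / (x y)\<close>,
  which \<open>gg\<^sup>2\<close> cancels.
\<close>

lemma ladder:
  assumes "in_L l"
  shows "ff l * [2 * l + 3]\<^sub>q - ff (l - 1) * [2 * l - 1]\<^sub>q + gg\<^sup>2 * (invl l * invl (l + 1))\<^sup>2 = - 1"
proof -
  define P R x y D E F where "P = [p + 1]\<^sub>q\<^sup>2" "R = [r]\<^sub>q\<^sup>2" "x = [l]\<^sub>q\<^sup>2" "y = [l + 1]\<^sub>q\<^sup>2" "D = [2 * l + 1]\<^sub>q"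
    "E = [2 * l + 3]\<^sub>q" "F = [2 * l - 1]\<^sub>q"
  note defs = this
  have nz: "x \<noteq> 0" "y \<noteq> 0" "D \<noteq> 0" "E \<noteq> 0" "F \<noteq> 0"
    using assms br_l_nonzero[of l] br_l_nonzero[of "l + 1"] br_2l_nonzero[of l 1] br_2l_nonzero[of l 3]
      br_2l_nonzero[of l "-1"] by (simp_all add: defs)
  have D: "D = y - x"
    unfolding defs by (rule br_square_diff[symmetric])
  have sq: "[p + l + 2]\<^sub>q * [p - l]\<^sub>q = P - y" "[l + r + 1]\<^sub>q * [l - r + 1]\<^sub>q = y - R"
      "[p + l + 1]\<^sub>q * [p - l + 1]\<^sub>q = P - x" "[l + r]\<^sub>q * [l - r]\<^sub>q = x - R"
    using br_square_diff2[of "p + 1" "l + 1"] br_square_diff2[of "l + 1" r]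
      br_square_diff2[of "p + 1" l] br_square_diff2[of l r]
    unfolding defs by (simp_all add: algebra_simps)
  have f: "ff l * E = (P - y) * (y - R) / (y * D)"
  proof -
    have "ff l = (P - y) * (y - R) / (y * D * E)"
    proof -
      have "ff l = ([p + l + 2]\<^sub>q * [p - l]\<^sub>q) * ([l + r + 1]\<^sub>q * [l - r + 1]\<^sub>q) / (y * D * E)"
        unfolding ff_def defs by (simp only: mult.assoc)
      then show ?thesis unfolding sq .
    qed
    then show ?thesis using nz by simp
  qed
  have f': "ff (l - 1) * F = (P - x) * (x - R) / (x * D)"
  proof -
    have "ff (l - 1) = (P - x) * (x - R) / (x * F * D)"
    proof -
      have "p + (l - 1) + 2 = p + l + 1" "p - (l - 1) = p - l + 1" "l - 1 + r + 1 = l + r" "l - 1 - r + 1 = l - r"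
        "l - 1 + 1 = l" "2 * (l - 1) + 1 = 2 * l - 1" "2 * (l - 1) + 3 = 2 * l + 1"
        by (simp_all add: algebra_simps)
      then have "ff (l - 1) = ([p + l + 1]\<^sub>q * [p - l + 1]\<^sub>q) * ([l + r]\<^sub>q * [l - r]\<^sub>q) / (x * F * D)"
        unfolding ff_def defs by (simp only: mult.assoc)
      then show ?thesis unfolding sq .
    qed
    then show ?thesis using nz by simp
  qed
  have g: "gg\<^sup>2 * (invl l * invl (l + 1))\<^sup>2 = - (P * R / (x * y))"
    by (simp add: gg_def invl_def defs power_mult_distrib divide_inverse power_inverse)
  have "(P - y) * (y - R) / (y * D) - (P - x) * (x - R) / (x * D) - P * R / (x * y) + 1
     = (x * (P - y) * (y - R) - y * (P - x) * (x - R) - P * R * D + x * y * D) / (x * y * D)"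
    using nz by (simp add: field_simps)
  also have "\<dots> = 0"
    unfolding D by (simp add: algebra_simps)
  finally show ?thesis
    unfolding g using f f' by (simp add: defs algebra_simps)
qed

text \<open>
  Here the right-hand side of the Serre relation enters: after the product formula has simplified the
  coefficients of \<open>ff l\<close> and \<open>ff (l - 1)\<close>, the claim is exactly \<open>ladder\<close>.
\<close>

lemma serre_43_32_level_right:
  assumes "in_L l"
  shows "a l m * (- b l (m+1) * s (l+1) (m+1) - s l (m+1) * b (l-1) (m+1) + c l (m+1) ^ 2)
        - [2]\<^sub>q * (- b l m * a (l+1) m * s (l+1) (m+1) - s l m * a (l-1) m * b (l-1) (m+1) + c l m * a l m * c l (m+1))
        + (- b l m * s (l+1) m - s l m * b (l-1) m + c l m ^ 2) * a l m = - a l m"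
    (is "?lhs = _")
proof -
  define S0 S1 S2 S' T0 T1 T2 T' M0 M1 iE W where "S0 = [l - m]\<^sub>q" "S1 = [l - m + 1]\<^sub>q"
    "S2 = [l - m + 2]\<^sub>q" "S' = [l - m - 1]\<^sub>q" "T0 = [l + m]\<^sub>q" "T1 = [l + m + 1]\<^sub>q" "T2 = [l + m + 2]\<^sub>q"
    "T' = [l + m - 1]\<^sub>q" "M0 = [m]\<^sub>q" "M1 = [m + 1]\<^sub>q" "iE = invD m * invD (m + 1)" "W = invl l * invl (l + 1)"
  note defs = this
  have e: "a l m = T1 * S0 * iE" "a (l+1) m = T2 * S1 * iE" "a (l-1) m = T0 * S' * iE"
    "b l (m+1) = ff l * T2" "b l m = ff l * T1" "b (l-1) (m+1) = ff (l-1) * T1" "b (l-1) m = ff (l-1) * T0"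
    "s (l+1) (m+1) = S0" "s l (m+1) = S'" "s l m = S0" "s (l+1) m = S1"
    "c l (m+1) = gg * M1 * W" "c l m = gg * M0 * W"
    unfolding a_eq b_eq c_eq defs by (simp_all add: algebra_simps)
  have S: "S2 = [2]\<^sub>q * S1 - S0" "T1 = [2]\<^sub>q * T0 - T'"
    unfolding defs by (rule br_next; simp)+
  have 1: "- (T2 * S0) - T1 * S1 + [2]\<^sub>q * T2 * S1 = [2 * l + 3]\<^sub>q"
  proof -
    have "- (T2 * S0) - T1 * S1 + [2]\<^sub>q * T2 * S1 = T2 * S2 - T1 * S1"
      unfolding S(1) by (simp add: algebra_simps)
    also have "\<dots> = [2 * l + 3]\<^sub>q" unfolding defs by (rule br_shift_prod_at) simp_all
    finally show ?thesis .
  qed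
  have 2: "- (T1 * S') - T0 * S0 + [2]\<^sub>q * T0 * S' = - [2 * l - 1]\<^sub>q"
  proof -
    have "- (T1 * S') - T0 * S0 + [2]\<^sub>q * T0 * S' = - (T0 * S0 - T' * S')"
      unfolding S(2) by (simp add: algebra_simps)
    also have "T0 * S0 - T' * S' = [2 * l - 1]\<^sub>q" unfolding defs by (rule br_shift_prod_at) simp_all
    finally show ?thesis .
  qed
  have 3: "M0\<^sup>2 + M1\<^sup>2 - [2]\<^sub>q * M0 * M1 = 1"
    unfolding defs by (rule br_consecutive)
  have "?lhs = T1 * S0 * iE * (ff l * (- (T2 * S0) - T1 * S1 + [2]\<^sub>q * T2 * S1)
      + ff (l - 1) * (- (T1 * S') - T0 * S0 + [2]\<^sub>q * T0 * S')
      + gg\<^sup>2 * W\<^sup>2 * (M0\<^sup>2 + M1\<^sup>2 - [2]\<^sub>q * M0 * M1))"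
    unfolding e by (simp add: algebra_simps power2_eq_square)
  also have "\<dots> = T1 * S0 * iE * (ff l * [2 * l + 3]\<^sub>q - ff (l - 1) * [2 * l - 1]\<^sub>q + gg\<^sup>2 * W\<^sup>2)"
    unfolding 1 2 3 by simp
  also have "ff l * [2 * l + 3]\<^sub>q - ff (l - 1) * [2 * l - 1]\<^sub>q + gg\<^sup>2 * W\<^sup>2 = - 1"
    unfolding defs by (rule ladder[OF assms])
  also have "T1 * S0 * iE * - 1 = - a l m"
    unfolding e by simp
  finally show ?thesis .
qed

lemma serre_43_32_level_left:
  assumes "in_L l"
  shows "(- b l (m-1) * s (l+1) (m-1) - s l (m-1) * b (l-1) (m-1) + c l (m-1) ^ 2)
        - [2]\<^sub>q * (- b l m * s (l+1) (m-1) - s l m * b (l-1) (m-1) + c l m * c l (m-1))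
        + (- b l m * s (l+1) m - s l m * b (l-1) m + c l m ^ 2) = - 1"
    (is "?lhs = _")
proof -
  define S0 S1 S2 S' T0 T1 T2 T' M0 M1 W where "S0 = [l - m]\<^sub>q" "S1 = [l - m + 1]\<^sub>q"
    "S2 = [l - m + 2]\<^sub>q" "S' = [l - m - 1]\<^sub>q" "T0 = [l + m]\<^sub>q" "T1 = [l + m + 1]\<^sub>q" "T2 = [l + m + 2]\<^sub>q"
    "T' = [l + m - 1]\<^sub>q" "M0 = [m - 1]\<^sub>q" "M1 = [m]\<^sub>q" "W = invl l * invl (l + 1)"
  note defs = this
  have e: "b l (m-1) = ff l * T0" "b l m = ff l * T1" "b (l-1) (m-1) = ff (l-1) * T'" "b (l-1) m = ff (l-1) * T0"
    "s (l+1) (m-1) = S2" "s l (m-1) = S1" "s l m = S0" "s (l+1) m = S1"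
    "c l (m-1) = gg * M0 * W" "c l m = gg * M1 * W"
    unfolding b_eq c_eq defs by (simp_all add: algebra_simps)
  have S: "T2 = [2]\<^sub>q * T1 - T0" "S1 = [2]\<^sub>q * S0 - S'"
    unfolding defs by (rule br_next; simp)+
  have 1: "- (T0 * S2) - T1 * S1 + [2]\<^sub>q * T1 * S2 = [2 * l + 3]\<^sub>q"
  proof -
    have "- (T0 * S2) - T1 * S1 + [2]\<^sub>q * T1 * S2 = T2 * S2 - T1 * S1"
      unfolding S(1) by (simp add: algebra_simps)
    also have "\<dots> = [2 * l + 3]\<^sub>q" unfolding defs by (rule br_shift_prod_at) simp_all
    finally show ?thesis .
  qed
  have 2: "- (S1 * T') - S0 * T0 + [2]\<^sub>q * S0 * T' = - [2 * l - 1]\<^sub>q"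
  proof -
    have "- (S1 * T') - S0 * T0 + [2]\<^sub>q * S0 * T' = - (T0 * S0 - T' * S')"
      unfolding S(2) by (simp add: algebra_simps)
    also have "T0 * S0 - T' * S' = [2 * l - 1]\<^sub>q" unfolding defs by (rule br_shift_prod_at) simp_all
    finally show ?thesis .
  qed
  have 3: "M0\<^sup>2 + M1\<^sup>2 - [2]\<^sub>q * M0 * M1 = 1"
    using br_consecutive[of "m - 1"] unfolding defs by simp
  have "?lhs = ff l * (- (T0 * S2) - T1 * S1 + [2]\<^sub>q * T1 * S2)
      + ff (l - 1) * (- (S1 * T') - S0 * T0 + [2]\<^sub>q * S0 * T')
      + gg\<^sup>2 * W\<^sup>2 * (M0\<^sup>2 + M1\<^sup>2 - [2]\<^sub>q * M0 * M1)"
    unfolding e by (simp add: algebra_simps power2_eq_square)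
  also have "\<dots> = ff l * [2 * l + 3]\<^sub>q - ff (l - 1) * [2 * l - 1]\<^sub>q + gg\<^sup>2 * W\<^sup>2"
    unfolding 1 2 3 by simp
  also have "\<dots> = - 1"
    unfolding defs by (rule ladder[OF assms])
  finally show ?thesis .
qed

text \<open>
  The relation with \<open>I32\<close> squared is linear in \<open>I43\<close>, so the contributions of \<open>b\<close>, \<open>c\<close> and \<open>s\<close> can be
  treated separately. In each of them only the displacement with unchanged \<open>m\<close> is more than a
  recursion.
\<close>

lemma serre_32_43_up_right2: "b l m * a (l+1) m * a (l+1) (m+1) - [2]\<^sub>q * (a l m * b l (m+1) * a (l+1) (m+1)) + a l m * a l (m+1) * b l (m+2) = 0"
proof -
  define S0 S1 S' T1 T2 T3 E0 E1 where "S0 = [l - m]\<^sub>q" "S1 = [l - m + 1]\<^sub>q" "S' = [l - m - 1]\<^sub>q"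
    "T1 = [l + m + 1]\<^sub>q" "T2 = [l + m + 2]\<^sub>q" "T3 = [l + m + 3]\<^sub>q"
    "E0 = invD m * invD (m + 1)" "E1 = invD (m + 1) * invD (m + 2)"
  note defs = this
  have S: "S1 = [2]\<^sub>q * S0 - S'"
    unfolding defs by (rule br_next) simp_all
  have e: "a (l+1) m = T2 * S1 * E0" "a (l+1) (m+1) = T3 * S0 * E1" "a l m = T1 * S0 * E0" "a l (m+1) = T2 * S' * E1"
    "b l m = ff l * T1" "b l (m+1) = ff l * T2" "b l (m+2) = ff l * T3"
    unfolding a_eq b_eq defs by (simp_all add: algebra_simps)
  show ?thesis unfolding e S by (simp add: algebra_simps)
qed

text \<open>
  The source of the right-hand side of the relation in the displacements that keep \<open>m\<close>: dividing
  \<open>[2 m \<plusminus> 2]\<close> by \<open>q\<^sup>m\<^sup>\<plusminus>\<^sup>1 + q\<^sup>-\<^sup>m\<^sup>\<minusplus>\<^sup>1\<close> leaves \<open>[m \<plusminus> 1]\<close>, and the difference of these is \<open>q\<^sup>m + q\<^sup>-\<^sup>m\<close>.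
\<close>

lemma invD_difference:
  assumes "in_M m"
  shows "invD m * invD (m + 1) * [2 * m + 2]\<^sub>q - invD (m - 1) * invD m * [2 * m - 2]\<^sub>q = 1"
proof -
  have 1: "invD (m + 1) * [2 * m + 2]\<^sub>q = [m + 1]\<^sub>q" "invD (m - 1) * [2 * m - 2]\<^sub>q = [m - 1]\<^sub>q"
  proof -
    have *: "invD x * [2 * x]\<^sub>q = [x]\<^sub>q" if "in_M x" for x
      using invD[OF that] unfolding br_double by (simp add: mult_ac)
    have "2 * (m + 1) = 2 * m + 2" "2 * (m - 1) = 2 * m - 2" by simp_all
    then show "invD (m + 1) * [2 * m + 2]\<^sub>q = [m + 1]\<^sub>q" "invD (m - 1) * [2 * m - 2]\<^sub>q = [m - 1]\<^sub>q"
      using *[of "m + 1"] *[of "m - 1"] assms by simp_all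
  qed
  have "invD m * invD (m + 1) * [2 * m + 2]\<^sub>q - invD (m - 1) * invD m * [2 * m - 2]\<^sub>q
      = invD m * (invD (m + 1) * [2 * m + 2]\<^sub>q - invD (m - 1) * [2 * m - 2]\<^sub>q)"
    by (simp add: algebra_simps)
  also have "\<dots> = 1"
    unfolding 1 br_step2 by (rule invD[OF assms])
  finally show ?thesis .
qed

lemma serre_32_43_up_center:
  assumes "in_M m"
  shows "b l m * (a (l+1) m + a (l+1) (m-1)) - [2]\<^sub>q * (a l m * b l (m+1) + b l (m-1) * a (l+1) (m-1))
      + (a l m + a l (m-1)) * b l m = b l m"  (is "?lhs = _")
proof -
  define S0 S1 S2 S' T0 T1 T2 T' E0 E' where "S0 = [l - m]\<^sub>q" "S1 = [l - m + 1]\<^sub>q"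
    "S2 = [l - m + 2]\<^sub>q" "S' = [l - m - 1]\<^sub>q" "T0 = [l + m]\<^sub>q" "T1 = [l + m + 1]\<^sub>q" "T2 = [l + m + 2]\<^sub>q"
    "T' = [l + m - 1]\<^sub>q" "E0 = invD m * invD (m + 1)" "E' = invD (m - 1) * invD m"
  note defs = this
  have e: "a l m = T1 * S0 * E0" "a (l+1) m = T2 * S1 * E0" "a (l+1) (m-1) = T1 * S2 * E'" "a l (m-1) = T0 * S1 * E'"
    "b l (m+1) = ff l * T2" "b l m = ff l * T1" "b l (m-1) = ff l * T0"
    unfolding a_eq b_eq defs by (simp_all add: algebra_simps)
  have S: "S1 = [2]\<^sub>q * S0 - S'" "T1 = [2]\<^sub>q * T0 - T'"
    unfolding defs by (rule br_next; simp)+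
  have 1: "T2 * S1 - [2]\<^sub>q * S0 * T2 + T1 * S0 = [2 * m + 2]\<^sub>q"
  proof -
    have "T2 * S1 - [2]\<^sub>q * S0 * T2 + T1 * S0 = T1 * S0 - T2 * S'"
      unfolding S(1) by (simp add: algebra_simps)
    also have "\<dots> = [2 * m + 2]\<^sub>q" unfolding defs by (rule br_shift_cross_at) simp_all
    finally show ?thesis .
  qed
  have 2: "T1 * S2 - [2]\<^sub>q * T0 * S2 + T0 * S1 = - [2 * m - 2]\<^sub>q"
  proof -
    have "T1 * S2 - [2]\<^sub>q * T0 * S2 + T0 * S1 = - (T' * S2 - T0 * S1)"
      unfolding S(2) by (simp add: algebra_simps)
    also have "T' * S2 - T0 * S1 = [2 * m - 2]\<^sub>q" unfolding defs by (rule br_shift_cross_at) simp_all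
    finally show ?thesis .
  qed
  have "?lhs = ff l * T1 * (E0 * (T2 * S1 - [2]\<^sub>q * S0 * T2 + T1 * S0) + E' * (T1 * S2 - [2]\<^sub>q * T0 * S2 + T0 * S1))"
    unfolding e by (simp add: algebra_simps)
  also have "\<dots> = ff l * T1 * (E0 * [2 * m + 2]\<^sub>q - E' * [2 * m - 2]\<^sub>q)"
    unfolding 1 2 by simp
  also have "E0 * [2 * m + 2]\<^sub>q - E' * [2 * m - 2]\<^sub>q = 1"
    unfolding defs by (rule invD_difference[OF assms])
  also have "ff l * T1 * 1 = b l m"
    unfolding e by simp
  finally show ?thesis .
qed

lemma serre_32_43_up_left2: "b l m - [2]\<^sub>q * b l (m-1) + b l (m-2) = 0"
proof -
  define T0 T1 T' where "T0 = [l + m]\<^sub>q" "T1 = [l + m + 1]\<^sub>q" "T' = [l + m - 1]\<^sub>q"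
  note defs = this
  have S: "T1 = [2]\<^sub>q * T0 - T'"
    unfolding defs by (rule br_next) simp_all
  have e: "b l m = ff l * T1" "b l (m - 1) = ff l * T0" "b l (m - 2) = ff l * T'"
    unfolding b_eq defs by (simp_all add: algebra_simps)
  show ?thesis unfolding e S by (simp add: algebra_simps)
qed

text \<open>
  The diagonal part only has to be proportional to \<open>[m]\<close> within a row. This generality covers
  the coefficient \<open>c\<close> of \<open>I43\<close> as well as the eigenvalue of \<open>I21\<close>.
\<close>

lemma serre_32_43_level_right2:
  assumes "\<And>l m. C l m = \<gamma> l * [m]\<^sub>q"
  shows "C l m * a l m * a l (m+1) - [2]\<^sub>q * (a l m * C l (m+1) * a l (m+1)) + a l m * a l (m+1) * C l (m+2) = 0"
proof -
  have S: "[m + 2]\<^sub>q = [2]\<^sub>q * [m + 1]\<^sub>q - [m]\<^sub>q"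
    by (rule br_next) simp_all
  show ?thesis unfolding assms S by (simp add: mult_ac ring_distribs)
qed

lemma serre_32_43_level_center:
  assumes "\<And>l m. C l m = \<gamma> l * [m]\<^sub>q" "in_M m"
  shows "C l m * (a l m + a l (m-1)) - [2]\<^sub>q * (a l m * C l (m+1) + C l (m-1) * a l (m-1))
      + (a l m + a l (m-1)) * C l m = C l m" (is "?lhs = _")
proof -
  have 1: "[2]\<^sub>q * [m + 1]\<^sub>q = [m]\<^sub>q * 2 + dd (m + 1)"
    using br_2[of "m + 1"] br_step2[of "m + 1"] by (simp add: algebra_simps)
  have 2: "[2]\<^sub>q * [m - 1]\<^sub>q = [m]\<^sub>q * 2 - dd (m - 1)"
    using br_2[of "m - 1"] br_step2[of "m - 1"] by (simp add: algebra_simps)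
  have 3: "a l m * dd (m + 1) = [l + m + 1]\<^sub>q * [l - m]\<^sub>q * invD m"
    using invD[of "m + 1"] assms(2) unfolding a_eq by (simp add: mult.assoc)
  have 4: "a l (m - 1) * dd (m - 1) = [l + m]\<^sub>q * [l - m + 1]\<^sub>q * invD m"
  proof -
    have "a l (m - 1) = [l + m]\<^sub>q * [l - m + 1]\<^sub>q * (invD m * invD (m - 1))"
      unfolding a_eq by (simp add: algebra_simps)
    then show ?thesis using invD[of "m - 1"] assms(2) by (simp add: mult.assoc)
  qed
  have 5: "[l + m]\<^sub>q * [l - m + 1]\<^sub>q - [l + m + 1]\<^sub>q * [l - m]\<^sub>q = [2 * m]\<^sub>q"
    by (rule br_shift_cross_at) simp_all
  have "?lhs = \<gamma> l * (a l m * (2 * [m]\<^sub>q - [2]\<^sub>q * [m + 1]\<^sub>q) + a l (m - 1) * (2 * [m]\<^sub>q - [2]\<^sub>q * [m - 1]\<^sub>q))"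
    unfolding assms(1) by (simp add: algebra_simps)
  also have "\<dots> = \<gamma> l * (a l (m - 1) * dd (m - 1) - a l m * dd (m + 1))"
    unfolding 1 2 by (simp add: algebra_simps)
  also have "\<dots> = \<gamma> l * ([l + m]\<^sub>q * [l - m + 1]\<^sub>q - [l + m + 1]\<^sub>q * [l - m]\<^sub>q) * invD m"
    unfolding 3 4 by (simp add: algebra_simps)
  also have "\<dots> = C l m"
    unfolding 5 br_double using invD[OF assms(2)] by (simp add: assms(1) mult_ac)
  finally show ?thesis .
qed

lemma serre_32_43_level_left2:
  assumes "\<And>l m. C l m = \<gamma> l * [m]\<^sub>q"
  shows "C l m - [2]\<^sub>q * C l (m-1) + C l (m-2) = 0"
proof -
  have S: "[m]\<^sub>q = [2]\<^sub>q * [m - 1]\<^sub>q - [m - 2]\<^sub>q"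
    by (rule br_next) simp_all
  show ?thesis unfolding assms S by (simp add: mult_ac ring_distribs)
qed

lemma serre_32_43_down_right2: "s l m * a (l-1) m * a (l-1) (m+1) - [2]\<^sub>q * (a l m * s l (m+1) * a (l-1) (m+1)) + a l m * a l (m+1) * s l (m+2) = 0"
proof -
  define S0 S1 S2 T0 T1 T2 E0 E1 where "S0 = [l - m]\<^sub>q" "S1 = [l - m - 1]\<^sub>q" "S2 = [l - m - 2]\<^sub>q"
    "T0 = [l + m]\<^sub>q" "T1 = [l + m + 1]\<^sub>q" "T2 = [l + m + 2]\<^sub>q"
    "E0 = invD m * invD (m + 1)" "E1 = invD (m + 1) * invD (m + 2)"
  note defs = this
  have S: "T2 = [2]\<^sub>q * T1 - T0"
    unfolding defs by (rule br_next) simp_all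
  have e: "a (l-1) m = T0 * S1 * E0" "a (l-1) (m+1) = T1 * S2 * E1" "a l m = T1 * S0 * E0" "a l (m+1) = T2 * S1 * E1"
    "s l m = S0" "s l (m+1) = S1" "s l (m+2) = S2"
    unfolding a_eq defs by (simp_all add: algebra_simps)
  show ?thesis unfolding e S by (simp add: algebra_simps)
qed

lemma serre_32_43_down_center:
  assumes "in_M m"
  shows "s l m * (a (l-1) m + a (l-1) (m-1)) - [2]\<^sub>q * (a l m * s l (m+1) + s l (m-1) * a (l-1) (m-1))
      + (a l m + a l (m-1)) * s l m = s l m" (is "?lhs = _")
proof -
  define S0 S1 S2 S' T0 T1 T2 T' E0 E' where "S0 = [l - m]\<^sub>q" "S1 = [l - m + 1]\<^sub>q"
    "S2 = [l - m + 2]\<^sub>q" "S' = [l - m - 1]\<^sub>q" "T0 = [l + m]\<^sub>q" "T1 = [l + m + 1]\<^sub>q" "T2 = [l + m + 2]\<^sub>q"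
    "T' = [l + m - 1]\<^sub>q" "E0 = invD m * invD (m + 1)" "E' = invD (m - 1) * invD m"
  note defs = this
  have e: "a l m = T1 * S0 * E0" "a (l-1) m = T0 * S' * E0" "a (l-1) (m-1) = T' * S0 * E'" "a l (m-1) = T0 * S1 * E'"
    "s l (m+1) = S'" "s l m = S0" "s l (m-1) = S1"
    unfolding a_eq defs by (simp_all add: algebra_simps)
  have S: "T2 = [2]\<^sub>q * T1 - T0" "S2 = [2]\<^sub>q * S1 - S0"
    unfolding defs by (rule br_next; simp)+
  have 1: "T0 * S' - [2]\<^sub>q * T1 * S' + T1 * S0 = [2 * m + 2]\<^sub>q"
  proof -
    have "T0 * S' - [2]\<^sub>q * T1 * S' + T1 * S0 = T1 * S0 - T2 * S'"
      unfolding S(1) by (simp add: algebra_simps)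
    also have "\<dots> = [2 * m + 2]\<^sub>q" unfolding defs by (rule br_shift_cross_at) simp_all
    finally show ?thesis .
  qed
  have 2: "T' * S0 - [2]\<^sub>q * S1 * T' + T0 * S1 = - [2 * m - 2]\<^sub>q"
  proof -
    have "T' * S0 - [2]\<^sub>q * S1 * T' + T0 * S1 = - (T' * S2 - T0 * S1)"
      unfolding S(2) by (simp add: algebra_simps)
    also have "T' * S2 - T0 * S1 = [2 * m - 2]\<^sub>q" unfolding defs by (rule br_shift_cross_at) simp_all
    finally show ?thesis .
  qed
  have "?lhs = S0 * (E0 * (T0 * S' - [2]\<^sub>q * T1 * S' + T1 * S0) + E' * (T' * S0 - [2]\<^sub>q * S1 * T' + T0 * S1))"
    unfolding e by (simp add: algebra_simps)
  also have "\<dots> = S0 * (E0 * [2 * m + 2]\<^sub>q - E' * [2 * m - 2]\<^sub>q)"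
    unfolding 1 2 by simp
  also have "E0 * [2 * m + 2]\<^sub>q - E' * [2 * m - 2]\<^sub>q = 1"
    unfolding defs by (rule invD_difference[OF assms])
  also have "S0 * 1 = s l m"
    unfolding e by simp
  finally show ?thesis .
qed

lemma serre_32_43_down_left2: "s l m - [2]\<^sub>q * s l (m-1) + s l (m-2) = 0"
proof -
  have S: "[l - m + 2]\<^sub>q = [2]\<^sub>q * [l - m + 1]\<^sub>q - [l - m]\<^sub>q"
    by (rule br_next) simp_all
  have e: "s l (m - 1) = [l - m + 1]\<^sub>q" "s l (m - 2) = [l - m + 2]\<^sub>q"
    by (simp_all add: algebra_simps)
  show ?thesis unfolding e S by simp
qed
end

section \<open>The relators act by zero\<close>

context so4_rep begin

definition V :: "vec set" where
  "V = carrier (Vrep h p r l0 m0)"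

lemma V_iff: "v \<in> V \<longleftrightarrow> (\<forall>l m. lookup v (l, m) \<noteq> 0 \<longrightarrow> in_L l \<and> in_M m)"
  unfolding V_def Vrep_def in_L_def in_M_def by (auto simp: in_keys_iff)

lemma V_off: "v \<in> V \<Longrightarrow> \<not> (in_L l \<and> in_M m) \<Longrightarrow> lookup v (l, m) = 0"
  unfolding V_iff by blast

abbreviation act :: "gen \<Rightarrow> vec \<Rightarrow> vec" where "act \<equiv> gen_act h p r"

definition lk :: "vec \<Rightarrow> complex \<Rightarrow> complex \<Rightarrow> complex" where "lk v l m = lookup v (l, m)"

lemma lk_act:
  "lk (act I32 v) = op32 a (lk v)"
  "lk (act I43 v) = op43 b s c (lk v)"
  "lk (act I21 v) = op43 (\<lambda>_ _. 0) (\<lambda>_ _. 0) (\<lambda>l m. \<i> * [m]\<^sub>q) (lk v)"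
  by (intro ext; simp add: lookup_gen_act_I21 lookup_gen_act_I32 lookup_gen_act_I43 op32_def op43_def lk_def mult.assoc)+

lemma lk_eqI: "(\<And>l m. lk v l m = lk w l m) \<Longrightarrow> v = w"
  unfolding lk_def by (rule poly_mapping_eqI) (metis surj_pair)

lemma commute_21_43: "act I21 (act I43 v) = act I43 (act I21 v)"
  by (rule lk_eqI) (simp add: lk_act op43_def algebra_simps)

lemma lk_ops: "lk (v + w) l m = lk v l m + lk w l m" "lk (v - w) l m = lk v l m - lk w l m"
  "lk (vscale x v) l m = x * lk v l m" "lk 0 l m = 0"
  by (simp_all add: lk_def lookup_add lookup_minus lookup_vscale)

text \<open>
  At a lattice point the coefficients are those computed above; at any other point all coordinates
  of \<open>v\<close> that enter are zero.
\<close>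

lemma serre_43_32:
  assumes "v \<in> V"
  shows "free_act h p r (serre h (gen I43) (gen I32)) v = 0"
proof (rule lk_eqI)
  fix l m
  let ?A32 = "op32 a" and ?A43 = "op43 b s c"
  have "lk (free_act h p r (serre h (gen I43) (gen I32)) v) l m
     = ?A43 (?A43 (?A32 (lk v))) l m - [2]\<^sub>q * ?A43 (?A32 (?A43 (lk v))) l m + ?A32 (?A43 (?A43 (lk v))) l m + ?A32 (lk v) l m"
    unfolding free_act_serre lk_ops lk_act ..
  also have "\<dots> = 0"
  proof (cases "in_L l \<and> in_M m")
    case True
    then have L: "in_L l" "in_L (l - 1)" "in_L (l + 1)" by simp_all
    show ?thesis
      unfolding serre_expand_43_32
      unfolding serre_43_32_up2_right[of "l-2" "m-1"] serre_43_32_up2_left[of "l-2" "m+1"] serre_43_32_up1_right[OF L(2), of "m-1"] serre_43_32_up1_left[OF L(2), of "m+1"]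
        serre_43_32_level_right[OF L(1), of "m-1"] serre_43_32_level_left[OF L(1), of "m+1"] serre_43_32_down1_right[OF L(3), of "m-1"] serre_43_32_down1_left[OF L(3), of "m+1"]
        serre_43_32_down2_right[of "l+2" "m-1"] serre_43_32_down2_left[of "l+2" "m+1"]
      unfolding op32_def
      by simp
  next
    case False
    then have "in_L l \<Longrightarrow> \<not> in_M m" by blast
    with assms show ?thesis unfolding serre_expand_43_32 unfolding op32_def by (simp add: lk_def V_off)
  qed
  finally show "lk (free_act h p r (serre h (gen I43) (gen I32)) v) l m = lk 0 l m" by (simp add: lk_ops)
qed

lemma serre_32_43:
  assumes "v \<in> V"
  shows "free_act h p r (serre h (gen I32) (gen I43)) v = 0"
proof (rule lk_eqI)
  fix l m
  let ?A32 = "op32 a" and ?A43 = "op43 b s c"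
  have "lk (free_act h p r (serre h (gen I32) (gen I43)) v) l m
     = ?A32 (?A32 (?A43 (lk v))) l m - [2]\<^sub>q * ?A32 (?A43 (?A32 (lk v))) l m + ?A43 (?A32 (?A32 (lk v))) l m + ?A43 (lk v) l m"
    unfolding free_act_serre lk_ops lk_act ..
  also have "\<dots> = 0"
  proof (cases "in_L l \<and> in_M m")
    case True
    have c': "c l m = gg * (invl l * invl (l + 1)) * [m]\<^sub>q" for l m
      unfolding c_eq by simp
    from True have M: "in_M m" by simp
    show ?thesis
      unfolding serre_expand_32_43
      unfolding serre_32_43_up_right2[of "l-1" "m-2"] serre_32_43_up_center[OF M, of "l-1"] serre_32_43_up_left2[of "l-1" "m+2"]
        serre_32_43_level_right2[of c, OF c', of l "m-2"] serre_32_43_level_center[of c, OF c' M, of l] serre_32_43_level_left2[of c, OF c', of l "m+2"]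
        serre_32_43_down_right2[of "l+1" "m-2"] serre_32_43_down_center[OF M, of "l+1"] serre_32_43_down_left2[of "l+1" "m+2"]
      unfolding op43_def
      by simp
  next
    case False
    then have "in_L l \<Longrightarrow> \<not> in_M m" by blast
    with assms show ?thesis unfolding serre_expand_32_43 unfolding op43_def by (simp add: lk_def V_off)
  qed
  finally show "lk (free_act h p r (serre h (gen I32) (gen I43)) v) l m = lk 0 l m" by (simp add: lk_ops)
qed

text \<open>
  The relation between \<open>I32\<close> and \<open>I21\<close> is the diagonal part of the relation between \<open>I32\<close> and \<open>I43\<close>.
\<close>

lemma serre_32_21:
  assumes "v \<in> V"
  shows "free_act h p r (serre h (gen I32) (gen I21)) v = 0"
proof (rule lk_eqI)
  fix l m
  let ?A32 = "op32 a" and ?C = "\<lambda>l m. \<i> * [m]\<^sub>q"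
  let ?A21 = "op43 (\<lambda>_ _. 0) (\<lambda>_ _. 0) ?C"
  have "lk (free_act h p r (serre h (gen I32) (gen I21)) v) l m
     = ?A32 (?A32 (?A21 (lk v))) l m - [2]\<^sub>q * ?A32 (?A21 (?A32 (lk v))) l m + ?A21 (?A32 (?A32 (lk v))) l m + ?A21 (lk v) l m"
    unfolding free_act_serre lk_ops lk_act ..
  also have "\<dots> = 0"
  proof (cases "in_L l \<and> in_M m")
    case True
    from True have M: "in_M m" by simp
    show ?thesis
      unfolding serre_expand_32_43
      unfolding serre_32_43_level_right2[where C = ?C and \<gamma> = "\<lambda>_. \<i>" and l = l and m = "m - 2", OF refl]
        serre_32_43_level_center[where C = ?C and \<gamma> = "\<lambda>_. \<i>" and l = l, OF refl M]
        serre_32_43_level_left2[where C = ?C and \<gamma> = "\<lambda>_. \<i>" and l = l and m = "m + 2", OF refl]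
      unfolding op43_def by simp
  next
    case False
    then have "in_L l \<Longrightarrow> \<not> in_M m" by blast
    with assms show ?thesis unfolding serre_expand_32_43 unfolding op43_def by (simp add: lk_def V_off)
  qed
  finally show "lk (free_act h p r (serre h (gen I32) (gen I21)) v) l m = lk 0 l m" by (simp add: lk_ops)
qed

lemma serre_21_32: "free_act h p r (serre h (gen I21) (gen I32)) v = 0"
proof (rule lk_eqI)
  fix l m
  let ?A32 = "op32 a" and ?C = "\<lambda>l m. \<i> * [m]\<^sub>q"
  let ?A21 = "op43 (\<lambda>_ _. 0) (\<lambda>_ _. 0) ?C"
  have C: "(?C l m)\<^sup>2 - [2]\<^sub>q * (?C l m * ?C l (m - 1)) + (?C l (m - 1))\<^sup>2 = - 1" for l m :: complex
  proof -
    have "(?C l m)\<^sup>2 - [2]\<^sub>q * (?C l m * ?C l (m - 1)) + (?C l (m - 1))\<^sup>2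
       = - ([m - 1]\<^sub>q\<^sup>2 + [m - 1 + 1]\<^sub>q\<^sup>2 - [2]\<^sub>q * [m - 1]\<^sub>q * [m - 1 + 1]\<^sub>q)"
      by (simp add: power_mult_distrib algebra_simps)
    then show ?thesis unfolding br_consecutive .
  qed
  have "lk (free_act h p r (serre h (gen I21) (gen I32)) v) l m
     = ?A21 (?A21 (?A32 (lk v))) l m - [2]\<^sub>q * ?A21 (?A32 (?A21 (lk v))) l m + ?A32 (?A21 (?A21 (lk v))) l m + ?A32 (lk v) l m"
    unfolding free_act_serre lk_ops lk_act ..
  also have "\<dots> = ((?C l m)\<^sup>2 - [2]\<^sub>q * (?C l m * ?C l (m - 1)) + (?C l (m - 1))\<^sup>2 + 1) * a l (m - 1) * lk v l (m - 1)
     - ((?C l (m + 1))\<^sup>2 - [2]\<^sub>q * (?C l (m + 1) * ?C l (m + 1 - 1)) + (?C l (m + 1 - 1))\<^sup>2 + 1) * lk v l (m + 1)"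
    unfolding op32_def op43_def by (simp add: algebra_simps power2_eq_square)
  also have "\<dots> = 0"
    unfolding C by simp
  finally show "lk (free_act h p r (serre h (gen I21) (gen I32)) v) l m = lk 0 l m" by (simp add: lk_ops)
qed

lemma relators_annihilate:
  assumes "v \<in> V" "f \<in> so4_relators h"
  shows "free_act h p r f v = 0"
  using assms(2) serre_32_21[OF assms(1)] serre_21_32 serre_43_32[OF assms(1)] serre_32_43[OF assms(1)]
  unfolding so4_relators_def
  by (auto simp: free_act_diff free_act_mult free_act_gen commute_21_43)

lemma V_zero: "0 \<in> V" by (simp add: V_iff)
lemma V_add: "v \<in> V \<Longrightarrow> w \<in> V \<Longrightarrow> v + w \<in> V"
  unfolding V_iff by (auto simp: lookup_add) (metis add.right_neutral)+
lemma V_vscale: "v \<in> V \<Longrightarrow> vscale x v \<in> V"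
  unfolding V_iff by (auto simp: lookup_vscale)

lemma V_act:
  assumes "v \<in> V" shows "act g v \<in> V"
proof -
  have "lookup (act g v) (l, m) = 0" if "in_L l \<Longrightarrow> \<not> in_M m" for l m
    using that V_off[OF assms]
    by (cases g) (simp_all add: lookup_gen_act_I21 lookup_gen_act_I32 lookup_gen_act_I43)
  then show ?thesis unfolding V_iff by blast
qed

lemma V_word_act: "v \<in> V \<Longrightarrow> word_act h p r w v \<in> V"
proof (cases w)
  case (Word gs)
  then show "v \<in> V \<Longrightarrow> ?thesis" by (induction gs arbitrary: w) (simp_all add: V_act)
qed

lemma V_free_act: "v \<in> V \<Longrightarrow> free_act h p r f v \<in> V"
  by (induction f rule: poly_mapping_add_induct)
    (simp_all add: free_act_single free_act_add V_word_act V_vscale V_add)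

end

section \<open>The quotient algebra acts\<close>

lemma ring_free_alg: "ring (ring_of_type_algebra :: free_alg ring)"
proof -
  have "\<exists>y. x + y = 0" for x :: free_alg
    using add.right_inverse by blast
  then show ?thesis
    unfolding ring_of_type_algebra_def using add.right_inverse
    by unfold_locales (auto simp: algebra_simps Units_def)
qed

context so4_rep begin

abbreviation FA :: "free_alg ring" where "FA \<equiv> ring_of_type_algebra"
abbreviation U :: "free_alg set ring" where "U \<equiv> Uq_tw_so4 h"
abbreviation VV :: "(free_alg set, vec) module" where "VV \<equiv> Vrep h p r l0 m0"

definition rel_ideal :: "free_alg set" where "rel_ideal = genideal FA (so4_relators h)"

lemma FA_simps: "carrier FA = UNIV" "x \<otimes>\<^bsub>FA\<^esub> y = x * y" "x \<oplus>\<^bsub>FA\<^esub> y = x + y" "\<one>\<^bsub>FA\<^esub> = 1" "\<zero>\<^bsub>FA\<^esub> = 0"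
  by (simp_all add: ring_of_type_algebra_def)

text \<open>
  The elements of the free algebra that annihilate the representation form a two-sided ideal. It
  contains the relators, hence the ideal that they generate, so the quotient algebra acts.
\<close>

lemma annihilator_ideal: "ideal {f. \<forall>v\<in>V. free_act h p r f v = 0} FA"
proof (rule idealI[OF ring_free_alg])
  interpret FA: ring FA by (rule ring_free_alg)
  show "subgroup {f. \<forall>v\<in>V. free_act h p r f v = 0} (add_monoid FA)"
  proof (rule FA.add.subgroupI)
    fix f assume f: "f \<in> {f. \<forall>v\<in>V. free_act h p r f v = 0}"
    have "\<ominus>\<^bsub>FA\<^esub> f = - f"
      by (rule FA.minus_equality) (simp_all add: FA_simps)
    then show "\<ominus>\<^bsub>FA\<^esub> f \<in> {f. \<forall>v\<in>V. free_act h p r f v = 0}"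
      using f by (simp add: free_act_minus)
  next
    have "free_act h p r 0 v = 0" for v by (simp add: free_act_def)
    then show "{f. \<forall>v\<in>V. free_act h p r f v = 0} \<noteq> {}" by blast
  qed (auto simp: FA_simps free_act_add)
qed (auto simp: FA_simps free_act_mult free_act_vzero V_free_act)

lemma rel_ideal: "ideal rel_ideal FA"
  unfolding rel_ideal_def by (rule ring.genideal_ideal[OF ring_free_alg]) (simp add: FA_simps)

lemma rel_ideal_annihilates:
  assumes "f \<in> rel_ideal" "v \<in> V" shows "free_act h p r f v = 0"
proof -
  have "rel_ideal \<subseteq> {f. \<forall>v\<in>V. free_act h p r f v = 0}"
    unfolding rel_ideal_def
    by (rule ring.genideal_minimal[OF ring_free_alg annihilator_ideal]) (use relators_annihilate in blast)
  with assms show ?thesis by blast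
qed

definition cls :: "free_alg \<Rightarrow> free_alg set" where "cls f = rel_ideal +>\<^bsub>FA\<^esub> f"

lemma U_eq: "U = FA Quot rel_ideal"
  by (simp add: Uq_tw_so4_def rel_ideal_def)

lemma U_ring: "ring U"
  unfolding U_eq by (rule ideal.quotient_is_ring[OF rel_ideal])

lemma U_carrier: "carrier U = range cls"
  by (auto simp: U_eq FactRing_def A_RCOSETS_def' cls_def FA_simps)

lemma U_ops: "cls f \<otimes>\<^bsub>U\<^esub> cls g = cls (f * g)" "cls f \<oplus>\<^bsub>U\<^esub> cls g = cls (f + g)" "\<one>\<^bsub>U\<^esub> = cls 1"
proof -
  interpret ideal rel_ideal FA by (rule rel_ideal)
  show "cls f \<otimes>\<^bsub>U\<^esub> cls g = cls (f * g)"
    using rcoset_mult_add[of f g] by (simp add: U_eq FactRing_def cls_def FA_simps)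
  show "cls f \<oplus>\<^bsub>U\<^esub> cls g = cls (f + g)"
    using a_rcos_sum[of f g] by (simp add: U_eq FactRing_def cls_def FA_simps)
  show "\<one>\<^bsub>U\<^esub> = cls 1"
    by (simp add: U_eq FactRing_def cls_def FA_simps)
qed

lemma VV_simps: "carrier VV = V" "\<zero>\<^bsub>VV\<^esub> = 0" "v \<oplus>\<^bsub>VV\<^esub> w = v + w"
  by (simp_all add: V_def Vrep_def)

text \<open>
  All representatives of a class act in the same way, so the singleton whose element is taken in the
  definition of the action is indeed a singleton.
\<close>

lemma VV_smult:
  assumes "v \<in> V" shows "cls f \<odot>\<^bsub>VV\<^esub> v = free_act h p r f v"
proof -
  interpret ideal rel_ideal FA by (rule rel_ideal)
  have "(\<lambda>f. free_act h p r f v) ` cls f = {free_act h p r f v}"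
  proof -
    have "f \<in> cls f" unfolding cls_def by (rule a_rcos_self) (simp add: FA_simps)
    moreover have "free_act h p r g v = free_act h p r f v" if "g \<in> cls f" for g
      using that rel_ideal_annihilates[OF _ assms]
      by (auto simp: cls_def a_r_coset_def' FA_simps free_act_add)
    ultimately show ?thesis by blast
  qed
  then show ?thesis by (simp add: Vrep_def)
qed

lemma VV_left_module: "left_module U VV"
proof -
  have "abelian_group VV"
  proof (rule abelian_groupI)
    show "\<exists>w\<in>carrier VV. w \<oplus>\<^bsub>VV\<^esub> v = \<zero>\<^bsub>VV\<^esub>" if "v \<in> carrier VV" for v
    proof (rule bexI[of _ "vscale (- 1) v"])
      have "vscale (- 1) v + vscale 1 v = 0"
        unfolding vscale_add_left[symmetric] by simp
      then show "vscale (- 1) v \<oplus>\<^bsub>VV\<^esub> v = \<zero>\<^bsub>VV\<^esub>" by (simp add: VV_simps)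
      show "vscale (- 1) v \<in> carrier VV" using that by (simp add: VV_simps V_vscale)
    qed
  qed (simp_all add: VV_simps V_add V_zero add_ac)
  then show ?thesis
    by (intro left_module.intro left_module_axioms.intro U_ring)
      (auto simp: U_carrier U_ops VV_simps VV_smult V_free_act V_add free_act_add free_act_vadd free_act_mult free_act_one)
qed

text \<open>
  The classes of the scalars and of the generators already generate the algebra, so submodules are the
  subspaces that are stable under the three generators.
\<close>

lemma submodule_VVD:
  assumes "submodule N U VV"
  shows "N \<subseteq> V" "0 \<in> N" "v \<in> N \<Longrightarrow> w \<in> N \<Longrightarrow> v + w \<in> N" "v \<in> N \<Longrightarrow> vscale x v \<in> N" "v \<in> N \<Longrightarrow> act g v \<in> N"
proof -
  note N = submoduleD[OF assms, unfolded VV_simps]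
  show "N \<subseteq> V" "0 \<in> N" "v \<in> N \<Longrightarrow> w \<in> N \<Longrightarrow> v + w \<in> N" by (fact N)+
  have *: "free_act h p r f v \<in> N" if "v \<in> N" for f v
    using N(5)[of "cls f" v] that N(1) by (auto simp: U_carrier VV_smult)
  show "v \<in> N \<Longrightarrow> vscale x v \<in> N" "v \<in> N \<Longrightarrow> act g v \<in> N"
    using *[of v "scal x"] *[of v "gen g"] by (simp_all add: free_act_scal free_act_gen)
qed

lemma submodule_VVI:
  assumes "N \<subseteq> V" "0 \<in> N" "\<And>v w. v \<in> N \<Longrightarrow> w \<in> N \<Longrightarrow> v + w \<in> N" "\<And>v x. v \<in> N \<Longrightarrow> vscale x v \<in> N"
    "\<And>v g. v \<in> N \<Longrightarrow> act g v \<in> N"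
  shows "submodule N U VV"
proof (rule submodule_left_moduleI[OF VV_left_module])
  have word: "word_act h p r w v \<in> N" if "v \<in> N" for w v
  proof (cases w)
    case (Word gs)
    then show ?thesis using that by (induction gs arbitrary: w) (simp_all add: assms(5))
  qed
  have "free_act h p r f v \<in> N" if "v \<in> N" for f v
    using that by (induction f rule: poly_mapping_add_induct)
      (simp_all add: free_act_single free_act_add word assms(3,4))
  then show "u \<odot>\<^bsub>VV\<^esub> v \<in> N" if "u \<in> carrier U" "v \<in> N" for u v
    using that assms(1) by (auto simp: U_carrier VV_smult)
qed (use assms in \<open>simp_all add: VV_simps\<close>)

end

section \<open>Submodules are spanned by basis vectors\<close>

text \<open>
  Multiplying \<open>D - x\<close> over all eigenvalues \<open>x \<noteq> e\<close> that occur in \<open>v\<close> kills all eigencomponents except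
  the one for \<open>e\<close>, which is multiplied by a nonzero scalar. The diagonal operator \<open>D\<close> only needs to
  be available on \<open>N\<close>.
\<close>

lemma eigenprojection:
  fixes N :: "vec set"
  assumes add: "\<And>v w. v \<in> N \<Longrightarrow> w \<in> N \<Longrightarrow> v + w \<in> N"
    and scale: "\<And>v x. v \<in> N \<Longrightarrow> vscale x v \<in> N"
    and diag: "\<And>v. v \<in> N \<Longrightarrow> \<exists>w\<in>N. \<forall>k. lookup w k = d k * lookup v k"
    and v: "v \<in> N"
  shows "\<exists>w\<in>N. \<forall>k. lookup w k = (if d k = e then lookup v k else 0)"
proof -
  have poly: "\<exists>w\<in>N. \<forall>k. lookup w k = (\<Prod>x\<in>E. d k - x) * lookup v k" if "finite E" for E
    using that
  proof (induction E rule: finite_induct)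
    case empty
    then show ?case using v by auto
  next
    case (insert x E)
    then obtain w where w: "w \<in> N" "\<And>k. lookup w k = (\<Prod>x\<in>E. d k - x) * lookup v k" by blast
    from diag[OF w(1)] obtain w' where w': "w' \<in> N" "\<And>k. lookup w' k = d k * lookup w k" by blast
    have "lookup (w' + vscale (- x) w) k = (\<Prod>x\<in>insert x E. d k - x) * lookup v k" for k
      using insert(1,2) by (simp add: lookup_add lookup_vscale w w' algebra_simps)
    then show ?case using add[OF w'(1) scale[OF w(1)]] by blast
  qed
  let ?E = "d ` keys v - {e}"
  obtain w where w: "w \<in> N" "\<And>k. lookup w k = (\<Prod>x\<in>?E. d k - x) * lookup v k"
    using poly[of ?E] by auto
  define c where "c = (\<Prod>x\<in>?E. e - x)"
  have "c \<noteq> 0" by (auto simp: c_def)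
  have "lookup (vscale (inverse c) w) k = (if d k = e then lookup v k else 0)" for k
  proof (cases "d k = e")
    case True
    then show ?thesis using \<open>c \<noteq> 0\<close> by (simp add: lookup_vscale w c_def)
  next
    case False
    have "(\<Prod>x\<in>?E. d k - x) = 0" if "k \<in> keys v"
      using False that by (intro prod_zero) auto
    then show ?thesis using False by (cases "k \<in> keys v") (auto simp: lookup_vscale w in_keys_iff)
  qed
  then show ?thesis using scale[OF w(1)] by blast
qed

context so4_rep begin

lemma qpow_int_eq_1: "x - y \<in> \<int> \<Longrightarrow> qpow h x = qpow h y \<Longrightarrow> x = y"
proof -
  assume "x - y \<in> \<int>" and e: "qpow h x = qpow h y"
  then obtain n :: int where n: "x - y = of_int n" by (auto elim: Ints_cases)
  have "x = y + of_int n" using n by (simp add: algebra_simps)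
  then have "qpow h y * qpow h (of_int n) = qpow h y * 1"
    using e by (simp add: qpow_add)
  then have "qpow h (of_int n) = 1" using qpow_nonzero mult_cancel_left by blast
  then have "n = 0" using not_root_of_unity by blast
  then show "x = y" using n by simp
qed

text \<open>
  If \<open>A - 1/A = B - 1/B\<close> then \<open>A = B\<close> or \<open>A B = - 1\<close>; for \<open>A = q\<^sup>m\<close> and \<open>B = q\<^sup>m\<^sup>'\<close> the second case is
  excluded by the hypothesis on \<open>m0\<close>.
\<close>

lemma weight_inj:
  assumes "in_M m" "in_M m'" "[m]\<^sub>q = [m']\<^sub>q"
  shows "m = m'"
proof -
  obtain j j' where j: "m = m0 + of_int j" "m' = m0 + of_int j'"
    using assms(1,2) by (metis in_M_E)
  define A A' B B' where "A = qpow h m" "A' = qpow h (- m)" "B = qpow h m'" "B' = qpow h (- m')"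
  note defs = this
  have u: "A * A' = 1" "B * B' = 1"
    by (simp_all add: defs qpow_mult_minus)
  have e: "A - A' = B - B'"
    using assms(3) br_times_qq[of m] br_times_qq[of m'] by (simp add: defs)
  have "(A - B) * (A * B + 1)
      = A * B * ((A - A') - (B - B')) + B * (A * A' - 1) - A * (B * B' - 1)"
    by (simp add: algebra_simps)
  then have "(A - B) * (A * B + 1) = 0"
    unfolding u e by simp
  moreover have "A * B \<noteq> - 1"
  proof -
    have "A * B = qpow h (2 * m0 + of_int (j + j'))"
      unfolding defs j qpow_add[symmetric] by (simp add: algebra_simps)
    then show ?thesis using m_generic by metis
  qed
  ultimately have "A = B" by (simp add: eq_neg_iff_add_eq_0)
  moreover have "m - m' \<in> \<int>" by (simp add: j flip: of_int_diff)
  ultimately show ?thesis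
    unfolding defs by (metis qpow_int_eq_1)
qed

text \<open>
  Up to factors and summands that depend only on \<open>m\<close>, the coefficient \<open>a\<close> is \<open>A + 1/A\<close> with
  \<open>A = q\<^sup>2\<^sup>l\<^sup>+\<^sup>1\<close>, the Casimir eigenvalue of the row for the subalgebra generated by \<open>I21\<close> and \<open>I32\<close>. If
  \<open>A + 1/A = B + 1/B\<close> then \<open>A = B\<close> or \<open>A B = 1\<close>, and the hypothesis on \<open>4 l0\<close> excludes the latter.
\<close>

lemma casimir_inj:
  assumes "in_L l" "in_L l'" "in_M m" "a l m = a l' m"
  shows "l = l'"
proof -
  obtain j j' where j: "l = l0 + of_int j" "l' = l0 + of_int j'"
    using assms(1,2) by (metis in_L_E)
  have "invD m \<noteq> 0" "invD (m + 1) \<noteq> 0"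
    using invD[of m] invD[of "m + 1"] assms(3) by auto
  then have ll: "[l + m + 1]\<^sub>q * [l - m]\<^sub>q = [l' + m + 1]\<^sub>q * [l' - m]\<^sub>q"
    using assms(4) unfolding a_eq by simp
  define f where "f l = qpow h (2 * l + 1) + qpow h (- (2 * l + 1))" for l
  have "[l + m + 1]\<^sub>q * [l - m]\<^sub>q * qq * qq = f l - f m" for l
  proof -
    have "[l + m + 1]\<^sub>q * [l - m]\<^sub>q * qq * qq = ([l + m + 1]\<^sub>q * qq) * ([l - m]\<^sub>q * qq)"
      by (simp add: mult_ac)
    also have "\<dots> = (qpow h (l + m + 1) - qpow h (- (l + m + 1))) * (qpow h (l - m) - qpow h (- (l - m)))"
      unfolding br_times_qq ..
    also have "\<dots> = f l - f m"
      unfolding left_diff_distrib right_diff_distrib qpow_add[symmetric] f_def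
      by (simp add: algebra_simps)
    finally show ?thesis .
  qed
  from this[of l] this[of l'] have "f l = f l'" unfolding ll by simp
  define A A' B B' where "A = qpow h (2 * l + 1)" "A' = qpow h (- (2 * l + 1))"
    "B = qpow h (2 * l' + 1)" "B' = qpow h (- (2 * l' + 1))"
  note defs = this
  have u: "A * A' = 1" "B * B' = 1"
    unfolding defs by (rule qpow_mult_minus)+
  have e: "A + A' = B + B'"
    using \<open>f l = f l'\<close> unfolding f_def defs .
  have "(A - B) * (A * B - 1)
      = A * B * ((A + A') - (B + B')) - B * (A * A' - 1) + A * (B * B' - 1)"
    by (simp add: algebra_simps)
  then have "(A - B) * (A * B - 1) = 0"
    unfolding u e by simp
  moreover have "A * B \<noteq> 1"
  proof -
    have "A * B = qpow h (4 * l0 + 2 * of_int (j + j' + 1))"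
      unfolding defs j qpow_add[symmetric] by (simp add: algebra_simps)
    then show ?thesis using l_generic2 by metis
  qed
  ultimately have "A = B" by simp
  moreover have "2 * l + 1 - (2 * l' + 1) = of_int (2 * (j - j'))" by (simp add: j algebra_simps)
  then have "2 * l + 1 - (2 * l' + 1) \<in> \<int>" by (metis Ints_of_int)
  ultimately have "2 * l + 1 = 2 * l' + 1"
    unfolding defs by (metis qpow_int_eq_1)
  then show ?thesis by simp
qed

lemma submodule_column:
  assumes N: "submodule N U VV" and v: "v \<in> N" and m: "in_M m"
  shows "\<exists>w\<in>N. \<forall>l m'. lookup w (l, m') = (if m' = m then lookup v (l, m') else 0)"
proof -
  note N = submodule_VVD[OF N]
  let ?d = "\<lambda>(l :: complex, m). \<i> * [m]\<^sub>q"
  have "\<exists>w\<in>N. \<forall>k. lookup w k = (if ?d k = \<i> * [m]\<^sub>q then lookup v k else 0)"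
  proof (rule eigenprojection[OF N(3,4) _ v])
    show "\<exists>w\<in>N. \<forall>k. lookup w k = ?d k * lookup v k" if "v \<in> N" for v
      using N(5)[OF that, of I21] by (intro bexI[of _ "act I21 v"]) (auto simp: lookup_gen_act_I21)
  qed
  then obtain w where w: "w \<in> N" "\<And>k. lookup w k = (if ?d k = \<i> * [m]\<^sub>q then lookup v k else 0)"
    by blast
  \<comment> \<open>Off the lattice the eigenvalue may be \<open>\<i>[m]\<close> as well, but there \<open>v\<close> has no coordinates.\<close>
  have "lookup w (l, m') = (if m' = m then lookup v (l, m') else 0)" for l m'
  proof (cases "in_M m'")
    case True
    then show ?thesis using weight_inj[OF True m] by (auto simp: w(2))
  next
    case False
    then have "lookup v (l, m') = 0" using V_off[of v l m'] v N(1) by blast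
    then show ?thesis by (simp add: w(2))
  qed
  with w(1) show ?thesis by blast
qed

text \<open>
  First restrict \<open>v\<close> to its column \<open>m\<close>. On vectors of this column, applying \<open>I32\<close>, keeping the part in
  column \<open>m + 1\<close>, applying \<open>I32\<close> again and keeping the part in column \<open>m\<close> is the diagonal operator with
  entries \<open>- a\<close>, which separates the rows.
\<close>

lemma submodule_basis_vector:
  assumes Nsub: "submodule N U VV" and v: "v \<in> N" and nz: "lookup v (l, m) \<noteq> 0"
  shows "Poly_Mapping.single (l, m) 1 \<in> N"
proof -
  note N = submodule_VVD[OF Nsub]
  have lm: "in_L l" "in_M m" using V_off[of v l m] nz v N(1) by blast+
  define Nm where "Nm = {v \<in> N. \<forall>l m'. m' \<noteq> m \<longrightarrow> lookup v (l, m') = 0}"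
  let ?d = "\<lambda>(l, m' :: complex). - a l m"
  obtain v1 where v1: "v1 \<in> N" "\<And>l m'. lookup v1 (l, m') = (if m' = m then lookup v (l, m') else 0)"
    using submodule_column[OF Nsub v lm(2)] by blast
  have "\<exists>w\<in>Nm. \<forall>k. lookup w k = (if ?d k = - a l m then lookup v1 k else 0)"
  proof (rule eigenprojection)
    show "v1 \<in> Nm" using v1 by (simp add: Nm_def)
    show "v + w \<in> Nm" if "v \<in> Nm" "w \<in> Nm" for v w
      using that N(3) by (simp add: Nm_def lookup_add)
    show "vscale x v \<in> Nm" if "v \<in> Nm" for v x
      using that N(4) by (simp add: Nm_def lookup_vscale)
    show "\<exists>w\<in>Nm. \<forall>k. lookup w k = ?d k * lookup v k" if "v \<in> Nm" for v
    proof -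
      have vN: "v \<in> N" and col: "\<And>l m'. m' \<noteq> m \<Longrightarrow> lookup v (l, m') = 0"
        using that by (simp_all add: Nm_def)
      obtain w where w: "w \<in> N"
        "\<And>l m'. lookup w (l, m') = (if m' = m + 1 then lookup (act I32 v) (l, m') else 0)"
        using submodule_column[OF Nsub N(5)[OF vN, of I32], of "m + 1"] lm(2) by auto
      obtain u where u: "u \<in> N"
        "\<And>l m'. lookup u (l, m') = (if m' = m then lookup (act I32 w) (l, m') else 0)"
        using submodule_column[OF Nsub N(5)[OF w(1), of I32] lm(2)] by blast
      have "lookup u (l, m') = - a l m * lookup v (l, m')" for l m'
        using col by (simp add: u w lookup_gen_act_I32)
      with u show ?thesis by (intro bexI[of _ u]) (auto simp: Nm_def)
    qed
  qed
  then obtain w where w: "w \<in> N" "\<And>k. lookup w k = (if ?d k = - a l m then lookup v1 k else 0)"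
    by (auto simp: Nm_def)
  have "lookup w (l', m') = (if (l', m') = (l, m) then lookup v (l, m) else 0)" for l' m'
  proof (cases "lookup v (l', m') = 0")
    case True
    then show ?thesis by (auto simp: w v1)
  next
    case False
    then have "in_L l'" using V_off[of v l' m'] v N(1) by blast
    then show ?thesis using casimir_inj[OF _ lm(1) lm(2), of l'] by (auto simp: w v1)
  qed
  then have "vscale (inverse (lookup v (l, m))) w = Poly_Mapping.single (l, m) 1"
    using nz by (intro poly_mapping_eqI) (auto simp: lookup_vscale lookup_single when_def split: if_splits)
  then show ?thesis using N(4)[OF w(1)] by metis
qed

definition pt :: "int \<times> int \<Rightarrow> complex \<times> complex" where
  "pt = (\<lambda>(i, j). (l0 + of_int i, m0 + of_int j))"

lemma pt_simp [simp]: "pt (i, j) = (l0 + of_int i, m0 + of_int j)"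
  by (simp add: pt_def)

lemma inj_pt: "pt x = pt y \<longleftrightarrow> x = y"
  by (cases x; cases y) simp

lemma V_iff_pt: "v \<in> V \<longleftrightarrow> (\<forall>k. lookup v k \<noteq> 0 \<longrightarrow> k \<in> range pt)"
proof -
  have "(l, m) \<in> range pt \<longleftrightarrow> in_L l \<and> in_M m" for l m
  proof
    show "(l, m) \<in> range pt \<Longrightarrow> in_L l \<and> in_M m"
      by (auto simp: in_L_def in_M_def)
    show "(l, m) \<in> range pt" if lm: "in_L l \<and> in_M m"
    proof -
      obtain i j where "l = l0 + of_int i" "m = m0 + of_int j"
        using lm in_L_E[of l] in_M_E[of m] by metis
      then have "(l, m) = pt (i, j)" by simp
      then show ?thesis by blast
    qed
  qed
  then show ?thesis unfolding V_iff by (metis surj_pair)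
qed

definition coord_span :: "(int \<times> int) set \<Rightarrow> vec set" where
  "coord_span S = {v. \<forall>k. lookup v k \<noteq> 0 \<longrightarrow> k \<in> pt ` S}"

lemma coord_span_UNIV: "coord_span UNIV = V"
  unfolding coord_span_def V_iff_pt[abs_def] by (auto simp: V_iff_pt)

lemma coord_span_empty: "coord_span {} = {0}"
  by (auto simp: coord_span_def intro: poly_mapping_eqI)

lemma single_in_coord_span: "Poly_Mapping.single (pt x) 1 \<in> coord_span S \<longleftrightarrow> x \<in> S"
proof -
  have "Poly_Mapping.single (pt x) 1 \<in> coord_span S \<longleftrightarrow> pt x \<in> pt ` S"
    unfolding coord_span_def mem_Collect_eq lookup_single when_def by (metis one_neq_zero)
  then show ?thesis by (simp add: image_iff inj_pt)
qed

lemma coord_span_subset_iff: "coord_span S \<subseteq> coord_span Y \<longleftrightarrow> S \<subseteq> Y"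
proof
  show "coord_span S \<subseteq> coord_span Y \<Longrightarrow> S \<subseteq> Y" using single_in_coord_span by blast
  show "S \<subseteq> Y \<Longrightarrow> coord_span S \<subseteq> coord_span Y" unfolding coord_span_def by blast
qed

text \<open>
  The four conditions are the four moves of \<open>I32\<close> and \<open>I43\<close>; the move to the left has coefficient
  \<open>- 1\<close> and is always possible.
\<close>

definition act_closed :: "(int \<times> int) set \<Rightarrow> bool" where
  "act_closed S \<longleftrightarrow> (\<forall>i j. (i, j) \<in> S \<longrightarrow>
     (i, j - 1) \<in> S \<and>
     (a (l0 + of_int i) (m0 + of_int j) \<noteq> 0 \<longrightarrow> (i, j + 1) \<in> S) \<and>
     (b (l0 + of_int i) (m0 + of_int j) \<noteq> 0 \<longrightarrow> (i + 1, j) \<in> S) \<and>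
     (s (l0 + of_int i) (m0 + of_int j) \<noteq> 0 \<longrightarrow> (i - 1, j) \<in> S))"

lemma lookup_coord_span: "v \<in> coord_span S \<Longrightarrow> lookup v (l0 + of_int i, m0 + of_int j) \<noteq> 0 \<Longrightarrow> (i, j) \<in> S"
proof -
  assume "v \<in> coord_span S" "lookup v (l0 + of_int i, m0 + of_int j) \<noteq> 0"
  then have "pt (i, j) \<in> pt ` S" unfolding coord_span_def by auto
  then show "(i, j) \<in> S" by (auto simp: inj_pt simp del: pt_simp)
qed

lemma act_coord_span:
  assumes S: "act_closed S" and v: "v \<in> coord_span S"
  shows "act g v \<in> coord_span S"
proof -
  have vV: "v \<in> V" using v coord_span_subset_iff[of S UNIV] by (auto simp: coord_span_UNIV)
  have XD: "(i, j) \<in> S \<Longrightarrow> (i, j - 1) \<in> S"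
    "(i, j) \<in> S \<Longrightarrow> a (l0 + of_int i) (m0 + of_int j) \<noteq> 0 \<Longrightarrow> (i, j + 1) \<in> S"
    "(i, j) \<in> S \<Longrightarrow> b (l0 + of_int i) (m0 + of_int j) \<noteq> 0 \<Longrightarrow> (i + 1, j) \<in> S"
    "(i, j) \<in> S \<Longrightarrow> s (l0 + of_int i) (m0 + of_int j) \<noteq> 0 \<Longrightarrow> (i - 1, j) \<in> S" for i j
    using S unfolding act_closed_def by blast+
  have "k \<in> pt ` S" if nz: "lookup (act g v) k \<noteq> 0" for k
  proof -
    obtain i j where k: "k = pt (i, j)"
      using V_act[OF vV, of g] nz unfolding V_iff_pt by (metis (no_types, lifting) imageE surj_pair)
    define l m where "l = l0 + of_int i" "m = m0 + of_int j"
    note lm = this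
    have nz': "lookup (act g v) (l, m) \<noteq> 0" using nz by (simp add: k lm)
    have inX: "(i', j') \<in> S" if "lookup v (l', m') \<noteq> 0" "l' = l0 + of_int i'" "m' = m0 + of_int j'" for i' j' l' m'
      using lookup_coord_span[OF v] that by blast
    have "(i, j) \<in> S"
    proof (cases g)
      case I21
      then have "lookup v (l, m) \<noteq> 0" using nz' by (auto simp: lookup_gen_act_I21)
      then show ?thesis using inX lm by blast
    next
      case I32
      then have "a l (m - 1) \<noteq> 0 \<and> lookup v (l, m - 1) \<noteq> 0 \<or> lookup v (l, m + 1) \<noteq> 0"
        using nz' by (auto simp: lookup_gen_act_I32)
      then show ?thesis
      proof
        assume "a l (m - 1) \<noteq> 0 \<and> lookup v (l, m - 1) \<noteq> 0"
        then show ?thesis using inX[of l "m - 1" i "j - 1"] XD(2)[of i "j - 1"] by (simp add: lm algebra_simps)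
      next
        assume "lookup v (l, m + 1) \<noteq> 0"
        then show ?thesis using inX[of l "m + 1" i "j + 1"] XD(1)[of i "j + 1"] by (simp add: lm)
      qed
    next
      case I43
      then have "b (l - 1) m \<noteq> 0 \<and> lookup v (l - 1, m) \<noteq> 0 \<or> s (l + 1) m \<noteq> 0 \<and> lookup v (l + 1, m) \<noteq> 0
          \<or> lookup v (l, m) \<noteq> 0"
        using nz' by (auto simp: lookup_gen_act_I43)
      then show ?thesis
      proof (elim disjE)
        assume "b (l - 1) m \<noteq> 0 \<and> lookup v (l - 1, m) \<noteq> 0"
        then show ?thesis using inX[of "l - 1" m "i - 1" j] XD(3)[of "i - 1" j] by (simp add: lm algebra_simps)
      next
        assume "s (l + 1) m \<noteq> 0 \<and> lookup v (l + 1, m) \<noteq> 0"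
        then show ?thesis using inX[of "l + 1" m "i + 1" j] XD(4)[of "i + 1" j] by (simp add: lm algebra_simps)
      next
        assume "lookup v (l, m) \<noteq> 0"
        then show ?thesis using inX lm by blast
      qed
    qed
    then show ?thesis unfolding k by blast
  qed
  then show ?thesis unfolding coord_span_def by blast
qed

lemma submodule_coord_span:
  assumes "act_closed S" shows "submodule (coord_span S) U VV"
proof (rule submodule_VVI)
  show "coord_span S \<subseteq> V" using coord_span_subset_iff[of S UNIV] by (simp add: coord_span_UNIV)
  show "0 \<in> coord_span S" by (simp add: coord_span_def)
  show "v + w \<in> coord_span S" if "v \<in> coord_span S" "w \<in> coord_span S" for v w
    using that by (auto simp: coord_span_def lookup_add) (metis add.right_neutral)
  show "vscale x v \<in> coord_span S" if "v \<in> coord_span S" for v x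
    using that by (auto simp: coord_span_def lookup_vscale)
  show "act g v \<in> coord_span S" if "v \<in> coord_span S" for v g
    by (rule act_coord_span) fact+
qed

lemma submodule_imp_coord_span:
  assumes Nsub: "submodule N U VV"
  obtains S where "act_closed S" "N = coord_span S"
proof -
  note N = submodule_VVD[OF Nsub]
  define S where "S = {x. Poly_Mapping.single (pt x) 1 \<in> N}"
  have inX: "(i, j) \<in> S" if "v \<in> N" "lookup v (l0 + of_int i, m0 + of_int j) \<noteq> 0" for v i j
    using submodule_basis_vector[OF Nsub that] by (simp add: S_def)
  have "act_closed S"
    unfolding act_closed_def
  proof (intro allI impI conjI)
    fix i j assume "(i, j) \<in> S"
    define v where "v = Poly_Mapping.single (pt (i, j)) (1 :: complex)"
    have vN: "v \<in> N" using \<open>(i, j) \<in> S\<close> unfolding S_def v_def by blast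
    have lv: "lookup v (l, m) = (if l = l0 + of_int i \<and> m = m0 + of_int j then 1 else 0)" for l m
      by (auto simp: v_def lookup_single when_def)
    show "(i, j - 1) \<in> S"
      by (rule inX[OF N(5)[OF vN, of I32]]) (simp add: lookup_gen_act_I32 lv)
    show "(i, j + 1) \<in> S" if "a (l0 + of_int i) (m0 + of_int j) \<noteq> 0"
      by (rule inX[OF N(5)[OF vN, of I32]]) (use that in \<open>simp add: lookup_gen_act_I32 lv\<close>)
    show "(i + 1, j) \<in> S" if "b (l0 + of_int i) (m0 + of_int j) \<noteq> 0"
      by (rule inX[OF N(5)[OF vN, of I43]]) (use that in \<open>simp add: lookup_gen_act_I43 lv\<close>)
    show "(i - 1, j) \<in> S" if "s (l0 + of_int i) (m0 + of_int j) \<noteq> 0"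
      by (rule inX[OF N(5)[OF vN, of I43]]) (use that in \<open>simp add: lookup_gen_act_I43 lv\<close>)
  qed
  moreover have "N = coord_span S"
  proof
    show "N \<subseteq> coord_span S"
    proof
      fix v assume v: "v \<in> N"
      have "k \<in> pt ` S" if "lookup v k \<noteq> 0" for k
      proof -
        have "k \<in> range pt" using that v N(1) V_iff_pt by blast
        then obtain i j where "k = pt (i, j)" by auto
        with inX[OF v, of i j] that have "k = pt (i, j)" "(i, j) \<in> S" by auto
        then show ?thesis by (rule image_eqI)
      qed
      then show "v \<in> coord_span S" by (simp add: coord_span_def)
    qed
    show "coord_span S \<subseteq> N"
    proof
      fix v assume v: "v \<in> coord_span S"
      have "(\<Sum>k\<in>A. vscale (lookup v k) (Poly_Mapping.single k 1)) \<in> N" if "A \<subseteq> keys v" for A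
        using finite_subset[OF that finite_keys] that
      proof (induction A rule: finite_induct)
        case empty
        then show ?case by (simp add: N(2))
      next
        case (insert k A)
        then have "k \<in> pt ` S" using v unfolding coord_span_def mem_Collect_eq in_keys_iff[symmetric] by blast
        then have "vscale (lookup v k) (Poly_Mapping.single k 1) \<in> N"
          by (auto simp: S_def intro: N(4) simp del: pt_simp)
        with insert show ?case by (simp add: N(3))
      qed
      moreover have "v = (\<Sum>k\<in>keys v. vscale (lookup v k) (Poly_Mapping.single k 1))"
        by (rule poly_mapping_eqI) (simp add: lookup_sum lookup_vscale
            sum_keys_lookup_single[where f = "\<lambda>k. k" and \<phi> = "\<lambda>_. 1", OF refl])
      ultimately show "v \<in> N" by (metis order_refl)
    qed
  qed
  ultimately show ?thesis using that by blast
qed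

end

section \<open>Walls in the lattice\<close>

text \<open>
  Think of \<open>P\<close> as a set that cannot be left or entered by steps inside \<open>D\<close>. Every row of \<open>D\<close> is
  unbounded in the direction \<open>\<sigma>\<close>, so two points in the same or in adjacent rows can be moved in this
  direction until they share a column; rows at a greater distance are joined through those in between.
\<close>

lemma region_connected:
  fixes D P :: "(int \<times> int) set" and \<sigma> :: int
  assumes sigma: "\<sigma> = 1 \<or> \<sigma> = - 1"
    and horiz: "\<And>i j. (i, j) \<in> D \<Longrightarrow> (i, j + 1) \<in> D \<Longrightarrow> (i, j) \<in> P \<longleftrightarrow> (i, j + 1) \<in> P"
    and vert: "\<And>i j. (i, j) \<in> D \<Longrightarrow> (i + 1, j) \<in> D \<Longrightarrow> (i, j) \<in> P \<longleftrightarrow> (i + 1, j) \<in> P"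
    and ray: "\<And>i j. (i, j) \<in> D \<Longrightarrow> (i, j + \<sigma>) \<in> D"
    and rows: "\<And>i i' k j j'. (i, j) \<in> D \<Longrightarrow> (i', j') \<in> D \<Longrightarrow> i \<le> k \<Longrightarrow> k \<le> i' \<Longrightarrow> \<exists>j''. (k, j'') \<in> D"
    and xy: "x \<in> D" "y \<in> D"
  shows "x \<in> P \<longleftrightarrow> y \<in> P"
proof -
  have step: "(i, j + \<sigma> * int n) \<in> D \<and> ((i, j + \<sigma> * int n) \<in> P \<longleftrightarrow> (i, j) \<in> P)" if "(i, j) \<in> D" for i j n
  proof (induction n)
    case 0
    then show ?case using that by simp
  next
    case (Suc n)
    let ?k = "j + \<sigma> * int n"
    have k: "(i, ?k) \<in> D" "(i, ?k + \<sigma>) \<in> D" using Suc ray by blast+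
    have "(i, ?k) \<in> P \<longleftrightarrow> (i, ?k + \<sigma>) \<in> P"
      using sigma
    proof
      assume "\<sigma> = 1"
      then show ?thesis using horiz[of i ?k] k by simp
    next
      assume "\<sigma> = - 1"
      then show ?thesis using horiz[of i "?k + \<sigma>"] k by simp
    qed
    moreover have "j + \<sigma> * int (Suc n) = ?k + \<sigma>" by (simp add: algebra_simps)
    ultimately show ?case using Suc k by metis
  qed
  have meet: "\<exists>n n'. j + \<sigma> * int n = j' + \<sigma> * int n'" for j j' :: int
  proof -
    have "j + \<sigma> * int (nat (\<sigma> * (j' - j))) = j' + \<sigma> * int (nat (\<sigma> * (j - j')))"
      using sigma by auto
    then show ?thesis by blast
  qed
  have row: "(i, j) \<in> P \<longleftrightarrow> (i, j') \<in> P" if "(i, j) \<in> D" "(i, j') \<in> D" for i j j'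
  proof -
    obtain n n' where n: "j + \<sigma> * int n = j' + \<sigma> * int n'" using meet by blast
    show ?thesis using step[OF that(1), of n] step[OF that(2), of n'] unfolding n by blast
  qed
  have adj: "(i, j) \<in> P \<longleftrightarrow> (i + 1, j') \<in> P" if "(i, j) \<in> D" "(i + 1, j') \<in> D" for i j j'
  proof -
    obtain n n' where n: "j + \<sigma> * int n = j' + \<sigma> * int n'" using meet by blast
    show ?thesis
      using step[OF that(1), of n] step[OF that(2), of n'] vert[of i "j' + \<sigma> * int n'"]
      unfolding n by blast
  qed
  have up: "\<forall>j j'. (i, j) \<in> D \<longrightarrow> (i + int n, j') \<in> D \<longrightarrow> ((i, j) \<in> P \<longleftrightarrow> (i + int n, j') \<in> P)" for i n
  proof (induction n)
    case 0
    show ?case unfolding of_nat_0 add_0_right using row by blast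
  next
    case (Suc n)
    show ?case
    proof (intro allI impI)
      fix j j' assume 1: "(i, j) \<in> D" "(i + int (Suc n), j') \<in> D"
      obtain k where k: "(i + int n, k) \<in> D"
        using rows[OF 1, of "i + int n"] by auto
      have e: "i + int (Suc n) = i + int n + 1" by simp
      have "(i, j) \<in> P \<longleftrightarrow> (i + int n, k) \<in> P" using Suc 1(1) k by blast
      also have "\<dots> \<longleftrightarrow> (i + int (Suc n), j') \<in> P"
        using adj[OF k] 1(2) unfolding e by blast
      finally show "(i, j) \<in> P \<longleftrightarrow> (i + int (Suc n), j') \<in> P" .
    qed
  qed
  have le: "(i, j) \<in> P \<longleftrightarrow> (i', j') \<in> P" if "(i, j) \<in> D" "(i', j') \<in> D" "i \<le> i'" for i j i' j'
  proof -
    have "i + int (nat (i' - i)) = i'" using that(3) by simp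
    with up[of i "nat (i' - i)"] that(1,2) show ?thesis by metis
  qed
  obtain i j i' j' where e: "x = (i, j)" "y = (i', j')" by (metis surj_pair)
  show ?thesis
    using le[of i j i' j'] le[of i' j' i j] xy linear[of i i'] unfolding e by blast
qed

definition down_set :: "int set \<Rightarrow> bool" where
  "down_set J \<longleftrightarrow> (\<forall>i k. i \<in> J \<longrightarrow> k \<le> i \<longrightarrow> k \<in> J)"

text \<open>
  A zero of the vertical coefficient is encoded by the set of rows from which it cannot be crossed
  upwards; this is all of \<open>\<int>\<close> when there is no zero. With this encoding no case distinction on the
  existence of the zero is needed later.
\<close>

lemma wall_exists:
  assumes "\<And>i i'. z i \<Longrightarrow> z i' \<Longrightarrow> i = i'"
  obtains J where "down_set J" "\<And>i. z i \<longleftrightarrow> i \<in> J \<and> i + 1 \<notin> J"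
proof
  let ?J = "{i. \<forall>k. z k \<longrightarrow> i \<le> k}"
  show "down_set ?J" by (auto simp: down_set_def)
  show "z i \<longleftrightarrow> i \<in> ?J \<and> i + 1 \<notin> ?J" for i
  proof
    assume "z i"
    then have "i \<le> k" if "z k" for k using assms[OF _ that, of i] by simp
    moreover have "\<not> i + 1 \<le> i" by simp
    ultimately show "i \<in> ?J \<and> i + 1 \<notin> ?J" using \<open>z i\<close> by blast
  next
    assume "i \<in> ?J \<and> i + 1 \<notin> ?J"
    then obtain k where "z k" "\<not> i + 1 \<le> k" "i \<le> k" by auto
    then have "k = i" by simp
    with \<open>z k\<close> show "z i" by simp
  qed
qed

text \<open>
  Here \<open>zs\<close> and \<open>zt\<close> are the zero sets of \<open>[l - m]\<close> and \<open>[l + m + 1]\<close>, as functions of \<open>i - j\<close> and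
  \<open>i + j\<close>. The set \<open>W\<close> is the side of the wall that cannot be left. The first condition bounds it by a
  curve with \<open>W\<close> on its left, the next three say that the blocked moves to the right, down and up are
  precisely those that leave \<open>W\<close>, and the last two that \<open>W\<close> and, if nonempty, its complement meet
  every row.
\<close>

definition diagonal_wall :: "(int \<Rightarrow> bool) \<Rightarrow> (int \<Rightarrow> bool) \<Rightarrow> (int \<times> int) set \<Rightarrow> bool" where
  "diagonal_wall zs zt W \<longleftrightarrow>
     (\<forall>i j. (i, j) \<in> W \<longrightarrow> (i, j - 1) \<in> W) \<and>
     (\<forall>i j. zs (i - j) \<or> zt (i + j) \<longleftrightarrow> (i, j) \<in> W \<and> (i, j + 1) \<notin> W) \<and>
     (\<forall>i j. zs (i - j) \<longleftrightarrow> (i, j) \<in> W \<and> (i - 1, j) \<notin> W) \<and>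
     (\<forall>i j. zt (i + j) \<longleftrightarrow> (i, j) \<in> W \<and> (i + 1, j) \<notin> W) \<and>
     (\<forall>i. \<exists>j. (i, j) \<in> W) \<and>
     (\<forall>i j i'. (i, j) \<notin> W \<longrightarrow> (\<exists>j'. (i', j') \<notin> W))"

lemma diagonal_wall_exists:
  fixes zs zt :: "int \<Rightarrow> bool"
  assumes zs: "\<And>i i'. zs i \<Longrightarrow> zs i' \<Longrightarrow> i = i'" and zt: "\<And>i i'. zt i \<Longrightarrow> zt i' \<Longrightarrow> i = i'"
    and not_both: "\<And>i i'. zs i \<Longrightarrow> zt i' \<Longrightarrow> False"
  shows "\<exists>W. diagonal_wall zs zt W"
proof -
  consider (none) "\<And>d. \<not> zs d" "\<And>e. \<not> zt e" | (s) \<alpha> where "zs \<alpha>" "\<And>e. \<not> zt e"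
    | (t) \<beta> where "zt \<beta>" "\<And>d. \<not> zs d"
    using not_both by blast
  then show ?thesis
  proof cases
    case none
    then show ?thesis by (intro exI[of _ UNIV]) (simp add: diagonal_wall_def)
  next
    case s
    have "zs d \<longleftrightarrow> d = \<alpha>" for d using zs s(1) by blast
    with s(2) show ?thesis
      unfolding diagonal_wall_def by (intro exI[of _ "{(i, j). i - j \<ge> \<alpha>}"] conjI; simp; presburger)
  next
    case t
    have "zt e \<longleftrightarrow> e = \<beta>" for e using zt t(1) by blast
    with t(2) show ?thesis
      unfolding diagonal_wall_def by (intro exI[of _ "{(i, j). i + j \<le> \<beta>}"] conjI; simp; presburger)
  qed
qed

context so4_rep begin

text \<open>
  The zeros of the coefficients in integer coordinates: \<open>zp\<close> and \<open>zr\<close> are the rows at which \<open>b\<close> vanishes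
  because of a factor with \<open>p\<close> or with \<open>r\<close>.
\<close>

definition zs :: "int \<Rightarrow> bool" where "zs d \<longleftrightarrow> [l0 - m0 + of_int d]\<^sub>q = 0"
definition zt :: "int \<Rightarrow> bool" where "zt e \<longleftrightarrow> [l0 + m0 + of_int e + 1]\<^sub>q = 0"
definition zp :: "int \<Rightarrow> bool" where
  "zp i \<longleftrightarrow> [p + (l0 + of_int i) + 2]\<^sub>q = 0 \<or> [p - (l0 + of_int i)]\<^sub>q = 0"
definition zr :: "int \<Rightarrow> bool" where
  "zr i \<longleftrightarrow> [l0 + of_int i + r + 1]\<^sub>q = 0 \<or> [l0 + of_int i - r + 1]\<^sub>q = 0"

lemma br_zero_unique:
  assumes "[x + of_int i]\<^sub>q = 0" "[x + of_int i']\<^sub>q = 0"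
  shows "i = i'"
proof -
  have "qpow h (2 * (x + of_int i)) = qpow h (2 * (x + of_int i'))"
    using assms by (simp add: br_eq_0_iff)
  moreover have "2 * (x + of_int i) - 2 * (x + of_int i') = of_int (2 * (i - i'))" by simp
  then have "2 * (x + of_int i) - 2 * (x + of_int i') \<in> \<int>" by (metis Ints_of_int)
  ultimately have "2 * (x + of_int i) = 2 * (x + of_int i')" by (metis qpow_int_eq_1)
  then show ?thesis by simp
qed

text \<open>
  If \<open>q\<^sup>2\<^sup>x = q\<^sup>2\<^sup>y = 1\<close> then \<open>q\<^sup>4\<^sup>l\<^sup>0\<^sup>+\<^sup>2\<^sup>k = 1\<close>. Thus there is at most one wall of each kind.
\<close>

lemma br_zero_not_both:
  assumes "[x]\<^sub>q = 0" "[y]\<^sub>q = 0" "x + y = 2 * l0 + of_int k"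
  shows False
proof -
  have "qpow h (2 * x + 2 * y) = 1"
    using assms(1,2) unfolding qpow_add br_eq_0_iff by simp
  moreover have "2 * x + 2 * y = 4 * l0 + 2 * of_int k"
    using arg_cong[OF assms(3), of "\<lambda>z. 2 * z"] by (simp add: algebra_simps)
  ultimately show False using l_generic2 by metis
qed

lemma zs_unique: "zs i \<Longrightarrow> zs i' \<Longrightarrow> i = i'"
  unfolding zs_def by (rule br_zero_unique)

lemma zt_unique: "zt i \<Longrightarrow> zt i' \<Longrightarrow> i = i'"
  unfolding zt_def using br_zero_unique[of "l0 + m0 + 1" i i'] by (simp add: add_ac)

lemma zs_zt_False: "zs i \<Longrightarrow> zt i' \<Longrightarrow> False"
  unfolding zs_def zt_def
  by (rule br_zero_not_both[where k = "i + i' + 1"], assumption, assumption) simp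

lemma zp_unique: "zp i \<Longrightarrow> zp i' \<Longrightarrow> i = i'"
proof -
  have 1: "[p + (l0 + of_int i) + 2]\<^sub>q = 0 \<longleftrightarrow> [p + l0 + 2 + of_int i]\<^sub>q = 0" for i
    by (simp add: add_ac)
  have 2: "[p - (l0 + of_int i)]\<^sub>q = 0 \<longleftrightarrow> [l0 - p + of_int i]\<^sub>q = 0" for i
    using br_minus_diff[of p "l0 + of_int i"] by (simp add: algebra_simps)
  have 3: False if "[p + l0 + 2 + of_int i]\<^sub>q = 0" "[l0 - p + of_int i']\<^sub>q = 0" for i i'
    by (rule br_zero_not_both[OF that, of "i + i' + 2"]) simp
  show "zp i \<Longrightarrow> zp i' \<Longrightarrow> i = i'"
    unfolding zp_def 1 2 using 3 br_zero_unique by blast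
qed

lemma zr_unique: "zr i \<Longrightarrow> zr i' \<Longrightarrow> i = i'"
proof -
  have 1: "[l0 + of_int i + r + 1]\<^sub>q = 0 \<longleftrightarrow> [l0 + r + 1 + of_int i]\<^sub>q = 0" for i
    by (simp add: add_ac)
  have 2: "[l0 + of_int i - r + 1]\<^sub>q = 0 \<longleftrightarrow> [l0 - r + 1 + of_int i]\<^sub>q = 0" for i
    by (simp add: algebra_simps)
  have 3: False if "[l0 + r + 1 + of_int i]\<^sub>q = 0" "[l0 - r + 1 + of_int i']\<^sub>q = 0" for i i'
    by (rule br_zero_not_both[OF that, of "i + i' + 2"]) simp
  show "zr i \<Longrightarrow> zr i' \<Longrightarrow> i = i'"
    unfolding zr_def 1 2 using 3 br_zero_unique by blast
qed

lemma s_zero_iff: "s (l0 + of_int i) (m0 + of_int j) = 0 \<longleftrightarrow> zs (i - j)"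
  by (simp add: zs_def algebra_simps)

lemma t_zero_iff: "[l0 + of_int i + (m0 + of_int j) + 1]\<^sub>q = 0 \<longleftrightarrow> zt (i + j)"
  by (simp add: zt_def algebra_simps)

lemma a_zero_iff: "a (l0 + of_int i) (m0 + of_int j) = 0 \<longleftrightarrow> zs (i - j) \<or> zt (i + j)"
proof -
  have "in_M (m0 + of_int j)" by (simp add: in_M_def)
  then have "invD (m0 + of_int j) \<noteq> 0" "invD (m0 + of_int j + 1) \<noteq> 0"
    using invD[of "m0 + of_int j"] invD[of "m0 + of_int j + 1"] by auto
  then show ?thesis unfolding a_eq mult_eq_0_iff t_zero_iff s_zero_iff by blast
qed

lemma b_zero_iff: "b (l0 + of_int i) (m0 + of_int j) = 0 \<longleftrightarrow> zp i \<or> zr i \<or> zt (i + j)"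
proof -
  define l where "l = l0 + of_int i"
  have "in_L l" by (simp add: in_L_def l_def)
  then have "[l + 1]\<^sub>q \<noteq> 0" "[2 * l + 1]\<^sub>q \<noteq> 0" "[2 * l + 3]\<^sub>q \<noteq> 0"
    using br_l_nonzero[of "l + 1"] br_2l_nonzero[of l 1] br_2l_nonzero[of l 3] by simp_all
  then have "ff l = 0 \<longleftrightarrow> zp i \<or> zr i"
    unfolding ff_def zp_def zr_def l_def[symmetric] by simp
  then show ?thesis
    unfolding b_eq mult_eq_0_iff t_zero_iff l_def by blast
qed

lemma act_closed_iff:
  "act_closed A \<longleftrightarrow> (\<forall>i j. (i, j) \<in> A \<longrightarrow> (i, j - 1) \<in> A \<and>
     (\<not> zs (i - j) \<longrightarrow> \<not> zt (i + j) \<longrightarrow> (i, j + 1) \<in> A) \<and>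
     (\<not> zp i \<longrightarrow> \<not> zr i \<longrightarrow> \<not> zt (i + j) \<longrightarrow> (i + 1, j) \<in> A) \<and>
     (\<not> zs (i - j) \<longrightarrow> (i - 1, j) \<in> A))"
  unfolding act_closed_def a_zero_iff b_zero_iff s_zero_iff by blast

lemma act_closed_Int: "act_closed A \<Longrightarrow> act_closed B \<Longrightarrow> act_closed (A \<inter> B)"
  unfolding act_closed_iff by blast

lemma act_closed_Un: "act_closed A \<Longrightarrow> act_closed B \<Longrightarrow> act_closed (A \<union> B)"
  unfolding act_closed_iff by blast

lemma act_closed_trivial: "act_closed {}" "act_closed UNIV"
  unfolding act_closed_iff by blast+

lemma act_closed_rows:
  assumes "down_set J" "\<And>i. i \<in> J \<Longrightarrow> i + 1 \<notin> J \<Longrightarrow> zp i \<or> zr i"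
  shows "act_closed (J \<times> UNIV)"
proof -
  have "i - 1 \<in> J" if "i \<in> J" for i
    using assms(1)[unfolded down_set_def, rule_format, OF that, of "i - 1"] by simp
  then show ?thesis using assms(2) unfolding act_closed_iff by blast
qed

end

section \<open>Length and irreducibility\<close>

context so4_rep begin

lemma act_closed_diagonal: "diagonal_wall zs zt W \<Longrightarrow> act_closed W"
  unfolding diagonal_wall_def act_closed_iff by blast

text \<open>
  A layer \<open>B - A\<close> that is one side of the diagonal wall in a strip \<open>J\<close> of rows without a horizontal
  wall inside is strongly connected, so a closed set between \<open>A\<close> and \<open>B\<close> contains all of the layer or
  nothing of it.
\<close>

lemma no_closed_between:
  assumes W: "diagonal_wall zs zt W"
    and J: "\<And>i k i'. i \<in> J \<Longrightarrow> i' \<in> J \<Longrightarrow> i \<le> k \<Longrightarrow> k \<le> i' \<Longrightarrow> k \<in> J"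
      "\<And>i. i \<in> J \<Longrightarrow> i + 1 \<in> J \<Longrightarrow> \<not> zp i \<and> \<not> zr i"
    and D: "B - A = {(i, j). i \<in> J \<and> ((i, j) \<in> W \<longleftrightarrow> t)}"
    and K: "act_closed K" "A \<subseteq> K" "K \<subseteq> B"
  shows "K = A \<or> K = B"
proof -
  note W = W[unfolded diagonal_wall_def]
  have W_rows: "\<exists>j. (i, j) \<in> W" for i using W by blast
  have coW_rows: "(i, j) \<notin> W \<Longrightarrow> \<exists>j'. (i', j') \<notin> W" for i j i' using W by blast
  note K' = K(1)[unfolded act_closed_iff]
  have in_D: "(i, j) \<in> B - A \<longleftrightarrow> i \<in> J \<and> ((i, j) \<in> W \<longleftrightarrow> t)" for i j
    unfolding D by simp
  have "x \<in> K \<longleftrightarrow> y \<in> K" if "x \<in> B - A" "y \<in> B - A" for x y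
  \<comment> \<open>The left neighbour of a point of \<open>W\<close> is in \<open>W\<close>, and the right neighbour of a point outside is outside.\<close>
  proof (rule region_connected[where D = "B - A" and \<sigma> = "if t then - 1 else 1"])
    show "(i, j) \<in> K \<longleftrightarrow> (i, j + 1) \<in> K" if "(i, j) \<in> B - A" "(i, j + 1) \<in> B - A" for i j
    proof
      assume "(i, j) \<in> K"
      moreover have "\<not> zs (i - j) \<and> \<not> zt (i + j)" using W that unfolding in_D by blast
      ultimately show "(i, j + 1) \<in> K" using K' by blast
    next
      assume "(i, j + 1) \<in> K"
      then have "(i, j + 1 - 1) \<in> K" using K' by blast
      then show "(i, j) \<in> K" by simp
    qed
    show "(i, j) \<in> K \<longleftrightarrow> (i + 1, j) \<in> K" if "(i, j) \<in> B - A" "(i + 1, j) \<in> B - A" for i j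
    proof
      assume "(i, j) \<in> K"
      moreover have "\<not> zt (i + j)" using W that unfolding in_D by blast
      moreover have "\<not> zp i" "\<not> zr i" using J(2) that unfolding in_D by blast+
      ultimately show "(i + 1, j) \<in> K" using K' by blast
    next
      assume 1: "(i + 1, j) \<in> K"
      have "zs (i + 1 - j) \<longleftrightarrow> (i + 1, j) \<in> W \<and> (i + 1 - 1, j) \<notin> W" using W by blast
      then have "\<not> zs (i + 1 - j)" using that unfolding in_D by auto
      then have "(i + 1 - 1, j) \<in> K" using K' 1 by blast
      then show "(i, j) \<in> K" by simp
    qed
    show "(i, j + (if t then - 1 else 1)) \<in> B - A" if "(i, j) \<in> B - A" for i j
    proof (cases t)
      case True
      have "(i, j - 1) \<in> W" using W that True unfolding in_D by blast
      then show ?thesis using that True unfolding in_D by simp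
    next
      case False
      have "(i, j + 1) \<in> W \<longrightarrow> (i, j + 1 - 1) \<in> W" using W by blast
      then show ?thesis using that False unfolding in_D by auto
    qed
    show "\<exists>j''. (k, j'') \<in> B - A"
      if "(i, j) \<in> B - A" "(i', j') \<in> B - A" "i \<le> k" "k \<le> i'" for i i' k j j'
    proof -
      have "k \<in> J" using J(1) that unfolding in_D by blast
      moreover have "\<exists>j''. (k, j'') \<in> W \<longleftrightarrow> t"
      proof (cases t)
        case True
        then show ?thesis using W_rows by blast
      next
        case False
        then have "(i, j) \<notin> W" using that(1) unfolding in_D by blast
        then show ?thesis using coW_rows False by blast
      qed
      ultimately show ?thesis unfolding in_D by blast
    qed
  qed (use that in auto)
  then show ?thesis using K(2,3) by blast
qed

text \<open>
  The sets \<open>P\<close> and \<open>R\<close> of rows below the two horizontal walls are comparable, and \<open>P \<inter> R \<subseteq> P \<union> R\<close> lists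
  them in increasing order. The chain adds the three strips from the bottom to the top, in each of
  them first the part in \<open>W\<close> and then the rest.
\<close>

lemma length_at_most_6: "\<exists>n\<le>6. has_length U VV n"
proof -
  obtain P where P: "down_set P" "\<And>i. zp i \<longleftrightarrow> i \<in> P \<and> i + 1 \<notin> P"
    using wall_exists[of zp] zp_unique by blast
  obtain R where R: "down_set R" "\<And>i. zr i \<longleftrightarrow> i \<in> R \<and> i + 1 \<notin> R"
    using wall_exists[of zr] zr_unique by blast
  obtain W where W: "diagonal_wall zs zt W"
    using diagonal_wall_exists[of zs zt] zs_unique zt_unique zs_zt_False by blast
  define A where "A = (P \<inter> R) \<times> (UNIV :: int set)"
  define B where "B = (P \<union> R) \<times> (UNIV :: int set)"
  define C where "C = (!) [{}, A \<inter> W, A, A \<union> (B \<inter> W), B, B \<union> W, UNIV]"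
  have "act_closed A" "act_closed B"
    unfolding A_def B_def using P R by (intro act_closed_rows; auto simp: down_set_def)+
  then have closed: "act_closed (C i)" if "i \<le> 6" for i
  proof -
    have "i = 0 \<or> i = 1 \<or> i = 2 \<or> i = 3 \<or> i = 4 \<or> i = 5 \<or> i = 6" using that by linarith
    then show ?thesis
      using \<open>act_closed A\<close> \<open>act_closed B\<close> act_closed_diagonal[OF W]
      by (elim disjE) (simp_all add: C_def act_closed_Int act_closed_Un act_closed_trivial)
  qed
  have layer: "\<exists>J t. C (Suc i) - C i = {(i, j). i \<in> J \<and> ((i, j) \<in> W \<longleftrightarrow> t)} \<and> J \<in> {P \<inter> R, (P \<union> R) - (P \<inter> R), - (P \<union> R)}"
    if "i < 6" for i
  proof -
    consider "i = 0" | "i = 1" | "i = 2" | "i = 3" | "i = 4" | "i = 5" using \<open>i < 6\<close> by linarith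
    then show ?thesis
    proof cases
      case 1
      then show ?thesis by (intro exI[of _ "P \<inter> R"] exI[of _ True]) (auto simp: C_def A_def)
    next
      case 2
      then show ?thesis by (intro exI[of _ "P \<inter> R"] exI[of _ False]) (auto simp: C_def A_def)
    next
      case 3
      then show ?thesis
        by (intro exI[of _ "(P \<union> R) - (P \<inter> R)"] exI[of _ True]) (auto simp: C_def A_def B_def)
    next
      case 4
      then show ?thesis
        by (intro exI[of _ "(P \<union> R) - (P \<inter> R)"] exI[of _ False]) (auto simp: C_def A_def B_def)
    next
      case 5
      then show ?thesis by (intro exI[of _ "- (P \<union> R)"] exI[of _ True]) (auto simp: C_def B_def)
    next
      case 6
      then show ?thesis by (intro exI[of _ "- (P \<union> R)"] exI[of _ False]) (auto simp: C_def B_def)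
    qed
  qed
  have mono: "C i \<subseteq> C (Suc i)" if "i < 6" for i
  proof -
    have "i = 0 \<or> i = 1 \<or> i = 2 \<or> i = 3 \<or> i = 4 \<or> i = 5" using that by linarith
    then show ?thesis by (elim disjE) (auto simp: C_def A_def B_def)
  qed
  have strip: "(\<forall>i k i'. i \<in> J \<longrightarrow> i' \<in> J \<longrightarrow> i \<le> k \<longrightarrow> k \<le> i' \<longrightarrow> k \<in> J) \<and> (\<forall>i. i \<in> J \<longrightarrow> i + 1 \<in> J \<longrightarrow> \<not> zp i \<and> \<not> zr i)"
    if "J \<in> {P \<inter> R, (P \<union> R) - (P \<inter> R), - (P \<union> R)}" for J
  proof -
    have "k \<in> P" if "i \<in> P" "k \<le> i" for i k using P(1) that unfolding down_set_def by blast
    moreover have "k \<in> R" if "i \<in> R" "k \<le> i" for i k using R(1) that unfolding down_set_def by blast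
    moreover have "i \<le> i + 1" for i :: int by simp
    ultimately show ?thesis
      using that unfolding P(2) R(2) by blast
  qed
  show ?thesis
  proof (rule has_length_if_chain[OF VV_left_module, where G = "\<lambda>i. coord_span (C i)"])
    show "coord_span (C 0) = {\<zero>\<^bsub>VV\<^esub>}" by (simp add: C_def coord_span_empty VV_simps)
    show "coord_span (C 6) = carrier VV" by (simp add: C_def coord_span_UNIV VV_simps)
    show "submodule (coord_span (C i)) U VV" if "i \<le> 6" for i
      by (rule submodule_coord_span[OF closed[OF that]])
    show "coord_span (C i) \<subseteq> coord_span (C (Suc i))" if "i < 6" for i
      using mono[OF that] by (simp add: coord_span_subset_iff)
    show "K = coord_span (C i) \<or> K = coord_span (C (Suc i))"
      if i: "i < 6" and K: "submodule K U VV" "coord_span (C i) \<subseteq> K" "K \<subseteq> coord_span (C (Suc i))" for i K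
    proof -
      obtain K' where K': "act_closed K'" "K = coord_span K'" using submodule_imp_coord_span[OF K(1)] by blast
      obtain J t where J: "C (Suc i) - C i = {(i, j). i \<in> J \<and> ((i, j) \<in> W \<longleftrightarrow> t)}"
        "J \<in> {P \<inter> R, (P \<union> R) - (P \<inter> R), - (P \<union> R)}"
        using layer[OF i] by blast
      have "K' = C i \<or> K' = C (Suc i)"
        using strip[OF J(2)] K(2,3) unfolding K'(2) coord_span_subset_iff
        by (intro no_closed_between[OF W _ _ J(1) K'(1)]) blast+
      then show ?thesis using K'(2) by blast
    qed
  qed
qed

lemma irreducible_without_walls:
  assumes "\<And>k. \<not> zs k" "\<And>k. \<not> zt k" "\<And>k. \<not> zp k" "\<And>k. \<not> zr k"
  shows "irreducible_module U VV"
proof -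
  have W: "diagonal_wall zs zt UNIV"
    using assms(1,2) by (simp add: diagonal_wall_def)
  have "N = {0} \<or> N = V" if N: "submodule N U VV" for N
  proof -
    obtain K where K: "act_closed K" "N = coord_span K" using submodule_imp_coord_span[OF N] by blast
    have "K = {} \<or> K = UNIV"
      by (rule no_closed_between[OF W, where J = UNIV and t = True, OF _ _ _ K(1)])
        (use assms in auto)
    then show ?thesis using K(2) coord_span_empty coord_span_UNIV by metis
  qed
  moreover have "V \<noteq> {0}"
    using coord_span_subset_iff[of UNIV "{}"] unfolding coord_span_UNIV coord_span_empty by auto
  ultimately show ?thesis
    unfolding irreducible_module_def VV_simps using VV_left_module by blast
qed

end

text \<open>
  \<open>exp (h n) = 1\<close> means \<open>h n = 2 \<pi> \<i> k\<close> for an integer \<open>k\<close>.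
\<close>

lemma q_generic_if_irrational:
  assumes "h \<notin> range (\<lambda>t :: rat. 2 * complex_of_real pi * \<i> * of_rat t)"
  shows "q_generic h"
proof
  fix n :: int assume n: "n \<noteq> 0"
  show "qpow h (of_int n) \<noteq> 1"
  proof
    assume "qpow h (of_int n) = 1"
    then have e: "exp (h * of_int n) = 1" by (simp add: qpow_def)
    then have re: "Re (h * of_int n) = 0"
      using norm_exp_eq_Re[of "h * of_int n"] by simp
    have "Re (exp (h * of_int n)) = 1" by (simp add: e)
    then have "cos (Im (h * of_int n)) = 1" unfolding Re_exp re by simp
    then obtain k :: int where "Im (h * of_int n) = of_int k * (2 * pi)"
      unfolding cos_one_2pi_int by (auto simp: mult_ac)
    with re have k: "h * of_int n = of_int k * (2 * of_real pi * \<i>)"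
      by (simp add: complex_eq_iff)
    have "h = 2 * complex_of_real pi * \<i> * of_rat (of_int k / of_int n)"
      using n k by (simp add: of_rat_divide field_simps)
    then show False using assms by blast
  qed
qed

theorem theorem4p3:
  fixes h p r l0 m0 :: complex
  assumes "h \<notin> range (\<lambda>t :: rat. 2 * complex_of_real pi * \<i> * of_rat t)"
    and "\<And>k :: int. qpow h (2 * m0 + of_int k) \<noteq> - 1"
    and "\<And>k :: int. qpow h (2 * l0 + 2 * of_int k) \<noteq> 1"
    and "\<And>k :: int. qpow h (4 * l0 + 2 * of_int k) \<noteq> 1"
  shows "(\<exists>n\<le>6. has_length (Uq_tw_so4 h) (Vrep h p r l0 m0) n) \<and>
    ((\<forall>k :: int.
        qpow h (2 * p + 2 * l0 + 2 * of_int k) \<noteq> 1 \<and>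
        qpow h (2 * p - 2 * l0 + 2 * of_int k) \<noteq> 1 \<and>
        qpow h (2 * l0 + 2 * r + 2 * of_int k) \<noteq> 1 \<and>
        qpow h (2 * l0 - 2 * r + 2 * of_int k) \<noteq> 1 \<and>
        qpow h (2 * l0 + 2 * m0 + 2 * of_int k) \<noteq> 1 \<and>
        qpow h (2 * l0 - 2 * m0 + 2 * of_int k) \<noteq> 1)
      \<longrightarrow> irreducible_module (Uq_tw_so4 h) (Vrep h p r l0 m0))"
proof -
  interpret q_generic h by (rule q_generic_if_irrational) fact
  interpret so4_rep h p r l0 m0 by unfold_locales (fact assms)+
  have "irreducible_module (Uq_tw_so4 h) (Vrep h p r l0 m0)"
    if generic: "\<forall>k :: int.
        qpow h (2 * p + 2 * l0 + 2 * of_int k) \<noteq> 1 \<and>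
        qpow h (2 * p - 2 * l0 + 2 * of_int k) \<noteq> 1 \<and>
        qpow h (2 * l0 + 2 * r + 2 * of_int k) \<noteq> 1 \<and>
        qpow h (2 * l0 - 2 * r + 2 * of_int k) \<noteq> 1 \<and>
        qpow h (2 * l0 + 2 * m0 + 2 * of_int k) \<noteq> 1 \<and>
        qpow h (2 * l0 - 2 * m0 + 2 * of_int k) \<noteq> 1"
  proof (rule irreducible_without_walls)
    have nz: "[x]\<^sub>q \<noteq> 0" if "2 * x = y + 2 * of_int k" "qpow h (y + 2 * of_int k) \<noteq> 1" for x y k
      using that by (simp add: br_eq_0_iff)
    fix k
    show "\<not> zs k"
      unfolding zs_def by (rule nz[of _ "2 * l0 - 2 * m0" k]) (use generic in \<open>simp_all add: algebra_simps\<close>)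
    show "\<not> zt k"
      unfolding zt_def using generic[rule_format, of "k + 1"]
      by (intro nz[of _ "2 * l0 + 2 * m0" "k + 1"]) (simp_all add: algebra_simps)
    show "\<not> zp k"
      unfolding zp_def de_Morgan_disj
      using generic[rule_format, of "k + 2"] generic[rule_format, of "- k"]
      by (intro conjI nz[of "p + (l0 + of_int k) + 2" "2 * p + 2 * l0" "k + 2"]
          nz[of "p - (l0 + of_int k)" "2 * p - 2 * l0" "- k"]) (simp_all add: algebra_simps)
    show "\<not> zr k"
      unfolding zr_def de_Morgan_disj
      using generic[rule_format, of "k + 1"]
      by (intro conjI nz[of "l0 + of_int k + r + 1" "2 * l0 + 2 * r" "k + 1"]
          nz[of "l0 + of_int k - r + 1" "2 * l0 - 2 * r" "k + 1"]) (simp_all add: algebra_simps)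
  qed
  with length_at_most_6 show ?thesis by blast
qed

end
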